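(* Let $\mathcal J_0,\mathcal J_T\in\mathcal L(H,H)$ be symmetric positive semidefinite with $\mathcal J_0$ invertible. Let $\mathcal P(s)\in\mathcal L(H,H)$ be the symmetric positive semidefinite solution of $$\frac{d}{ds}\mathcal P+\mathcal P\mathcal F+\mathcal F^*\mathcal P-\mathcal PGN^{-1}G^*\mathcal P+\mathcal M=0,\qquad \mathcal P(T)=\mathcal J_T,$$ and let $\Phi_{\mathcal F,\mathcal P}(s,t)$, $s\ge t$, be the evolution operator on $H$ defined by $\frac{d}{ds}\Phi_{\mathcal F,\mathcal P}(s,t)=(\mathcal F(s)-GN^{-1}G^*\mathcal P(s))\Phi_{\mathcal F,\mathcal P}(s,t)$, $\Phi_{\mathcal F,\mathcal P}(t,t)=\mathrm{Id}_H$. Define for $s,t\in[0,T]$ $$K(s,t)=\Phi_{\mathcal F,\mathcal P}(s,0)(\mathcal J_0+\mathcal P(0))^{-1}\Phi^*_{\mathcal F,\mathcal P}(t,0)+\int_0^{\min(s,t)}\Phi_{\mathcal F,\mathcal P}(s,\tau)G(\tau)N^{-1}(\tau)G^*(\tau)\Phi^*_{\mathcal F,\mathcal P}(t,\tau)\,d\tau\in\mathcal L(H,H).$$ Let $\mathcal H$ be the space of $X(\cdot)\in L^2(0,T;H)$ such that $\frac{dX}{ds}=\mathcal F(s)X(s)+G(s)V(s)$ for some $V\in L^2(0,T;U)$, equipped with $$\|X(\cdot)\|^2_{\mathcal H}=(\mathcal J_0X(0),X(0))_H+(\mathcal J_TX(T),X(T))_H+\int_0^T(\mathcal M(s)X(s),X(s))_H\,ds+\int_0^T(N(s)V(s),V(s))_U\,ds,$$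 where $V$ is the representative control of $X$. Then $\mathcal H$ is an $H$-valued reproducing kernel Hilbert space with $\mathcal L(H,H)$-valued reproducing kernel $K$: for every $t\in[0,T]$ and $Z\in H$, $K(\cdot,t)Z\in\mathcal H$, and for every $X(\cdot)\in\mathcal H$, $(X(t),Z)_H=(X(\cdot),K(\cdot,t)Z)_{\mathcal H}$.
   Context: Let $m$ be a probability measure on $\mathbb R^n$, $H=L^2_m(\mathbb R^n;\mathbb R^n)$, $U=L^2_m(\mathbb R^n;\mathbb R^d)$ with the $L^2_m$ inner products, $\bar X=\int X_x\,dm(x)$. Data $F,\bar F,M,\bar M,S\in L^\infty(0,T;\mathbb R^{n\times n})$ ($M,\bar M$ symmetric), $G\in L^\infty(0,T;\mathbb R^{n\times d})$, $N$ symmetric positive definite with $N,N^{-1}\in L^\infty$. With $\bar M_S=S^*\bar MS-S^*\bar M-\bar MS$, define operators on $H$: $(\mathcal F(s)X)_x=F(s)X_x+\bar F(s)\bar X$, $(G(s)V)_x=G(s)V_x$, $(\mathcal M(s)X)_x=(M+\bar M)X_x+\bar M_S\bar X$; assume $M+\bar M$ and $M+\bar M+\bar M_S$ positive semidefinite for all $s$. Representative control: among all $V$ generating the same trajectory $X$ (they differ by $W$ with $G(s)W(s)=0$), the unique one minimizing $(N(s)V(s),V(s))_U$ for each $s$, characterized by $(N(s)V(s),W(s))_U=0$ for all $W$ with $G(s)W(s)=0$. The inner product of $\mathcal H$ is the one associated with the norm, computed with representative controls. *)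

theory Defs
  imports "HOL-Analysis.Analysis"
begin

definition sym_op :: "('a::real_inner \<Rightarrow> 'a) \<Rightarrow> bool" where
  "sym_op A \<longleftrightarrow> (\<forall>x y. inner (A x) y = inner x (A y))"

definition psd_op :: "('a::real_inner \<Rightarrow> 'a) \<Rightarrow> bool" where
  "psd_op A \<longleftrightarrow> (\<forall>x. 0 \<le> inner (A x) x)"

definition op_family_Linf ::
  "real \<Rightarrow> (real \<Rightarrow> 'a::real_normed_vector \<Rightarrow> 'b::real_normed_vector) \<Rightarrow> bool" where
  "op_family_Linf T A \<longleftrightarrow>
     (\<forall>s\<in>{0..T}. bounded_linear (A s)) \<and> (\<exists>C. \<forall>s\<in>{0..T}. onorm (A s) \<le> C) \<and>
     (\<forall>x. (\<lambda>s. A s x) \<in> borel_measurable (restrict_space lborel {0..T}))"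

definition closed_loop ::
  "(real \<Rightarrow> 'h::real_inner \<Rightarrow> 'h) \<Rightarrow> (real \<Rightarrow> 'u::real_inner \<Rightarrow> 'h) \<Rightarrow> (real \<Rightarrow> 'u \<Rightarrow> 'u)
    \<Rightarrow> (real \<Rightarrow> 'h \<Rightarrow> 'h) \<Rightarrow> real \<Rightarrow> 'h \<Rightarrow> 'h" where
  "closed_loop F G N P s Y = F s Y - G s (inv (N s) (adjoint (G s) (P s Y)))"

text \<open>Right-hand side R so that the Riccati equation reads dP/ds = - R.\<close>
definition riccati_rhs ::
  "(real \<Rightarrow> 'h::real_inner \<Rightarrow> 'h) \<Rightarrow> (real \<Rightarrow> 'u::real_inner \<Rightarrow> 'h) \<Rightarrow> (real \<Rightarrow> 'u \<Rightarrow> 'u)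
    \<Rightarrow> (real \<Rightarrow> 'h \<Rightarrow> 'h) \<Rightarrow> (real \<Rightarrow> 'h \<Rightarrow> 'h) \<Rightarrow> real \<Rightarrow> 'h \<Rightarrow> 'h" where
  "riccati_rhs F G N M P s X =
     P s (F s X) + adjoint (F s) (P s X) - P s (G s (inv (N s) (adjoint (G s) (P s X)))) + M s X"

definition riccati_solution ::
  "real \<Rightarrow> (real \<Rightarrow> 'h::{real_inner,banach,second_countable_topology} \<Rightarrow> 'h)
    \<Rightarrow> (real \<Rightarrow> 'u::real_inner \<Rightarrow> 'h) \<Rightarrow> (real \<Rightarrow> 'u \<Rightarrow> 'u)
    \<Rightarrow> (real \<Rightarrow> 'h \<Rightarrow> 'h) \<Rightarrow> ('h \<Rightarrow> 'h) \<Rightarrow> (real \<Rightarrow> 'h \<Rightarrow> 'h) \<Rightarrow> bool" where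
  "riccati_solution T F G N M JT P \<longleftrightarrow>
     (\<forall>s\<in>{0..T}. \<forall>X.
        set_integrable lborel {s..T} (\<lambda>\<tau>. riccati_rhs F G N M P \<tau> X) \<and>
        P s X = JT X + set_lebesgue_integral lborel {s..T} (\<lambda>\<tau>. riccati_rhs F G N M P \<tau> X))"

definition evolution_op ::
  "real \<Rightarrow> (real \<Rightarrow> 'h::{real_inner,banach,second_countable_topology} \<Rightarrow> 'h)
    \<Rightarrow> (real \<Rightarrow> real \<Rightarrow> 'h \<Rightarrow> 'h) \<Rightarrow> bool" where
  "evolution_op T A Phi \<longleftrightarrow>
     (\<forall>t s. 0 \<le> t \<and> t \<le> s \<and> s \<le> T \<longrightarrow> bounded_linear (Phi s t) \<and>
        (\<forall>X. set_integrable lborel {t..s} (\<lambda>\<tau>. A \<tau> (Phi \<tau> t X)) \<and>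
             Phi s t X = X + set_lebesgue_integral lborel {t..s} (\<lambda>\<tau>. A \<tau> (Phi \<tau> t X))))"

definition rk_kernel ::
  "('h::{real_inner,banach,second_countable_topology} \<Rightarrow> 'h) \<Rightarrow> (real \<Rightarrow> 'h \<Rightarrow> 'h)
    \<Rightarrow> (real \<Rightarrow> 'u::real_inner \<Rightarrow> 'h) \<Rightarrow> (real \<Rightarrow> 'u \<Rightarrow> 'u)
    \<Rightarrow> (real \<Rightarrow> real \<Rightarrow> 'h \<Rightarrow> 'h) \<Rightarrow> real \<Rightarrow> real \<Rightarrow> 'h \<Rightarrow> 'h" where
  "rk_kernel J0 P G N Phi s t Z =
     Phi s 0 (inv (\<lambda>x. J0 x + P 0 x) (adjoint (Phi t 0) Z)) +
     set_lebesgue_integral lborel {0..min s t}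
       (\<lambda>\<tau>. Phi s \<tau> (G \<tau> (inv (N \<tau>) (adjoint (G \<tau>) (adjoint (Phi t \<tau>) Z)))))"

definition state_eq ::
  "real \<Rightarrow> (real \<Rightarrow> 'h::{real_inner,banach,second_countable_topology} \<Rightarrow> 'h)
    \<Rightarrow> (real \<Rightarrow> 'u::{real_inner,banach,second_countable_topology} \<Rightarrow> 'h)
    \<Rightarrow> (real \<Rightarrow> 'h) \<Rightarrow> (real \<Rightarrow> 'u) \<Rightarrow> bool" where
  "state_eq T F G X V \<longleftrightarrow>
     V \<in> borel_measurable (restrict_space lborel {0..T}) \<and>
     set_integrable lborel {0..T} (\<lambda>s. (norm (V s))\<^sup>2) \<and>
     X \<in> borel_measurable (restrict_space lborel {0..T}) \<and>
     set_integrable lborel {0..T} (\<lambda>s. (norm (X s))\<^sup>2) \<and>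
     (\<forall>s\<in>{0..T}. set_integrable lborel {0..s} (\<lambda>\<tau>. F \<tau> (X \<tau>) + G \<tau> (V \<tau>)) \<and>
        X s = X 0 + set_lebesgue_integral lborel {0..s} (\<lambda>\<tau>. F \<tau> (X \<tau>) + G \<tau> (V \<tau>)))"

definition Hspace ::
  "real \<Rightarrow> (real \<Rightarrow> 'h::{real_inner,banach,second_countable_topology} \<Rightarrow> 'h)
    \<Rightarrow> (real \<Rightarrow> 'u::{real_inner,banach,second_countable_topology} \<Rightarrow> 'h) \<Rightarrow> (real \<Rightarrow> 'h) set" where
  "Hspace T F G = {X. \<exists>V. state_eq T F G X V}"

definition rep_control ::
  "real \<Rightarrow> (real \<Rightarrow> 'h::{real_inner,banach,second_countable_topology} \<Rightarrow> 'h)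
    \<Rightarrow> (real \<Rightarrow> 'u::{real_inner,banach,second_countable_topology} \<Rightarrow> 'h) \<Rightarrow> (real \<Rightarrow> 'u \<Rightarrow> 'u)
    \<Rightarrow> (real \<Rightarrow> 'h) \<Rightarrow> (real \<Rightarrow> 'u) \<Rightarrow> bool" where
  "rep_control T F G N X V \<longleftrightarrow> state_eq T F G X V \<and>
     (AE s in lborel. s \<in> {0..T} \<longrightarrow> (\<forall>w. G s w = 0 \<longrightarrow> inner (N s (V s)) w = 0))"

definition H_inner ::
  "real \<Rightarrow> (real \<Rightarrow> 'h::{real_inner,banach,second_countable_topology} \<Rightarrow> 'h)
    \<Rightarrow> (real \<Rightarrow> 'u::{real_inner,banach,second_countable_topology} \<Rightarrow> 'h) \<Rightarrow> (real \<Rightarrow> 'u \<Rightarrow> 'u)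
    \<Rightarrow> (real \<Rightarrow> 'h \<Rightarrow> 'h) \<Rightarrow> ('h \<Rightarrow> 'h) \<Rightarrow> ('h \<Rightarrow> 'h)
    \<Rightarrow> (real \<Rightarrow> 'h) \<Rightarrow> (real \<Rightarrow> 'h) \<Rightarrow> real" where
  "H_inner T F G N M J0 JT X Y =
     (let VX = (SOME V. rep_control T F G N X V); VY = (SOME V. rep_control T F G N Y V) in
       inner (J0 (X 0)) (Y 0) + inner (JT (X T)) (Y T)
       + set_lebesgue_integral lborel {0..T} (\<lambda>s. inner (M s (X s)) (Y s))
       + set_lebesgue_integral lborel {0..T} (\<lambda>s. inner (N s (VX s)) (VY s)))"

text \<open>S (functions on [0,T], identified when equal on [0,T]) with the form ip is a
  real Hilbert space.\<close>
definition hilbert_fn_space ::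
  "real \<Rightarrow> (real \<Rightarrow> 'h::real_normed_vector) set \<Rightarrow> ((real \<Rightarrow> 'h) \<Rightarrow> (real \<Rightarrow> 'h) \<Rightarrow> real) \<Rightarrow> bool" where
  "hilbert_fn_space T S ip \<longleftrightarrow>
     (\<lambda>_. 0) \<in> S \<and> (\<forall>X\<in>S. \<forall>Y\<in>S. (\<lambda>s. X s + Y s) \<in> S) \<and> (\<forall>X\<in>S. \<forall>c. (\<lambda>s. c *\<^sub>R X s) \<in> S) \<and>
     (\<forall>X\<in>S. \<forall>Y\<in>S. ip X Y = ip Y X) \<and>
     (\<forall>X\<in>S. \<forall>Y\<in>S. \<forall>Z\<in>S. ip (\<lambda>s. X s + Y s) Z = ip X Z + ip Y Z) \<and>
     (\<forall>X\<in>S. \<forall>Y\<in>S. \<forall>c. ip (\<lambda>s. c *\<^sub>R X s) Y = c * ip X Y) \<and>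
     (\<forall>X\<in>S. 0 \<le> ip X X \<and> (ip X X = 0 \<longrightarrow> (\<forall>s\<in>{0..T}. X s = 0))) \<and>
     (\<forall>Xs. (\<forall>n. Xs n \<in> S) \<and>
           (\<forall>e>0. \<exists>N. \<forall>m\<ge>N. \<forall>n\<ge>N. ip (\<lambda>s. Xs m s - Xs n s) (\<lambda>s. Xs m s - Xs n s) < e)
        \<longrightarrow> (\<exists>X\<in>S. (\<lambda>n. ip (\<lambda>s. Xs n s - X s) (\<lambda>s. Xs n s - X s)) \<longlonglongrightarrow> 0))"

definition RKHS_with_kernel ::
  "real \<Rightarrow> (real \<Rightarrow> 'h::real_inner) set \<Rightarrow> ((real \<Rightarrow> 'h) \<Rightarrow> (real \<Rightarrow> 'h) \<Rightarrow> real)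
    \<Rightarrow> (real \<Rightarrow> real \<Rightarrow> 'h \<Rightarrow> 'h) \<Rightarrow> bool" where
  "RKHS_with_kernel T S ip K \<longleftrightarrow> hilbert_fn_space T S ip \<and>
     (\<forall>t\<in>{0..T}. \<forall>Z. (\<lambda>s. K s t Z) \<in> S \<and> (\<forall>X\<in>S. inner (X t) Z = ip X (\<lambda>s. K s t Z)))"

end

theory Submission
  imports Defs
begin

text \<open>
  With the feedback \<open>Q = N\<^sup>-\<^sup>1 G\<^sup>* P\<close>, the substitution \<open>u = V + Q X\<close> turns the state equation into
  \<open>X' = A X + G u\<close> for the closed loop \<open>A = F - G Q\<close>, and completing the square with the Riccati
  equation gives
  \<open>(X, Y)\<^sub>H = ((J\<^sub>0 + P(0)) X(0), Y(0)) + \<integral> (N u\<^sub>X, u\<^sub>Y)\<close>.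
  Hence \<open>X \<mapsto> (X(0), u\<^sub>X)\<close> is an isometry onto a closed subspace of \<open>H \<times> L\<^sup>2\<close>, whose inverse is the
  variation of constants formula for \<open>\<Phi>\<close>; this gives completeness. The kernel section \<open>K(\<cdot>, t) Z\<close> is the
  trajectory with initial value \<open>(J\<^sub>0 + P(0))\<^sup>-\<^sup>1 \<Phi>(t,0)\<^sup>* Z\<close> and closed-loop control
  \<open>1\<^bsub>\<tau> \<le> t\<^esub> N\<^sup>-\<^sup>1 G\<^sup>* \<Phi>(t,\<tau>)\<^sup>* Z\<close>, so pairing it with \<open>X\<close> reproduces the variation of constants
  formula for \<open>(X(t), Z)\<close>.
\<close>

section \<open>Operators on Hilbert spaces\<close>

text \<open>All equations are given in integrated form, applied to one vector at a time, with
  coefficients that are merely measurable in \<open>s\<close>. Hence \<open>(P X, Y)\<close> cannot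
  simply be differentiated: the square is completed through a product rule for integral equations,
  proved by exchanging integrals over a triangle. A second obstacle is that \<open>H_inner\<close>
  picks a representative control by choice, so one must exist as a measurable function and any two
  must agree almost everywhere. Measurability of inverses and of projections onto the kernels of
  \<open>G s\<close> is obtained by writing them as limits of iterations whose iterates are visibly
  measurable. The substitution \<open>u = V + Q X\<close> respects representative controls because
  \<open>N Q X = G* P X\<close> is orthogonal to the kernel of \<open>G\<close>. That orthogonality
  is a pointwise condition, and it survives \<open>L2\<close> limits along an almost everywhere
  convergent subsequence; this is why the subspace is closed. Finally, \<open>Phi s t\<close> is
  constrained only for \<open>t \<le> s\<close>, so every two-parameter integrand is handled on the
  triangle alone.\<close>

lemma riesz_representation:
  fixes \<phi> :: "'a::{real_inner,banach} \<Rightarrow> real"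
  assumes "bounded_linear \<phi>"
  shows "\<exists>a. \<forall>x. \<phi> x = inner x a"
proof -
  interpret bounded_linear \<phi> by fact
  obtain K where K: "\<And>x. \<bar>\<phi> x\<bar> \<le> norm x * K" using bounded by auto
  \<comment> \<open>The representer is found as the minimiser of this functional: its critical point
    equation is \<open>\<phi> x = inner x a\<close>.\<close>
  define J where "J x = (norm x)\<^sup>2 - 2 * \<phi> x" for x
  have J_ge: "J x \<ge> - K\<^sup>2" for x
  proof -
    have "2 * \<phi> x \<le> 2 * (norm x * K)" using K[of x] by linarith
    also have "\<dots> \<le> (norm x)\<^sup>2 + K\<^sup>2" using sum_squares_bound[of "norm x" K] by simp
    finally show ?thesis by (simp add: J_def)
  qed
  define m where "m = Inf (range J)"
  have bdd: "bdd_below (range J)" using J_ge by (auto intro!: bdd_belowI)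
  have m_le: "m \<le> J x" for x unfolding m_def by (rule cInf_lower[OF _ bdd]) auto
  \<comment> \<open>The linear parts cancel and leave the parallelogram law. Since the midpoint has
    value at least \<open>m\<close>, a minimising sequence is Cauchy.\<close>
  have par: "(norm (x - y))\<^sup>2 = 2 * J x + 2 * J y - 4 * J ((1/2) *\<^sub>R (x + y))" for x y
    by (simp add: J_def scale add) (simp add: power2_norm_eq_inner power_divide inner_simps inner_commute field_simps)
  have "\<exists>x. J x < m + 1 / Suc n" for n
    using cInf_lessD[of "range J" "m + 1 / Suc n"] by (auto simp: m_def)
  then obtain f where f: "\<And>n. J (f n) < m + 1 / Suc n" by metis
  have dist: "(norm (f p - f q))\<^sup>2 \<le> 2 / Suc p + 2 / Suc q" for p q
    using par[of "f p" "f q"] f[of p] f[of q] m_le[of "(1/2) *\<^sub>R (f p + f q)"] by simp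
  have "Cauchy f"
  proof (rule metric_CauchyI)
    fix e :: real assume "0 < e"
    then obtain n where n: "4 / e\<^sup>2 < real n" using reals_Archimedean2 by blast
    have "dist (f p) (f q) < e" if "p \<ge> n" "q \<ge> n" for p q
    proof -
      have "0 < n" using n \<open>0 < e\<close> by (cases n) (auto simp: field_simps)
      have "2 / Suc p + 2 / Suc q \<le> 2 / n + 2 / real n"
        using that \<open>0 < n\<close> by (intro add_mono divide_left_mono) auto
      also have "\<dots> < e\<^sup>2" using n \<open>0 < e\<close> \<open>0 < n\<close> by (simp add: field_simps)
      finally have "(norm (f p - f q))\<^sup>2 < e\<^sup>2" using dist[of p q] by simp
      then show ?thesis using \<open>0 < e\<close> by (auto simp: dist_norm dest: power_less_imp_less_base)
    qed
    then show "\<exists>M. \<forall>p\<ge>M. \<forall>q\<ge>M. dist (f p) (f q) < e" by blast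
  qed
  then obtain a where a: "f \<longlonglongrightarrow> a" using Cauchy_convergent_iff convergent_def by blast
  have "(\<lambda>n. J (f n)) \<longlonglongrightarrow> J a" unfolding J_def by (intro tendsto_intros tendsto a)
  moreover have "(\<lambda>n. m + 1 / Suc n) \<longlonglongrightarrow> m + 0"
    by (intro tendsto_intros LIMSEQ_Suc[OF lim_1_over_n])
  ultimately have "J a \<le> m + 0" by (rule LIMSEQ_le) (use f less_imp_le in blast)
  then have min: "J a \<le> J x" for x using m_le[of x] by simp
  have "\<phi> y = inner y a" for y
  proof (rule ccontr)
    assume ne: "\<phi> y \<noteq> inner y a"
    define d where "d = \<phi> y - inner y a"
    have q: "2 * t * d \<le> t\<^sup>2 * (norm y)\<^sup>2" for t
      using min[of "a + t *\<^sub>R y"] unfolding J_def d_def power2_norm_eq_inner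
      by (simp add: scale add inner_simps inner_commute power2_eq_square algebra_simps)
    have "y \<noteq> 0" using ne by (auto simp: zero)
    then have ny: "(norm y)\<^sup>2 > 0" by simp
    \<comment> \<open>This step length minimises \<open>t^2 |y|^2 - 2 t d\<close>, so it exhibits a
      decrease unless \<open>d = 0\<close>.\<close>
    have "2 * (d / (norm y)\<^sup>2) * d \<le> (d / (norm y)\<^sup>2)\<^sup>2 * (norm y)\<^sup>2" by (rule q)
    then have "2 * d\<^sup>2 / (norm y)\<^sup>2 \<le> d\<^sup>2 / (norm y)\<^sup>2" using \<open>y \<noteq> 0\<close> by (simp add: power2_eq_square)
    then have "2 * d\<^sup>2 \<le> d\<^sup>2" using ny by (simp add: divide_le_cancel)
    then show False using ne by (simp add: d_def)
  qed
  then show ?thesis by blast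
qed

text \<open>\<open>adjoint\<close> is defined by choice, so its characteristic identity is available
  only once some function satisfying it is known to exist. The Riesz representation supplies
  one.\<close>

lemma inner_adjoint:
  fixes f :: "'a::{real_inner,banach} \<Rightarrow> 'b::real_inner"
  assumes "bounded_linear f"
  shows "inner x (adjoint f y) = inner (f x) y"
proof -
  have "\<exists>a. \<forall>x. inner (f x) y = inner x a" for y
    by (intro riesz_representation bounded_linear_compose[OF bounded_linear_inner_left assms])
  then have "\<exists>f'. \<forall>x y. inner (f x) y = inner x (f' y)" by metis
  from someI_ex[OF this] show ?thesis unfolding adjoint_def by metis
qed

text \<open>Test the adjoint identity at the vector \<open>adjoint f y\<close> itself and cancel one
  norm. The bound \<open>C\<close> is explicit so that a bound uniform in a parameter carries over
  to the adjoint family.\<close>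

lemma norm_adjoint_le:
  fixes f :: "'a::{real_inner,banach} \<Rightarrow> 'b::real_inner"
  assumes "bounded_linear f" "0 \<le> C" and "\<And>x. norm (f x) \<le> C * norm x"
  shows "norm (adjoint f y) \<le> C * norm y"
proof (cases "adjoint f y = 0")
  case True
  then show ?thesis using assms(2) by simp
next
  case False
  have "(norm (adjoint f y))\<^sup>2 = inner (f (adjoint f y)) y"
    using inner_adjoint[OF assms(1), of "adjoint f y" y] by (simp add: power2_norm_eq_inner)
  also have "\<dots> \<le> norm (f (adjoint f y)) * norm y" by (rule norm_cauchy_schwarz)
  also have "\<dots> \<le> C * norm (adjoint f y) * norm y" by (intro mult_right_mono assms(3)) simp
  finally show ?thesis using False by (simp add: power2_eq_square)
qed

lemma bounded_linear_adjoint: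
  fixes f :: "'a::{real_inner,banach} \<Rightarrow> 'b::real_inner"
  assumes "bounded_linear f"
  shows "bounded_linear (adjoint f)"
proof -
  obtain K where K: "K > 0" "\<And>x. norm (f x) \<le> norm x * K"
    using bounded_linear.pos_bounded[OF assms] by blast
  show ?thesis
  proof (rule bounded_linear_intro[where K = K])
    show "adjoint f (x + y) = adjoint f x + adjoint f y" for x y
      by (subst vector_eq_ldot[symmetric]) (simp add: inner_adjoint assms inner_simps) 
    show "adjoint f (r *\<^sub>R x) = r *\<^sub>R adjoint f x" for r x
      by (subst vector_eq_ldot[symmetric]) (simp add: inner_adjoint assms inner_simps)
    show "norm (adjoint f x) \<le> norm x * K" for x
      using norm_adjoint_le[OF assms, of K x] K less_imp_le by (simp add: mult.commute)
  qed
qed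

text \<open>Baire category: the closed sets on which the whole family is bounded by \<open>n\<close>
  cover the space, so one of them contains a ball. Subtracting the values at \<open>x0 + y\<close>
  and at its centre \<open>x0\<close> moves the bound to a ball around zero at the price of a factor
  2.\<close>

lemma uniform_boundedness:
  fixes A :: "'i \<Rightarrow> 'a::banach \<Rightarrow> 'b::real_normed_vector"
  assumes lin: "\<And>i. i \<in> I \<Longrightarrow> bounded_linear (A i)"
    and pt: "\<And>x. \<exists>B. \<forall>i\<in>I. norm (A i x) \<le> B"
  shows "\<exists>C\<ge>0. \<forall>i\<in>I. \<forall>x. norm (A i x) \<le> C * norm x"
proof -
  define S where "S n = {x. \<forall>i\<in>I. norm (A i x) \<le> real n}" for n
  have cl: "closed (S n)" for n
  proof -
    have "S n = (\<Inter>i\<in>I. {x. norm (A i x) \<le> real n})" by (auto simp: S_def)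
    moreover have "closed {x. norm (A i x) \<le> real n}" if "i \<in> I" for i
      by (intro closed_Collect_le continuous_on_norm continuous_on_const linear_continuous_on lin that)
    ultimately show ?thesis by auto
  qed
  have "(\<Union>n. S n) = UNIV"
  proof -
    have "\<exists>n. x \<in> S n" for x
    proof -
      obtain B where "\<forall>i\<in>I. norm (A i x) \<le> B" using pt by blast
      moreover obtain n where "B \<le> real n" using real_arch_simple by blast
      ultimately have "x \<in> S n" by (auto simp: S_def intro: order_trans)
      then show ?thesis ..
    qed
    then show ?thesis by auto
  qed
  then have "\<exists>n. interior (S n) \<noteq> {}"
    using Baire_category_alt[of "euclidean :: 'a topology" "range S"] cl
    by (force simp: completely_metrizable_space_euclidean)
  then obtain n x0 where "x0 \<in> interior (S n)" by blast
  then obtain e where e: "e > 0" "cball x0 e \<subseteq> S n" by (meson mem_interior_cball)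
  have bd: "norm (A i x) \<le> (2 * real n / e) * norm x" if i: "i \<in> I" for i x
  proof (cases "x = 0")
    case True
    then show ?thesis using lin[OF i] by (simp add: linear_simps)
  next
    case False
    interpret bounded_linear "A i" by (rule lin[OF i])
    define y where "y = (e / norm x) *\<^sub>R x"
    have "x0 + y \<in> S n" using e False by (intro subsetD[OF e(2)]) (simp add: y_def dist_norm)
    moreover have "x0 \<in> S n" using e by (intro subsetD[OF e(2)]) simp
    ultimately have "norm (A i (x0 + y)) \<le> n" "norm (A i x0) \<le> n" using i by (auto simp: S_def)
    moreover have "A i y = A i (x0 + y) - A i x0" by (simp add: add)
    ultimately have "norm (A i y) \<le> 2 * real n" using norm_triangle_ineq4[of "A i (x0 + y)" "A i x0"] by simp
    then have "e / norm x * norm (A i x) \<le> 2 * real n" using e by (simp add: y_def scale)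
    then show ?thesis using False e(1) by (simp add: field_simps)
  qed
  show ?thesis
    using bd e(1) by (intro exI[of _ "2 * real n / e"]) auto
qed

text \<open>The polynomial \<open>t |-> (A (x + t y), x + t y)\<close> is nonnegative, so its
  discriminant is not positive. As the form may be degenerate, the leading coefficient can vanish;
  then the polynomial is affine and its slope must be zero.\<close>

lemma psd_cauchy_schwarz:
  assumes lin: "bounded_linear A" and sym: "sym_op A" and psd: "psd_op A"
  shows "(inner (A x) y)\<^sup>2 \<le> inner (A x) x * inner (A y) y"
proof -
  interpret bounded_linear A by fact
  define a b c where "a = inner (A y) y" and "b = inner (A x) y" and "c = inner (A x) x"
  have s: "inner (A y) x = b" using sym by (metis b_def sym_op_def inner_commute)
  have nn: "0 \<le> a" "0 \<le> c" using psd by (auto simp: a_def c_def psd_op_def)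
  have q: "0 \<le> c + 2 * t * b + t\<^sup>2 * a" for t
  proof -
    have "0 \<le> inner (A (x + t *\<^sub>R y)) (x + t *\<^sub>R y)" using psd by (simp add: psd_op_def)
    also have "\<dots> = c + 2 * t * b + t\<^sup>2 * a"
      using s by (simp add: add scale inner_simps a_def b_def c_def power2_eq_square algebra_simps)
    finally show ?thesis .
  qed
  have "b\<^sup>2 \<le> c * a"
  proof (cases "a = 0")
    case True
    have "b = 0"
    proof (rule ccontr)
      assume "b \<noteq> 0"
      \<comment> \<open>At this \<open>t\<close> the affine function \<open>c + 2 t b\<close> takes
        the value -1.\<close>
      then show False using q[of "- (c + 1) / (2 * b)"] True nn by (simp add: field_simps)
    qed
    then show ?thesis using True by simp
  next
    case False
    have "0 \<le> c + 2 * (- b / a) * b + (- b / a)\<^sup>2 * a" by (rule q)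
    then show ?thesis using False nn by (simp add: field_simps power2_eq_square)
  qed
  then show ?thesis by (simp add: a_def b_def c_def)
qed

text \<open>Hellinger--Toeplitz: the inverse is symmetric and everywhere defined, hence bounded by the
  uniform boundedness principle.\<close>
lemma psd_bij_coercive:
  fixes A :: "'a::{real_inner,banach} \<Rightarrow> 'a"
  assumes lin: "bounded_linear A" and sym: "sym_op A" and psd: "psd_op A" and bij: "bij A"
  shows "\<exists>c>0. \<forall>x. c * (norm x)\<^sup>2 \<le> inner (A x) x"
proof -
  have AB: "A (inv A x) = x" for x using bij by (simp add: bij_is_surj surj_f_inv_f)
  have BA: "inv A (A x) = x" for x using bij by (simp add: bij_is_inj)
  have symB: "inner (inv A x) y = inner x (inv A y)" for x y
    using sym unfolding sym_op_def by (metis AB)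
  \<comment> \<open>The functionals are indexed by \<open>y\<close> in the unit ball. At a fixed
    \<open>x\<close> they are bounded because symmetry moves the inverse onto \<open>x\<close>;
    continuity of \<open>inv A\<close> is the outcome, not an ingredient.\<close>
  have "\<exists>C\<ge>0. \<forall>y\<in>cball 0 1. \<forall>x. norm (inner x (inv A y)) \<le> C * norm x"
  proof (rule uniform_boundedness)
    fix x
    have "norm (inner x (inv A y)) \<le> norm (inv A x)" if "y \<in> cball 0 1" for y
    proof -
      have "norm (inner x (inv A y)) \<le> norm (inv A x) * norm y"
        unfolding symB[symmetric] by (simp add: Cauchy_Schwarz_ineq2)
      also have "\<dots> \<le> norm (inv A x) * 1" using that by (intro mult_left_mono) auto
      finally show ?thesis by simp
    qed
    then show "\<exists>B. \<forall>y\<in>cball 0 1. norm (inner x (inv A y)) \<le> B" by blast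
  qed (rule bounded_linear_inner_left)
  then obtain C where C: "C \<ge> 0" "\<And>y x. norm y \<le> 1 \<Longrightarrow> \<bar>inner x (inv A y)\<bar> \<le> C * norm x" by force
  have low: "norm x \<le> C * norm (A x)" for x
  proof (cases "x = 0")
    case False
    interpret bounded_linear A by fact
    have "A x \<noteq> 0" using False BA[of x] BA[of 0] by (auto simp: zero)
    define y where "y = (1 / norm (A x)) *\<^sub>R A x"
    have iy: "inv A y = (1 / norm (A x)) *\<^sub>R x"
      using BA[of "(1 / norm (A x)) *\<^sub>R x"] by (simp add: y_def scale)
    have "\<bar>inner x (inv A y)\<bar> \<le> C * norm x" by (rule C) (use \<open>A x \<noteq> 0\<close> in \<open>simp add: y_def\<close>)
    then have "(norm x)\<^sup>2 \<le> C * norm x * norm (A x)"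
      using \<open>A x \<noteq> 0\<close> by (simp add: iy power2_norm_eq_inner[symmetric] field_simps)
    then show ?thesis using False by (simp add: power2_eq_square mult.assoc mult.left_commute)
  qed (use C in auto)
  obtain K where K: "K > 0" "\<And>x. norm (A x) \<le> norm x * K" using bounded_linear.pos_bounded[OF lin] by blast
  \<comment> \<open>A lower bound on \<open>|A x|\<close> is turned into one on
    \<open>(A x, x)\<close>: Cauchy-Schwarz for the form at \<open>x\<close> and \<open>A x\<close>
    gives \<open>|A x|^4 \<le> (A x, x) K |A x|^2\<close>. The summand 1 keeps the constant positive
    when \<open>C = 0\<close>.\<close>
  have "(norm x)\<^sup>2 \<le> (C\<^sup>2 * K + 1) * inner (A x) x" for x
  proof -
    have nn: "0 \<le> inner (A x) x" using psd by (simp add: psd_op_def)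
    have "((norm (A x))\<^sup>2)\<^sup>2 \<le> inner (A x) x * inner (A (A x)) (A x)"
      using psd_cauchy_schwarz[OF lin sym psd, of x "A x"] by (simp add: power2_norm_eq_inner)
    also have "\<dots> \<le> inner (A x) x * (K * (norm (A x))\<^sup>2)"
    proof (intro mult_left_mono nn)
      have "inner (A (A x)) (A x) \<le> norm (A (A x)) * norm (A x)" by (rule norm_cauchy_schwarz)
      also have "\<dots> \<le> norm (A x) * K * norm (A x)" by (intro mult_right_mono K) simp
      finally show "inner (A (A x)) (A x) \<le> K * (norm (A x))\<^sup>2" by (simp add: power2_eq_square mult_ac)
    qed
    finally have *: "(norm (A x))\<^sup>2 * (norm (A x))\<^sup>2 \<le> (norm (A x))\<^sup>2 * (K * inner (A x) x)"
      by (simp add: power2_eq_square mult_ac)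
    have "(norm (A x))\<^sup>2 \<le> K * inner (A x) x"
    proof (cases "A x = 0")
      case False
      then show ?thesis using mult_left_le_imp_le[OF *] by simp
    qed simp
    moreover have "(norm x)\<^sup>2 \<le> C\<^sup>2 * (norm (A x))\<^sup>2"
      using power_mono[OF low[of x], of 2] by (simp add: power_mult_distrib)
    ultimately have "(norm x)\<^sup>2 \<le> C\<^sup>2 * (K * inner (A x) x)"
      by (meson mult_left_mono order_trans zero_le_power2)
    then show ?thesis using nn by (simp add: algebra_simps)
  qed
  moreover have "C\<^sup>2 * K + 1 > 0" using K(1) by (simp add: add_nonneg_pos)
  ultimately show ?thesis
    by (intro exI[of _ "1 / (C\<^sup>2 * K + 1)"]) (auto simp: field_simps)
qed

text \<open>Richardson iteration with step \<open>c / C\<^sup>2\<close>.\<close>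
lemma coercive_contraction:
  fixes A :: "'a::real_inner \<Rightarrow> 'a"
  assumes lin: "bounded_linear A" and c: "0 < c" "\<And>x. c * (norm x)\<^sup>2 \<le> inner (A x) x"
    and C: "0 < C" "\<And>x. norm (A x) \<le> C * norm x" and cC: "c \<le> C"
  shows "norm (x - (c / C\<^sup>2) *\<^sub>R A x) \<le> sqrt (1 - (c / C)\<^sup>2) * norm x"
proof (rule power2_le_imp_le)
  have "(norm (x - (c / C\<^sup>2) *\<^sub>R A x))\<^sup>2 = (norm x)\<^sup>2 - 2 * (c / C\<^sup>2) * inner (A x) x + (c / C\<^sup>2)\<^sup>2 * (norm (A x))\<^sup>2"
    unfolding power2_norm_eq_inner by (simp add: inner_simps inner_commute power2_eq_square)
  also have "\<dots> \<le> (norm x)\<^sup>2 - 2 * (c / C\<^sup>2) * (c * (norm x)\<^sup>2) + (c / C\<^sup>2)\<^sup>2 * (C\<^sup>2 * (norm x)\<^sup>2)"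
    using c C power_mono[OF C(2)[of x], of 2]
    by (intro add_mono diff_mono mult_left_mono order_refl) (auto simp: power_mult_distrib)
  also have "\<dots> = (1 - (c / C)\<^sup>2) * (norm x)\<^sup>2"
    using C(1) by (simp add: power_divide power2_eq_square) (simp add: field_simps)
  also have "\<dots> = (sqrt (1 - (c / C)\<^sup>2) * norm x)\<^sup>2"
    using c C cC by (simp add: power_mult_distrib power_le_one)
  finally show "(norm (x - (c / C\<^sup>2) *\<^sub>R A x))\<^sup>2 \<le> (sqrt (1 - (c / C)\<^sup>2) * norm x)\<^sup>2" .
  show "0 \<le> sqrt (1 - (c / C)\<^sup>2) * norm x" using c C cC by (simp add: power_le_one)
qed

text \<open>Solving \<open>A x = y\<close> is a fixed point problem for
  \<open>x |-> x + (c / C^2) (y - A x)\<close>, a contraction by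
  \<open>coercive_contraction\<close>; this gives surjectivity. Coercivity at a difference gives
  injectivity.\<close>

lemma coercive_bij:
  fixes A :: "'a::{real_inner,banach} \<Rightarrow> 'a"
  assumes lin: "bounded_linear A" and c: "0 < c" "\<And>x. c * (norm x)\<^sup>2 \<le> inner (A x) x"
  shows "bij A"
proof -
  interpret bounded_linear A by fact
  obtain K where K: "K > 0" "\<And>x. norm (A x) \<le> norm x * K" using pos_bounded by blast
  \<comment> \<open>The maximum enforces \<open>c \<le> C\<close>, so that
    \<open>1 - (c / C)^2\<close> lies in \<open>[0, 1)\<close> and its square root is a contraction
    factor.\<close>
  define C where "C = max c K"
  have C: "0 < C" "c \<le> C" "norm (A x) \<le> C * norm x" for x
    using K(1) K(2)[of x] mult_left_mono[of K C "norm x"] c(1) by (auto simp: C_def mult.commute)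
  define q where "q = sqrt (1 - (c / C)\<^sup>2)"
  have contr: "norm (x - (c / C\<^sup>2) *\<^sub>R A x) \<le> q * norm x" for x
    unfolding q_def by (rule coercive_contraction[OF lin c C(1,3,2)])
  have q: "0 \<le> q" "q < 1" using c C(1,2) by (auto simp: q_def power_le_one)
  have "\<exists>x. A x = y" for y
  proof -
    have "\<exists>!x. x + (c / C\<^sup>2) *\<^sub>R (y - A x) = x"
    proof (rule banach_fix_type[OF q], intro allI)
      fix u v
      have e: "u + (c / C\<^sup>2) *\<^sub>R (y - A u) - (v + (c / C\<^sup>2) *\<^sub>R (y - A v)) = (u - v) - (c / C\<^sup>2) *\<^sub>R A (u - v)"
        by (simp add: diff algebra_simps)
      show "dist (u + (c / C\<^sup>2) *\<^sub>R (y - A u)) (v + (c / C\<^sup>2) *\<^sub>R (y - A v)) \<le> q * dist u v"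
        unfolding dist_norm e by (rule contr)
    qed
    then obtain x where "x + (c / C\<^sup>2) *\<^sub>R (y - A x) = x" by blast
    then have "A x = y" using c(1) C(1) by simp
    then show ?thesis ..
  qed
  then have "surj A" by (metis surjI)
  moreover have "inj A"
  proof (rule injI)
    fix x y assume "A x = A y"
    then have "c * (norm (x - y))\<^sup>2 \<le> 0" using c(2)[of "x - y"] by (simp add: diff)
    then show "x = y" using c(1) by (simp add: mult_le_0_iff)
  qed
  ultimately show ?thesis by (simp add: bij_def)
qed

section \<open>Measurable families of operators\<close>

abbreviation lebI :: "real \<Rightarrow> real measure" where
  "lebI T \<equiv> restrict_space lborel {0..T}"

text \<open>Approximate \<open>X\<close> by simple functions. Each of them splits the domain into
  finitely many measurable pieces on which the argument of \<open>A s\<close> is constant, and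
  continuity of \<open>A s\<close> passes to the limit.\<close>

lemma borel_measurable_caratheodory:
  fixes A :: "'s \<Rightarrow> 'a::{real_normed_vector,second_countable_topology} \<Rightarrow> 'b::real_normed_vector"
  assumes cont: "\<And>s. s \<in> space M \<Longrightarrow> continuous_on UNIV (A s)"
    and meas: "\<And>x. (\<lambda>s. A s x) \<in> borel_measurable M" and X: "X \<in> borel_measurable M"
  shows "(\<lambda>s. A s (X s)) \<in> borel_measurable M"
proof -
  obtain S where S: "\<And>i. simple_function M (S i)" "\<And>s. s \<in> space M \<Longrightarrow> (\<lambda>i. S i s) \<longlonglongrightarrow> X s"
    using borel_measurable_implies_sequence_metric[OF X] by metis
  have "(\<lambda>s. A s (S i s)) \<in> borel_measurable M" for i
  proof (rule measurable_compose_countable'[where I = "S i ` space M" and g = "S i" and f = "\<lambda>x s. A s x"])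
    show "S i \<in> measurable M (count_space (S i ` space M))"
      using S(1)[of i] by (subst measurable_count_space_eq2) (auto simp: simple_function_def)
    show "countable (S i ` space M)" using S(1)[of i] by (simp add: simple_function_def countable_finite)
  qed (rule meas)
  then show ?thesis
  proof (rule borel_measurable_LIMSEQ_metric)
    fix s assume s: "s \<in> space M"
    show "(\<lambda>i. A s (S i s)) \<longlonglongrightarrow> A s (X s)"
      using continuous_on_tendsto_compose[OF cont[OF s] S(2)[OF s]] by simp
  qed
qed

text \<open>A form of Pettis' theorem. Separability makes membership in a closed ball a countable
  conjunction of conditions on scalar products, and makes every open set a countable union of closed
  balls.\<close>

lemma weakly_measurable_imp_measurable:
  fixes f :: "'s \<Rightarrow> 'a::{real_inner,second_countable_topology}"
  assumes meas: "\<And>y. (\<lambda>s. inner (f s) y) \<in> borel_measurable M"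
  shows "f \<in> borel_measurable M"
proof -
  obtain D :: "'a set" where D: "countable D" "\<And>X. open X \<Longrightarrow> X \<noteq> {} \<Longrightarrow> \<exists>d\<in>D. d \<in> X"
    by (rule countable_dense_setE) auto
  \<comment> \<open>Testing against the countable dense set suffices because a violated inequality
    is violated on an open set of directions.\<close>
  have norm_le: "norm z \<le> r \<longleftrightarrow> (\<forall>d\<in>D. inner z d \<le> r * norm d)" if "0 \<le> r" for z r
  proof
    assume "norm z \<le> r"
    then show "\<forall>d\<in>D. inner z d \<le> r * norm d"
      by (meson mult_right_mono norm_cauchy_schwarz norm_ge_zero order_trans)
  next
    assume *: "\<forall>d\<in>D. inner z d \<le> r * norm d"
    let ?U = "{d. r * norm d < inner z d}"
    have "open ?U" by (intro open_Collect_less continuous_intros)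
    then have "?U = {}" using D(2)[of ?U] * by force
    then have "inner z z \<le> r * norm z" by (simp add: not_less set_eq_iff)
    then show "norm z \<le> r" using that by (cases "z = 0") (auto simp: power2_norm_eq_inner[symmetric] power2_eq_square)
  qed
  have ball: "f -` cball a r \<inter> space M \<in> sets M" if "0 \<le> r" for a r
  proof -
    have eq: "f -` cball a r \<inter> space M = {s\<in>space M. \<forall>d\<in>D. inner (f s) d - inner a d \<le> r * norm d}"
      using norm_le[OF that, of "f _ - a"] by (auto simp: dist_norm norm_minus_commute[of a] inner_diff_left)
    have [measurable]: "(\<lambda>s. inner (f s) d) \<in> borel_measurable M" for d by (rule meas)
    show ?thesis unfolding eq by (intro sets.sets_Collect_countable_All' D(1)) measurable
  qed
  show ?thesis
  proof (rule borel_measurableI)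
    fix S :: "'a set" assume "open S"
    define B where "B = {(d, r). d \<in> D \<and> r \<in> \<rat> \<and> 0 \<le> r \<and> cball d r \<subseteq> S}"
    have "B \<subseteq> D \<times> \<rat>" by (auto simp: B_def)
    then have cB: "countable B" using D(1) countable_rat by (meson countable_SIGMA countable_subset)
    have "S = (\<Union>(d, r)\<in>B. cball d r)"
    proof
      show "S \<subseteq> (\<Union>(d, r)\<in>B. cball d r)"
      proof
        fix x assume "x \<in> S"
        then obtain e where e: "e > 0" "ball x e \<subseteq> S" using \<open>open S\<close> openE by blast
        \<comment> \<open>With the centre \<open>d\<close> within \<open>e / 4\<close> of
          \<open>x\<close>, the lower bound on \<open>r\<close> puts \<open>x\<close> into the ball,
          and the upper bound keeps the ball inside radius \<open>3 e / 4\<close> around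
          \<open>x\<close>.\<close>
        obtain r where r: "r \<in> \<rat>" "e / 4 < r" "r < e / 2" using Rats_dense_in_real[of "e/4" "e/2"] e by auto
        obtain d where d: "d \<in> D" "d \<in> ball x (e / 4)" using D(2)[of "ball x (e/4)"] e by auto
        have "cball d r \<subseteq> ball x e"
        proof
          fix y assume "y \<in> cball d r"
          then show "y \<in> ball x e" using d(2) r(3) dist_triangle[of x y d] e(1) by (simp add: dist_commute)
        qed
        then have "(d, r) \<in> B" using d r e by (auto simp: B_def)
        moreover have "x \<in> cball d r" using d r by (simp add: dist_commute)
        ultimately show "x \<in> (\<Union>(d, r)\<in>B. cball d r)" by blast
      qed
    qed (auto simp: B_def)
    then have "f -` S \<inter> space M = (\<Union>p\<in>B. f -` cball (fst p) (snd p) \<inter> space M)"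
      by (simp add: case_prod_unfold vimage_UN del: vimage_Union)
    also have "\<dots> \<in> sets M" by (intro sets.countable_UN'' cB ball) (auto simp: B_def)
    finally show "f -` S \<inter> space M \<in> sets M" .
  qed
qed

lemma continuous_on_lebI_measurable:
  fixes f :: "real \<Rightarrow> 'a::topological_space"
  assumes "continuous_on {0..T} f"
  shows "f \<in> borel_measurable (lebI T)"
  using borel_measurable_continuous_on_restrict[OF assms]
  by (simp add: measurable_def space_restrict_space sets_restrict_space)

section \<open>Closure properties of uniformly bounded, strongly measurable operator
  families\<close>

lemma op_family_LinfE:
  assumes "op_family_Linf T A"
  obtains C where "0 < C" "\<And>s x. s \<in> {0..T} \<Longrightarrow> norm (A s x) \<le> C * norm x"
proof -
  have bl: "bounded_linear (A s)" if "s \<in> {0..T}" for s using assms that by (simp add: op_family_Linf_def)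
  obtain C where C: "\<And>s. s \<in> {0..T} \<Longrightarrow> onorm (A s) \<le> C"
    using assms unfolding op_family_Linf_def by blast
  \<comment> \<open>The maximum with 1 makes the bound strictly positive, which later divisions by
    it require.\<close>
  have "norm (A s x) \<le> (max C 1) * norm x" if s: "s \<in> {0..T}" for s x
    using onorm[OF bl[OF s], of x] C[OF s] mult_right_mono[of "onorm (A s)" "max C 1" "norm x"] by force
  then show thesis using that[of "max C 1"] by force
qed

lemma op_family_LinfI:
  assumes "0 \<le> C" and "\<And>s. s \<in> {0..T} \<Longrightarrow> bounded_linear (A s)"
    and "\<And>s x. s \<in> {0..T} \<Longrightarrow> norm (A s x) \<le> C * norm x"
    and "\<And>x. (\<lambda>s. A s x) \<in> borel_measurable (lebI T)"
  shows "op_family_Linf T A"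
  unfolding op_family_Linf_def using assms onorm_bound[OF \<open>0 \<le> C\<close>] by blast

lemma op_family_bounded_linear:
  "op_family_Linf T A \<Longrightarrow> s \<in> {0..T} \<Longrightarrow> bounded_linear (A s)"
  by (simp add: op_family_Linf_def)

lemma op_family_apply_measurable:
  fixes A :: "real \<Rightarrow> 'a::{real_normed_vector,second_countable_topology} \<Rightarrow> 'b::real_normed_vector"
  assumes "op_family_Linf T A" "X \<in> borel_measurable (lebI T)"
  shows "(\<lambda>s. A s (X s)) \<in> borel_measurable (lebI T)"
proof (rule borel_measurable_caratheodory[OF _ _ assms(2)])
  show "continuous_on UNIV (A s)" if "s \<in> space (lebI T)" for s
    using assms(1) that by (auto intro: linear_continuous_on simp: op_family_Linf_def)
qed (use assms(1) in \<open>simp add: op_family_Linf_def\<close>)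

lemma op_family_compose:
  fixes A :: "real \<Rightarrow> 'b::{real_normed_vector,second_countable_topology} \<Rightarrow> 'c::real_normed_vector"
    and B :: "real \<Rightarrow> 'a::real_normed_vector \<Rightarrow> 'b"
  assumes A: "op_family_Linf T A" and B: "op_family_Linf T B"
  shows "op_family_Linf T (\<lambda>s x. A s (B s x))"
proof -
  obtain C D where C: "0 < C" "\<And>s x. s \<in> {0..T} \<Longrightarrow> norm (A s x) \<le> C * norm x"
    and D: "0 < D" "\<And>s x. s \<in> {0..T} \<Longrightarrow> norm (B s x) \<le> D * norm x"
    using A B by (metis op_family_LinfE)
  show ?thesis
  proof (rule op_family_LinfI)
    fix s :: real and x assume s: "s \<in> {0..T}"
    show "bounded_linear (\<lambda>x. A s (B s x))"
      using s A B by (intro bounded_linear_compose[of "A s" "B s"]) (auto simp: op_family_Linf_def)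
    show "norm (A s (B s x)) \<le> (C * D) * norm x"
      using order_trans[OF C(2)[OF s, of "B s x"] mult_left_mono[OF D(2)[OF s, of x], of C]] C(1) by (simp add: mult.assoc)
  next
    show "0 \<le> C * D" using C D by simp
  next
    show "(\<lambda>s. A s (B s x)) \<in> borel_measurable (lebI T)" for x
      using B by (intro op_family_apply_measurable[OF A]) (simp add: op_family_Linf_def)
  qed
qed

lemma op_family_add:
  fixes A B :: "real \<Rightarrow> 'a::real_normed_vector \<Rightarrow> 'b::{real_normed_vector,second_countable_topology}"
  assumes A: "op_family_Linf T A" and B: "op_family_Linf T B"
  shows "op_family_Linf T (\<lambda>s x. A s x + B s x)"
proof -
  obtain C D where C: "0 < C" "\<And>s x. s \<in> {0..T} \<Longrightarrow> norm (A s x) \<le> C * norm x"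
    and D: "0 < D" "\<And>s x. s \<in> {0..T} \<Longrightarrow> norm (B s x) \<le> D * norm x"
    using A B by (metis op_family_LinfE)
  show ?thesis
  proof (rule op_family_LinfI)
    show "norm (A s x + B s x) \<le> (C + D) * norm x" if "s \<in> {0..T}" for s x
      using norm_triangle_le[of "A s x" "B s x"] C(2)[OF that, of x] D(2)[OF that, of x] by (simp add: algebra_simps)
    show "(\<lambda>s. A s x + B s x) \<in> borel_measurable (lebI T)" for x
      using A B by (intro borel_measurable_add) (auto simp: op_family_Linf_def)
    show "0 \<le> C + D" using C(1) D(1) by simp
    show "bounded_linear (\<lambda>x. A s x + B s x)" if "s \<in> {0..T}" for s
      using A B that by (intro bounded_linear_add) (auto simp: op_family_Linf_def)
  qed
qed

lemma op_family_scaleR: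
  fixes A :: "real \<Rightarrow> 'a::real_normed_vector \<Rightarrow> 'b::{real_normed_vector,second_countable_topology}"
  assumes A: "op_family_Linf T A"
  shows "op_family_Linf T (\<lambda>s x. c *\<^sub>R A s x)"
proof -
  obtain C where C: "0 < C" "\<And>s x. s \<in> {0..T} \<Longrightarrow> norm (A s x) \<le> C * norm x"
    using A by (metis op_family_LinfE)
  show ?thesis
  proof (rule op_family_LinfI)
    show "norm (c *\<^sub>R A s x) \<le> (\<bar>c\<bar> * C) * norm x" if "s \<in> {0..T}" for s x
      using mult_left_mono[OF C(2)[OF that], of "\<bar>c\<bar>"] by (simp add: mult.assoc)
    show "(\<lambda>s. c *\<^sub>R A s x) \<in> borel_measurable (lebI T)" for x
      using A by (intro borel_measurable_scaleR) (auto simp: op_family_Linf_def)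
    show "0 \<le> \<bar>c\<bar> * C" using C(1) by simp
    show "bounded_linear (\<lambda>x. c *\<^sub>R A s x)" if "s \<in> {0..T}" for s
      using A that by (intro bounded_linear_const_scaleR) (auto simp: op_family_Linf_def)
  qed
qed

lemma op_family_diff:
  fixes A B :: "real \<Rightarrow> 'a::real_normed_vector \<Rightarrow> 'b::{real_normed_vector,second_countable_topology}"
  assumes A: "op_family_Linf T A" and B: "op_family_Linf T B"
  shows "op_family_Linf T (\<lambda>s x. A s x - B s x)"
  using op_family_add[OF A op_family_scaleR[OF B, of "- 1"]] by simp

text \<open>Measurability of \<open>s |-> A s y\<close> for each \<open>y\<close> yields only weak
  measurability of the adjoint family, through \<open>(adjoint (A s) x, y) = (x, A s y)\<close>.
  Separability upgrades it to strong measurability.\<close>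

lemma op_family_adjoint:
  fixes A :: "real \<Rightarrow> 'a::{real_inner,banach,second_countable_topology} \<Rightarrow> 'b::{real_inner,second_countable_topology}"
  assumes A: "op_family_Linf T A"
  shows "op_family_Linf T (\<lambda>s. adjoint (A s))"
proof -
  obtain C where C: "0 < C" "\<And>s x. s \<in> {0..T} \<Longrightarrow> norm (A s x) \<le> C * norm x"
    using A by (metis op_family_LinfE)
  have bl: "bounded_linear (A s)" if "s \<in> {0..T}" for s using A that by (simp add: op_family_Linf_def)
  show ?thesis
  proof (rule op_family_LinfI)
    show "0 \<le> C" using C by simp
    show "bounded_linear (adjoint (A s))" if "s \<in> {0..T}" for s by (rule bounded_linear_adjoint[OF bl[OF that]])
    show "norm (adjoint (A s) x) \<le> C * norm x" if "s \<in> {0..T}" for s x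
      using norm_adjoint_le[OF bl[OF that]] C that by simp
    show "(\<lambda>s. adjoint (A s) x) \<in> borel_measurable (lebI T)" for x
    proof (rule weakly_measurable_imp_measurable)
      fix y
      have "(\<lambda>s. inner (A s y) x) \<in> borel_measurable (lebI T)"
        using A by (intro borel_measurable_inner) (auto simp: op_family_Linf_def)
      moreover have "inner (A s y) x = inner (adjoint (A s) x) y" if "s \<in> space (lebI T)" for s
        using inner_adjoint[OF bl, of s y x] that by (simp add: inner_commute)
      ultimately show "(\<lambda>s. inner (adjoint (A s) x) y) \<in> borel_measurable (lebI T)"
        using measurable_cong[of "lebI T" "\<lambda>s. inner (A s y) x" "\<lambda>s. inner (adjoint (A s) x) y"] by blast
    qed
  qed
qed

text \<open>The bound \<open>1 / c\<close> comes from coercivity. For measurability, the inverse is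
  the limit of Richardson iterates, which are built from \<open>A s\<close> by finitely many
  evaluations and sums and are therefore measurable in \<open>s\<close>.\<close>

lemma op_family_inverse:
  fixes A :: "real \<Rightarrow> 'a::{real_inner,banach,second_countable_topology} \<Rightarrow> 'a"
  assumes A: "op_family_Linf T A" and c: "0 < c" "\<And>s x. s \<in> {0..T} \<Longrightarrow> c * (norm x)\<^sup>2 \<le> inner (A s x) x"
  shows "op_family_Linf T (\<lambda>s. inv (A s))"
proof -
  obtain C0 where C0: "0 < C0" "\<And>s x. s \<in> {0..T} \<Longrightarrow> norm (A s x) \<le> C0 * norm x"
    using A by (metis op_family_LinfE)
  define C where "C = max c C0"
  have C: "0 < C" "c \<le> C" using c(1) by (auto simp: C_def)
  have CA: "norm (A s x) \<le> C * norm x" if "s \<in> {0..T}" for s x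
    using C0(2)[OF that, of x] mult_right_mono[of C0 C "norm x"] by (simp add: C_def)
  have bl: "bounded_linear (A s)" if "s \<in> {0..T}" for s using A that by (simp add: op_family_Linf_def)
  have bij: "bij (A s)" if "s \<in> {0..T}" for s by (rule coercive_bij[OF bl[OF that] c(1) c(2)[OF that]])
  have AB: "A s (inv (A s) x) = x" if "s \<in> {0..T}" for s x
    using bij[OF that] by (simp add: bij_is_surj surj_f_inv_f)
  have BA: "inv (A s) (A s x) = x" if "s \<in> {0..T}" for s x
    using bij[OF that] by (simp add: bij_is_inj)
  have bd: "norm (inv (A s) x) \<le> (1 / c) * norm x" if s: "s \<in> {0..T}" for s x
  proof (cases "inv (A s) x = 0")
    case False
    have "c * (norm (inv (A s) x))\<^sup>2 \<le> inner x (inv (A s) x)" using c(2)[OF s, of "inv (A s) x"] by (simp add: AB[OF s])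
    also have "\<dots> \<le> norm x * norm (inv (A s) x)" by (rule norm_cauchy_schwarz)
    finally show ?thesis using False c(1) by (simp add: power2_eq_square field_simps)
  qed (use c(1) in auto)
  show ?thesis
  proof (rule op_family_LinfI)
    show "0 \<le> 1 / c" using c(1) by simp
    show "bounded_linear (inv (A s))" if s: "s \<in> {0..T}" for s
    proof (rule bounded_linear_intro[where K = "1 / c"])
      interpret bounded_linear "A s" by (rule bl[OF s])
      show "inv (A s) (x + y) = inv (A s) x + inv (A s) y" for x y
        using BA[OF s, of "inv (A s) x + inv (A s) y"] by (simp add: add AB[OF s])
      show "inv (A s) (r *\<^sub>R x) = r *\<^sub>R inv (A s) x" for r x
        using BA[OF s, of "r *\<^sub>R inv (A s) x"] by (simp add: scale AB[OF s])
      show "norm (inv (A s) x) \<le> norm x * (1 / c)" for x using bd[OF s, of x] by simp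
    qed
    show "norm (inv (A s) x) \<le> (1 / c) * norm x" if "s \<in> {0..T}" for s x by (rule bd[OF that])
  next
    fix x
    define y where "y = rec_nat (\<lambda>s. 0) (\<lambda>k z s. z s + (c / C\<^sup>2) *\<^sub>R (x - A s (z s)))"
    have y0: "y 0 s = 0" and yS: "y (Suc k) s = y k s + (c / C\<^sup>2) *\<^sub>R (x - A s (y k s))" for k s
      by (simp_all add: y_def)
    define q where "q = sqrt (1 - (c / C)\<^sup>2)"
    have q: "0 \<le> q" "q < 1" using c(1) C by (auto simp: q_def power_le_one)
    show "(\<lambda>s. inv (A s) x) \<in> borel_measurable (lebI T)"
    proof (rule borel_measurable_LIMSEQ_metric)
      show "y k \<in> borel_measurable (lebI T)" for k
      proof (induction k)
        case (Suc k)
        have "y (Suc k) = (\<lambda>s. y k s + (c / C\<^sup>2) *\<^sub>R (x - A s (y k s)))" by (simp add: yS fun_eq_iff)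
        moreover have "(\<lambda>s. y k s + (c / C\<^sup>2) *\<^sub>R (x - A s (y k s))) \<in> borel_measurable (lebI T)"
          by (intro borel_measurable_add borel_measurable_scaleR borel_measurable_diff
              op_family_apply_measurable[OF A] Suc borel_measurable_const)
        ultimately show ?case by simp
      qed (simp add: y_def)
      fix s assume "s \<in> space (lebI T)"
      then have s: "s \<in> {0..T}" by simp
      interpret bounded_linear "A s" by (rule bl[OF s])
      have err: "norm (y k s - inv (A s) x) \<le> q ^ k * norm (inv (A s) x)" for k
      proof (induction k)
        case (Suc k)
        define e where "e = y k s - inv (A s) x"
        \<comment> \<open>The right-hand side \<open>x\<close> drops out: the error evolves by the
          homogeneous iteration, to which the contraction estimate applies.\<close>
        have "y (Suc k) s - inv (A s) x = e - (c / C\<^sup>2) *\<^sub>R A s e"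
          by (simp add: yS e_def diff AB[OF s] algebra_simps)
        then have "norm (y (Suc k) s - inv (A s) x) \<le> q * norm e"
          using coercive_contraction[OF bl[OF s] c(1) c(2)[OF s] C(1) CA[OF s] C(2)] by (simp add: q_def)
        also have "\<dots> \<le> q * (q ^ k * norm (inv (A s) x))" using Suc q by (intro mult_left_mono) (auto simp: e_def)
        finally show ?case by simp
      qed (simp add: y0)
      have lim: "(\<lambda>k. q ^ k * norm (inv (A s) x)) \<longlonglongrightarrow> 0"
        by (rule tendsto_mult_left_zero[OF LIMSEQ_realpow_zero[OF q]])
      have "(\<lambda>k. y k s - inv (A s) x) \<longlonglongrightarrow> 0"
        by (rule Lim_null_comparison[OF always_eventually[OF allI[OF err]] lim])
      then show "(\<lambda>k. y k s) \<longlonglongrightarrow> inv (A s) x" by (simp add: LIM_zero_iff)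
    qed
  qed
qed

section \<open>Bochner integrals on intervals\<close>

lemma set_integral_bounded_linear:
  fixes f :: "'s \<Rightarrow> 'a::{banach,second_countable_topology}" and L :: "'a \<Rightarrow> 'b::{banach,second_countable_topology}"
  assumes "bounded_linear L" "set_integrable M A f"
  shows "set_integrable M A (\<lambda>x. L (f x))" "(LINT x:A|M. L (f x)) = L (LINT x:A|M. f x)"
proof -
  have eq: "(\<lambda>x. indicator A x *\<^sub>R L (f x)) = (\<lambda>x. L (indicator A x *\<^sub>R f x))"
    by (simp add: linear_simps(5)[OF assms(1)])
  show "set_integrable M A (\<lambda>x. L (f x))" using integrable_bounded_linear[OF assms(1)] assms(2)
    unfolding set_integrable_def eq by blast
  show "(LINT x:A|M. L (f x)) = L (LINT x:A|M. f x)" using integral_bounded_linear[OF assms(1)] assms(2)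
    unfolding set_integrable_def set_lebesgue_integral_def eq by blast
qed

lemma set_integrable_subinterval:
  fixes f :: "real \<Rightarrow> 'a::{banach,second_countable_topology}"
  assumes "set_integrable lborel {a..b} f" "a \<le> c" "d \<le> b"
  shows "set_integrable lborel {c..d} f"
  by (rule set_integrable_subset[OF assms(1)]) (use assms in auto)

lemma set_integral_Icc_split:
  fixes f :: "real \<Rightarrow> 'a::{banach,second_countable_topology}"
  assumes f: "set_integrable lborel {a..c} f" and "a \<le> b" "b \<le> c"
  shows "(LINT x:{a..c}|lborel. f x) = (LINT x:{a..b}|lborel. f x) + (LINT x:{b..c}|lborel. f x)"
proof -
  have u: "{a..c} = {a..b} \<union> {b..c}" using assms by auto
  have "AE x in lborel. x \<noteq> b" by (rule AE_lborel_singleton)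
  then have ae: "AE x in lborel. \<not> (x \<in> {a..b} \<and> x \<in> {b..c})" by eventually_elim auto
  show ?thesis unfolding u
    by (rule set_integral_Un_AE[OF ae]) (use assms set_integrable_subinterval[OF f] in auto)
qed

lemma set_integrable_lebI:
  fixes f :: "real \<Rightarrow> 'a::{banach,second_countable_topology}"
  shows "set_integrable lborel {0..T} f \<longleftrightarrow> integrable (lebI T) f"
    and "set_lebesgue_integral lborel {0..T} f = integral\<^sup>L (lebI T) f"
  by (auto simp: set_integrable_def set_lebesgue_integral_def integrable_restrict_space integral_restrict_space)

lemma AE_lebI: "(AE s in lebI T. P s) \<longleftrightarrow> (AE s in lborel. s \<in> {0..T} \<longrightarrow> P s)"
  by (subst AE_restrict_space_iff) auto

lemma finite_measure_lebI: "finite_measure (lebI T)"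
  by (intro finite_measureI) (simp add: emeasure_restrict_space emeasure_lborel_Icc_eq)

lemma set_integrable_dominated:
  fixes f :: "real \<Rightarrow> 'a::{banach,second_countable_topology}" and g :: "real \<Rightarrow> real"
  assumes "f \<in> borel_measurable (lebI T)" "set_integrable lborel {0..T} g"
    and "\<And>s. s \<in> {0..T} \<Longrightarrow> norm (f s) \<le> g s"
  shows "set_integrable lborel {0..T} f"
proof -
  have "integrable (lebI T) f"
  proof (rule Bochner_Integration.integrable_bound)
    show "integrable (lebI T) g" using assms(2) by (simp add: set_integrable_lebI)
    show "AE s in lebI T. norm (f s) \<le> norm (g s)"
      by (rule AE_I2) (use assms(3) in \<open>force simp: space_restrict_space\<close>)
  qed fact
  then show ?thesis by (simp add: set_integrable_lebI)
qed

lemma set_integrable_const_Icc: "set_integrable lborel {a..b::real} (\<lambda>s. c::'a::{banach,second_countable_topology})"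
  unfolding set_integrable_def by (intro integrable_scaleR_left integrable_real_indicator) (auto simp: emeasure_lborel_Icc_eq)

lemma set_integrable_bounded:
  fixes f :: "real \<Rightarrow> 'a::{banach,second_countable_topology}"
  assumes "f \<in> borel_measurable (lebI T)" and "\<And>s. s \<in> {0..T} \<Longrightarrow> norm (f s) \<le> B"
  shows "set_integrable lborel {0..T} f"
  by (rule set_integrable_dominated[OF assms(1) set_integrable_const_Icc[of _ _ B] assms(2)])

text \<open>Dominated convergence with the indicator of the varying interval. The limit point itself
  has to be discarded, because there the indicators need not converge when the sequence approaches
  from below.\<close>

lemma continuous_on_indefinite_integral:
  fixes f :: "real \<Rightarrow> 'a::{banach,second_countable_topology}"
  assumes f: "set_integrable lborel {a..b} f"
  shows "continuous_on {a..b} (\<lambda>s. LINT x:{a..s}|lborel. f x)"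
  unfolding continuous_on_sequentially comp_def
proof (intro allI ballI impI)
  fix u s assume s: "s \<in> {a..b}" and "(\<forall>n. u n \<in> {a..b}) \<and> u \<longlonglongrightarrow> s"
  then have u: "\<And>n. u n \<in> {a..b}" "u \<longlonglongrightarrow> s" by auto
  have eq: "(LINT x:{a..r}|lborel. f x) = (LINT x|lborel. indicator {a..r} x *\<^sub>R (indicator {a..b} x *\<^sub>R f x))"
    if "r \<in> {a..b}" for r
    unfolding set_lebesgue_integral_def
    by (rule Bochner_Integration.integral_cong) (use that in \<open>auto simp: indicator_def\<close>)
  have f': "integrable lborel (\<lambda>x. indicator {a..b} x *\<^sub>R f x)" using f by (simp add: set_integrable_def)
  then have [measurable]: "(\<lambda>x. indicator {a..b} x *\<^sub>R f x) \<in> borel_measurable lborel" by auto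
  have "(\<lambda>n. LINT x|lborel. indicator {a..u n} x *\<^sub>R (indicator {a..b} x *\<^sub>R f x))
      \<longlonglongrightarrow> (LINT x|lborel. indicator {a..s} x *\<^sub>R (indicator {a..b} x *\<^sub>R f x))"
  proof (rule integral_dominated_convergence[where w = "\<lambda>x. norm (indicator {a..b} x *\<^sub>R f x)"])
    show "integrable lborel (\<lambda>x. norm (indicator {a..b} x *\<^sub>R f x))" using f' by (rule integrable_norm)
    have "AE x in lborel. x \<noteq> s" by (rule AE_lborel_singleton)
    then show "AE x in lborel. (\<lambda>n. indicator {a..u n} x *\<^sub>R (indicator {a..b} x *\<^sub>R f x))
        \<longlonglongrightarrow> indicator {a..s} x *\<^sub>R (indicator {a..b} x *\<^sub>R f x)"
    proof eventually_elim
      fix x assume "x \<noteq> s"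
      have "\<forall>\<^sub>F n in sequentially. indicator {a..u n} x = (indicator {a..s} x :: real)"
      proof (cases "x < s")
        case True
        from order_tendstoD(1)[OF u(2) True] show ?thesis by eventually_elim (use True in \<open>auto simp: indicator_def\<close>)
      next
        case False
        then have "s < x" using \<open>x \<noteq> s\<close> by simp
        from order_tendstoD(2)[OF u(2) this] show ?thesis by eventually_elim (use False \<open>s < x\<close> in \<open>auto simp: indicator_def\<close>)
      qed
      then show "(\<lambda>n. indicator {a..u n} x *\<^sub>R (indicator {a..b} x *\<^sub>R f x))
        \<longlonglongrightarrow> indicator {a..s} x *\<^sub>R (indicator {a..b} x *\<^sub>R f x)"
        by (intro tendsto_intros tendsto_eventually)
    qed
    show "AE x in lborel. norm (indicator {a..u n} x *\<^sub>R (indicator {a..b} x *\<^sub>R f x)) \<le> norm (indicator {a..b} x *\<^sub>R f x)" for n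
      by (auto simp: indicator_def)
  qed measurable
  then show "(\<lambda>n. LINT x:{a..u n}|lborel. f x) \<longlonglongrightarrow> (LINT x:{a..s}|lborel. f x)"
    using eq u(1) s by simp
qed

text \<open>With \<open>I\<close> the integral of \<open>f\<close>, the function
  \<open>h = exp (- L (s - a)) (c + L I)\<close> has derivative
  \<open>exp (- L (s - a)) L (f - (c + L I)) \<le> 0\<close>, so it stays below its initial value
  \<open>c\<close>. The hypothesis is then used once more to pass from \<open>c + L I\<close> to
  \<open>f\<close>.\<close>

lemma gronwall:
  fixes f :: "real \<Rightarrow> real"
  assumes cont: "continuous_on {a..b} f" and L: "0 \<le> L"
    and le: "\<And>s. s \<in> {a..b} \<Longrightarrow> f s \<le> c + L * (LINT x:{a..s}|lborel. f x)" and s: "s \<in> {a..b}"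
  shows "f s \<le> c * exp (L * (s - a))"
proof -
  have int: "set_integrable lborel {a..b} f" by (rule borel_integrable_atLeastAtMost'[OF cont])
  define I where "I s = integral {a..s} f" for s
  have I: "(LINT x:{a..s}|lborel. f x) = I s" if "s \<in> {a..b}" for s
    unfolding I_def by (rule set_borel_integral_eq_integral(2), rule set_integrable_subinterval[OF int]) (use that in auto)
  define h where "h s = exp (- (L * (s - a))) * (c + L * I s)" for s
  have dI: "(I has_real_derivative f t) (at t within {a..b})" if "t \<in> {a..b}" for t
    unfolding I_def by (rule integral_has_real_derivative[OF cont that])
  have "h s \<le> h a"
  proof (rule DERIV_nonpos_imp_decreasing_open[where f = h and a = a and b = s])
    fix t assume t: "a < t" "t < s"
    then have tb: "t \<in> {a..b}" using s by auto
    have "(I has_real_derivative f t) (at t)"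
      using dI[OF tb] t s at_within_Icc_at[of a t b] by auto
    then have "(h has_real_derivative (exp (- (L * (t - a))) * (- L) * (c + L * I t) + exp (- (L * (t - a))) * (L * f t))) (at t)"
      unfolding h_def by (auto intro!: derivative_eq_intros)
    moreover have "exp (- (L * (t - a))) * (- L) * (c + L * I t) + exp (- (L * (t - a))) * (L * f t)
        = exp (- (L * (t - a))) * (L * (f t - (c + L * I t)))" by (simp add: algebra_simps)
    moreover have "\<dots> \<le> 0" using le[OF tb] I[OF tb] L by (auto intro!: mult_nonneg_nonpos)
    ultimately show "\<exists>y. (h has_real_derivative y) (at t) \<and> y \<le> 0" by metis
  next
    have "continuous_on {a..b} I" using dI DERIV_continuous continuous_on_eq_continuous_within by blast
    then have "continuous_on {a..s} I" by (rule continuous_on_subset) (use s in auto)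
    then show "continuous_on {a..s} h" unfolding h_def by (intro continuous_intros)
  qed (use s in auto)
  then have "exp (- (L * (s - a))) * (c + L * I s) \<le> c" by (simp add: h_def I_def)
  then have "exp (L * (s - a)) * (exp (- (L * (s - a))) * (c + L * I s)) \<le> exp (L * (s - a)) * c"
    by (intro mult_left_mono) auto
  moreover have "exp (L * (s - a)) * (exp (- (L * (s - a))) * (c + L * I s)) = c + L * I s"
    by (simp only: mult.assoc[symmetric] exp_minus_inverse mult_1)
  ultimately have "c + L * I s \<le> c * exp (L * (s - a))" by (simp only: mult.commute)
  then show ?thesis using le[OF s] I[OF s] by simp
qed

text \<open>The intervals \<open>{..a}\<close> form an intersection-stable generator of the Borel
  sets, so a Dynkin argument extends the vanishing integrals to all Borel sets. A function with this
  property vanishes almost everywhere.\<close>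

lemma AE_zero_of_integral_zero:
  fixes f :: "real \<Rightarrow> 'a::{banach,second_countable_topology}"
  assumes f: "set_integrable lborel {0..T} f" and zero: "\<And>s. s \<in> {0..T} \<Longrightarrow> (LINT x:{0..s}|lborel. f x) = 0"
  shows "AE s in lborel. s \<in> {0..T} \<longrightarrow> f s = 0"
proof -
  define g where "g x = indicator {0..T} x *\<^sub>R f x" for x
  have g: "integrable lborel g" using f by (simp add: g_def[abs_def] set_integrable_def)
  have setg: "set_integrable lborel A g" if "A \<in> sets borel" for A
    using integrable_mult_indicator[OF _ g, of A] that by (simp add: set_integrable_def)
  have atMost: "(LINT x:{..a}|lborel. g x) = 0" for a
  proof -
    consider "a < 0 \<or> T < 0" | "0 \<le> a" "a \<le> T" | "T < a" "0 \<le> T" by linarith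
    then show ?thesis
    proof cases
      case 1
      then have "(LINT x:{..a}|lborel. g x) = (LINT x:{..a}|lborel. 0)"
        by (intro set_lebesgue_integral_cong) (auto simp: g_def indicator_def)
      then show ?thesis by simp
    next
      case 2
      then have "(LINT x:{..a}|lborel. g x) = (LINT x:{0..a}|lborel. f x)"
        unfolding set_lebesgue_integral_def by (intro Bochner_Integration.integral_cong) (auto simp: g_def indicator_def)
      then show ?thesis using zero 2 by simp
    next
      case 3
      then have "(LINT x:{..a}|lborel. g x) = (LINT x:{0..T}|lborel. f x)"
        unfolding set_lebesgue_integral_def by (intro Bochner_Integration.integral_cong) (auto simp: g_def indicator_def)
      then show ?thesis using zero 3 by simp
    qed
  qed
  \<comment> \<open>The integral over the whole line is what the complement step of the Dynkin
    induction needs.\<close>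
  have UNIV0: "(LINT x:UNIV|lborel. g x) = 0"
  proof -
    have "(LINT x:UNIV|lborel. g x) = (LINT x:{..T}|lborel. g x)"
      unfolding set_lebesgue_integral_def by (intro Bochner_Integration.integral_cong) (auto simp: g_def indicator_def)
    then show ?thesis by (simp add: atMost)
  qed
  have "(LINT x:A|lborel. g x) = 0" if "A \<in> sets lborel" for A
  proof -
    have "Int_stable (range (\<lambda>a::real. {..a}))" by (auto simp: Int_stable_def)
    moreover have "range (\<lambda>a::real. {..a}) \<subseteq> Pow UNIV" by simp
    moreover have "A \<in> sigma_sets UNIV (range (\<lambda>a::real. {..a}))"
      using that by (simp add: borel_eq_atMost)
    ultimately show ?thesis
    proof (induction rule: sigma_sets_induct_disjoint)
      case (basic A)
      then show ?case using atMost by auto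
    next
      case (compl A)
      have A: "A \<in> sets borel" using compl(1) by (simp add: borel_eq_atMost)
      have "(LINT x:A \<union> (UNIV - A)|lborel. g x) = (LINT x:A|lborel. g x) + (LINT x:UNIV - A|lborel. g x)"
        by (rule set_integral_Un) (use A setg in auto)
      then show ?case using compl UNIV0 by simp
    next
      case (union A)
      have A: "A i \<in> sets borel" for i using union(2) by (auto simp: borel_eq_atMost)
      have "(LINT x:(\<Union>i. A i)|lborel. g x) = (\<Sum>i. (LINT x:(A i)|lborel. g x))"
        by (rule lebesgue_integral_countable_add)
          (use A setg union(1) in \<open>auto simp: disjoint_family_on_def\<close>)
      then show ?case using union by simp
    qed (simp add: set_lebesgue_integral_def)
  qed
  then have "AE x in lborel. g x = 0" by (intro sigma_finite_measure.density_zero[OF sigma_finite_lborel] g)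
  then show ?thesis by eventually_elim (auto simp: g_def)
qed

text \<open>The integrand is controlled only on the triangle, so it is extended by zero to the
  plane. A majorant in product form is integrable there without \<open>a\<close> or \<open>b\<close>
  being bounded, and the two iterated integrals of the extension are the two sides.\<close>

lemma triangle_fubini:
  fixes f :: "real \<Rightarrow> real \<Rightarrow> 'a::{banach,second_countable_topology}" and a b :: "real \<Rightarrow> real"
  assumes f: "(\<lambda>p. f (fst p) (snd p)) \<in> borel_measurable (restrict_space borel {p. 0 \<le> snd p \<and> snd p \<le> fst p \<and> fst p \<le> T})"
    and a: "set_integrable lborel {0..T} a" and b: "set_integrable lborel {0..T} b"
    and bound: "\<And>r \<tau>. 0 \<le> \<tau> \<Longrightarrow> \<tau> \<le> r \<Longrightarrow> r \<le> T \<Longrightarrow> norm (f r \<tau>) \<le> a r * b \<tau>"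
  shows "set_integrable lborel {0..T} (\<lambda>r. LINT \<tau>:{0..r}|lborel. f r \<tau>)"
    and "set_integrable lborel {0..T} (\<lambda>\<tau>. LINT r:{\<tau>..T}|lborel. f r \<tau>)"
    and "(LINT r:{0..T}|lborel. (LINT \<tau>:{0..r}|lborel. f r \<tau>)) = (LINT \<tau>:{0..T}|lborel. (LINT r:{\<tau>..T}|lborel. f r \<tau>))"
proof -
  define D where "D = {p::real \<times> real. 0 \<le> snd p \<and> snd p \<le> fst p \<and> fst p \<le> T}"
  have "closed D" unfolding D_def by (intro closed_Collect_conj closed_Collect_le continuous_intros)
  then have D[measurable]: "D \<in> sets borel" by simp
  define h where "h p = indicator D p *\<^sub>R f (fst p) (snd p)" for p
  define a' where "a' r = indicator {0..T} r *\<^sub>R a r" for r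
  define b' where "b' r = indicator {0..T} r *\<^sub>R b r" for r
  have a': "integrable lborel a'" and b': "integrable lborel b'"
    using a b by (auto simp: set_integrable_def a'_def[abs_def] b'_def[abs_def])
  have [measurable]: "a' \<in> borel_measurable borel" "b' \<in> borel_measurable borel"
    using borel_measurable_integrable[OF a'] borel_measurable_integrable[OF b'] by simp_all
  have h_meas: "h \<in> borel_measurable (lborel \<Otimes>\<^sub>M lborel)"
    using f D unfolding h_def[abs_def] D_def[symmetric] lborel_prod
    by (subst (asm) borel_measurable_restrict_space_iff) auto
  have ab: "integrable (lborel \<Otimes>\<^sub>M lborel) (\<lambda>p. a' (fst p) * b' (snd p))"
  proof (rule lborel_pair.Fubini_integrable)
    show "(\<lambda>p. a' (fst p) * b' (snd p)) \<in> borel_measurable (lborel \<Otimes>\<^sub>M lborel)" by measurable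
  qed (use a' b' in \<open>auto simp: abs_mult\<close>)
  have h: "integrable (lborel \<Otimes>\<^sub>M lborel) h"
  proof (rule Bochner_Integration.integrable_bound[OF ab h_meas], rule AE_I2)
    fix p :: "real \<times> real"
    show "norm (h p) \<le> norm (a' (fst p) * b' (snd p))"
    proof (cases "p \<in> D")
      case True
      then show ?thesis using bound[of "snd p" "fst p"] by (auto simp: h_def a'_def b'_def D_def)
    qed (simp add: h_def)
  qed
  have fst: "(LINT \<tau>|lborel. h (r, \<tau>)) = indicator {0..T} r *\<^sub>R (LINT \<tau>:{0..r}|lborel. f r \<tau>)" for r
  proof (cases "r \<in> {0..T}")
    case True
    then show ?thesis unfolding set_lebesgue_integral_def h_def D_def
      by (auto intro!: Bochner_Integration.integral_cong simp: indicator_def)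
  next
    case False
    then have "h (r, \<tau>) = 0" for \<tau> by (auto simp: h_def D_def indicator_def)
    then show ?thesis using False by simp
  qed
  have snd: "(LINT r|lborel. h (r, \<tau>)) = indicator {0..T} \<tau> *\<^sub>R (LINT r:{\<tau>..T}|lborel. f r \<tau>)" for \<tau>
  proof (cases "\<tau> \<in> {0..T}")
    case True
    then show ?thesis unfolding set_lebesgue_integral_def h_def D_def
      by (auto intro!: Bochner_Integration.integral_cong simp: indicator_def)
  next
    case False
    then have "h (r, \<tau>) = 0" for r by (auto simp: h_def D_def indicator_def)
    then show ?thesis using False by simp
  qed
  show "set_integrable lborel {0..T} (\<lambda>r. LINT \<tau>:{0..r}|lborel. f r \<tau>)"
    using lborel_pair.integrable_fst'[OF h] unfolding set_integrable_def fst .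
  show "set_integrable lborel {0..T} (\<lambda>\<tau>. LINT r:{\<tau>..T}|lborel. f r \<tau>)"
    using lborel_pair.integrable_snd[of "\<lambda>x y. h (x, y)"] h unfolding set_integrable_def snd by simp
  show "(LINT r:{0..T}|lborel. (LINT \<tau>:{0..r}|lborel. f r \<tau>)) = (LINT \<tau>:{0..T}|lborel. (LINT r:{\<tau>..T}|lborel. f r \<tau>))"
    using lborel_pair.Fubini_integral[of "\<lambda>x y. h (x, y)"] h
    unfolding set_lebesgue_integral_def[of lborel "{0..T}"] fst snd by simp
qed

section \<open>Square-integrable functions on a bounded interval\<close>

lemma L2_imp_integrable:
  fixes f :: "real \<Rightarrow> 'a::{banach,second_countable_topology}"
  assumes "f \<in> borel_measurable (lebI T)" "set_integrable lborel {0..T} (\<lambda>s. (norm (f s))\<^sup>2)"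
  shows "set_integrable lborel {0..T} f"
proof (rule set_integrable_dominated[OF assms(1)])
  show "set_integrable lborel {0..T} (\<lambda>s. 1 + (norm (f s))\<^sup>2)"
    by (intro set_integral_add assms set_integrable_const_Icc)
  show "norm (f s) \<le> 1 + (norm (f s))\<^sup>2" for s
    using sum_squares_bound[of "norm (f s)" 1] norm_ge_zero[of "f s"] by (simp del: norm_ge_zero)
qed

lemma L2_mult:
  fixes f :: "real \<Rightarrow> 'a::{banach,second_countable_topology}" and g :: "real \<Rightarrow> 'b::{banach,second_countable_topology}"
  assumes "f \<in> borel_measurable (lebI T)" "set_integrable lborel {0..T} (\<lambda>s. (norm (f s))\<^sup>2)"
    and "g \<in> borel_measurable (lebI T)" "set_integrable lborel {0..T} (\<lambda>s. (norm (g s))\<^sup>2)"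
  shows "set_integrable lborel {0..T} (\<lambda>s. norm (f s) * norm (g s))"
proof (rule set_integrable_dominated)
  show "(\<lambda>s. norm (f s) * norm (g s)) \<in> borel_measurable (lebI T)"
    using assms by measurable
  show "set_integrable lborel {0..T} (\<lambda>s. (norm (f s))\<^sup>2 + (norm (g s))\<^sup>2)"
    by (intro set_integral_add assms)
  show "norm (norm (f s) * norm (g s)) \<le> (norm (f s))\<^sup>2 + (norm (g s))\<^sup>2" for s
    using sum_squares_bound[of "norm (f s)" "norm (g s)"] mult_nonneg_nonneg[OF norm_ge_zero norm_ge_zero, of "f s" "g s"]
    unfolding real_norm_def abs_mult abs_norm_cancel by linarith
qed

lemma L2_add:
  fixes f g :: "real \<Rightarrow> 'a::{banach,second_countable_topology}"
  assumes "f \<in> borel_measurable (lebI T)" "set_integrable lborel {0..T} (\<lambda>s. (norm (f s))\<^sup>2)"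
    and "g \<in> borel_measurable (lebI T)" "set_integrable lborel {0..T} (\<lambda>s. (norm (g s))\<^sup>2)"
  shows "set_integrable lborel {0..T} (\<lambda>s. (norm (f s + g s))\<^sup>2)"
proof (rule set_integrable_dominated)
  show "(\<lambda>s. (norm (f s + g s))\<^sup>2) \<in> borel_measurable (lebI T)"
    using assms by measurable
  show "set_integrable lborel {0..T} (\<lambda>s. 2 * (norm (f s))\<^sup>2 + 2 * (norm (g s))\<^sup>2)"
    by (intro set_integral_add set_integrable_mult_right assms)
  show "norm ((norm (f s + g s))\<^sup>2) \<le> 2 * (norm (f s))\<^sup>2 + 2 * (norm (g s))\<^sup>2" for s
  proof -
    have "(norm (f s + g s))\<^sup>2 \<le> (norm (f s) + norm (g s))\<^sup>2" by (intro power_mono norm_triangle_ineq) simp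
    also have "\<dots> \<le> 2 * (norm (f s))\<^sup>2 + 2 * (norm (g s))\<^sup>2"
      using sum_squares_bound[of "norm (f s)" "norm (g s)"] by (simp add: power2_sum)
    finally show ?thesis by simp
  qed
qed

lemma L2_op_family:
  fixes A :: "real \<Rightarrow> 'a::{banach,second_countable_topology} \<Rightarrow> 'b::{banach,second_countable_topology}"
  assumes A: "op_family_Linf T A"
    and f: "f \<in> borel_measurable (lebI T)" "set_integrable lborel {0..T} (\<lambda>s. (norm (f s))\<^sup>2)"
  shows "set_integrable lborel {0..T} (\<lambda>s. (norm (A s (f s)))\<^sup>2)"
proof -
  obtain C where C: "0 < C" "\<And>s x. s \<in> {0..T} \<Longrightarrow> norm (A s x) \<le> C * norm x"
    using A by (metis op_family_LinfE)
  show ?thesis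
  proof (rule set_integrable_dominated)
    show "(\<lambda>s. (norm (A s (f s)))\<^sup>2) \<in> borel_measurable (lebI T)"
      using op_family_apply_measurable[OF A f(1)] by measurable
    show "set_integrable lborel {0..T} (\<lambda>s. C\<^sup>2 * (norm (f s))\<^sup>2)"
      by (intro set_integrable_mult_right f)
    show "norm ((norm (A s (f s)))\<^sup>2) \<le> C\<^sup>2 * (norm (f s))\<^sup>2" if "s \<in> {0..T}" for s
      using power_mono[OF C(2)[OF that, of "f s"], of 2] by (simp add: power_mult_distrib)
  qed
qed

text \<open>The Riesz-Fischer argument: Cauchy in \<open>L2\<close> implies Cauchy in
  \<open>L1\<close> on a finite interval, which gives an almost everywhere convergent subsequence,
  and Fatou's lemma returns the limit to \<open>L2\<close>. The subsequence is part of the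
  conclusion because pointwise conditions on the functions are to be passed to the limit.\<close>

lemma L2_complete:
  fixes V :: "nat \<Rightarrow> real \<Rightarrow> 'a::{banach,second_countable_topology}"
  assumes meas: "\<And>n. V n \<in> borel_measurable (lebI T)"
    and int: "\<And>n. set_integrable lborel {0..T} (\<lambda>s. (norm (V n s))\<^sup>2)"
    and cauchy: "\<And>e. e > 0 \<Longrightarrow> \<exists>N. \<forall>m\<ge>N. \<forall>n\<ge>N. (LINT s:{0..T}|lborel. (norm (V m s - V n s))\<^sup>2) < e"
    and T: "0 < T"
  obtains W r where "W \<in> borel_measurable (lebI T)" "set_integrable lborel {0..T} (\<lambda>s. (norm (W s))\<^sup>2)"
    "strict_mono r" "AE s in lborel. s \<in> {0..T} \<longrightarrow> (\<lambda>k. V (r k) s) \<longlonglongrightarrow> W s"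
    "(\<lambda>n. LINT s:{0..T}|lborel. (norm (V n s - W s))\<^sup>2) \<longlonglongrightarrow> 0"
proof -
  interpret finite_measure "lebI T" by (rule finite_measure_lebI)
  have diff_int: "set_integrable lborel {0..T} (\<lambda>s. (norm (V m s - V n s))\<^sup>2)" for m n
    using L2_add[of "V m" T "\<lambda>s. - V n s"] meas int by simp
  have V_int: "set_integrable lborel {0..T} (V n)" for n
    by (rule L2_imp_integrable[OF meas int])
  have L1: "\<exists>N. \<forall>i\<ge>N. \<forall>j\<ge>N. (LINT s|lebI T. norm (V i s - V j s)) < e" if e: "e > 0" for e
  proof -
    \<comment> \<open>Integrating \<open>a \<le> d / 2 + a^2 / (2 d)\<close> with this
      \<open>d\<close> bounds the \<open>L1\<close> distance by \<open>e / 4 + e / 2\<close>, once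
      the squared distance is below \<open>d * e\<close>.\<close>
    define d where "d = e / (2 * T)"
    have d: "d > 0" using e T by (simp add: d_def)
    obtain N where N: "\<And>m n. m \<ge> N \<Longrightarrow> n \<ge> N \<Longrightarrow> (LINT s:{0..T}|lborel. (norm (V m s - V n s))\<^sup>2) < d * e"
      using cauchy[of "d * e"] d e by auto
    have "(LINT s:{0..T}|lborel. norm (V i s - V j s)) < e" if "i \<ge> N" "j \<ge> N" for i j
    proof -
      have "(LINT s:{0..T}|lborel. norm (V i s - V j s)) \<le> (LINT s:{0..T}|lborel. d / 2 + (1 / (2 * d)) * (norm (V i s - V j s))\<^sup>2)"
      proof (rule set_integral_mono)
        show "set_integrable lborel {0..T} (\<lambda>s. norm (V i s - V j s))"
          by (intro set_integrable_norm set_integral_diff V_int)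
        show "set_integrable lborel {0..T} (\<lambda>s. d / 2 + (1 / (2 * d)) * (norm (V i s - V j s))\<^sup>2)"
          by (intro set_integral_add set_integrable_const_Icc set_integrable_mult_right diff_int)
        fix s
        show "norm (V i s - V j s) \<le> d / 2 + (1 / (2 * d)) * (norm (V i s - V j s))\<^sup>2"
          using sum_squares_bound[of d "norm (V i s - V j s)"] d by (simp add: field_simps power2_eq_square)
      qed
      also have "\<dots> = d / 2 * T + (1 / (2 * d)) * (LINT s:{0..T}|lborel. (norm (V i s - V j s))\<^sup>2)"
        using T by (subst set_integral_add) (auto intro!: set_integrable_const_Icc set_integrable_mult_right diff_int simp: set_integral_const[of "{0..T}"])
      also have "\<dots> < d / 2 * T + (1 / (2 * d)) * (d * e)"
        using N[OF that] d by (intro add_strict_left_mono mult_strict_left_mono) auto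
      also have "\<dots> \<le> e" using d T e by (simp add: d_def field_simps)
      finally show ?thesis .
    qed
    then show ?thesis by (auto simp: set_integrable_lebI)
  qed
  obtain r where r: "strict_mono r" "AE s in lebI T. Cauchy (\<lambda>k. V (r k) s)"
    by (rule cauchy_L1_AE_cauchy_subseq[OF _ L1]) (use V_int in \<open>auto simp: set_integrable_lebI\<close>)
  define W where "W s = lim (\<lambda>k. V (r k) s)" for s
  have W: "W \<in> borel_measurable (lebI T)" unfolding W_def by (rule borel_measurable_lim_metric) (rule meas)
  have conv: "AE s in lebI T. (\<lambda>k. V (r k) s) \<longlonglongrightarrow> W s"
    using r(2) by eventually_elim (auto simp: W_def Cauchy_convergent_iff convergent_LIMSEQ_iff)
  \<comment> \<open>Integrability belongs to the conclusion, as \<open>W\<close> is not yet known to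
    be square integrable. Fatou's lemma turns the strict bound into a weak one, hence the later use
    with \<open>e / 2\<close>.\<close>
  have fatou: "integrable (lebI T) (\<lambda>s. (norm (V n s - W s))\<^sup>2) \<and> (LINT s|lebI T. (norm (V n s - W s))\<^sup>2) \<le> e"
    if e: "e > 0" and N: "\<And>m. m \<ge> N \<Longrightarrow> (LINT s:{0..T}|lborel. (norm (V n s - V m s))\<^sup>2) < e" for e n N
  proof -
    have nn: "(\<integral>\<^sup>+ s. ennreal ((norm (V n s - W s))\<^sup>2) \<partial>lebI T) \<le> ennreal e"
    proof -
      have "(\<integral>\<^sup>+ s. ennreal ((norm (V n s - W s))\<^sup>2) \<partial>lebI T)
          = (\<integral>\<^sup>+ s. liminf (\<lambda>k. ennreal ((norm (V n s - V (r k) s))\<^sup>2)) \<partial>lebI T)"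
      proof (rule nn_integral_cong_AE)
        show "AE s in lebI T. ennreal ((norm (V n s - W s))\<^sup>2) = liminf (\<lambda>k. ennreal ((norm (V n s - V (r k) s))\<^sup>2))"
          using conv
        proof eventually_elim
          fix s assume "(\<lambda>k. V (r k) s) \<longlonglongrightarrow> W s"
          then have "(\<lambda>k. ennreal ((norm (V n s - V (r k) s))\<^sup>2)) \<longlonglongrightarrow> ennreal ((norm (V n s - W s))\<^sup>2)"
            by (intro tendsto_ennrealI tendsto_intros)
          then show "ennreal ((norm (V n s - W s))\<^sup>2) = liminf (\<lambda>k. ennreal ((norm (V n s - V (r k) s))\<^sup>2))"
            by (metis lim_imp_Liminf trivial_limit_sequentially)
        qed
      qed
      also have "\<dots> \<le> liminf (\<lambda>k. \<integral>\<^sup>+ s. ennreal ((norm (V n s - V (r k) s))\<^sup>2) \<partial>lebI T)"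
      proof (rule nn_integral_liminf)
        show "(\<lambda>s. ennreal ((norm (V n s - V (r k) s))\<^sup>2)) \<in> borel_measurable (lebI T)" for k
          by (rule measurable_compose[OF borel_measurable_diff[OF meas[of n] meas[of "r k"]]]) measurable
      qed
      also have "\<dots> \<le> ennreal e"
      proof (rule Liminf_le[OF trivial_limit_sequentially], rule eventually_sequentiallyI[of N])
        fix k assume "k \<ge> N"
        then have "r k \<ge> N" using seq_suble[OF r(1), of k] by simp
        have "(\<integral>\<^sup>+ s. ennreal ((norm (V n s - V (r k) s))\<^sup>2) \<partial>lebI T) = ennreal (LINT s|lebI T. (norm (V n s - V (r k) s))\<^sup>2)"
          by (rule nn_integral_eq_integral) (use diff_int in \<open>auto simp: set_integrable_lebI\<close>)
        also have "\<dots> \<le> ennreal e"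
          using N[OF \<open>r k \<ge> N\<close>] by (intro ennreal_leI) (simp add: set_integrable_lebI)
        finally show "(\<integral>\<^sup>+ s. ennreal ((norm (V n s - V (r k) s))\<^sup>2) \<partial>lebI T) \<le> ennreal e" .
      qed
      finally show ?thesis .
    qed
    have m: "(\<lambda>s. (norm (V n s - W s))\<^sup>2) \<in> borel_measurable (lebI T)"
      using meas W by measurable
    have i: "integrable (lebI T) (\<lambda>s. (norm (V n s - W s))\<^sup>2)"
      by (rule integrableI_bounded[OF m]) (use le_less_trans[OF nn ennreal_less_top] in simp)
    have "ennreal (LINT s|lebI T. (norm (V n s - W s))\<^sup>2) \<le> ennreal e"
      using nn nn_integral_eq_integral[OF i] by simp
    then show ?thesis using i e by simp
  qed
  have lim: "(\<lambda>n. LINT s|lebI T. (norm (V n s - W s))\<^sup>2) \<longlonglongrightarrow> 0"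
  proof (rule LIMSEQ_I)
    fix e :: real assume e: "e > 0"
    obtain N where N: "\<forall>m\<ge>N. \<forall>n\<ge>N. (LINT s:{0..T}|lborel. (norm (V m s - V n s))\<^sup>2) < e / 2"
      using cauchy[of "e / 2"] e by auto
    have "norm ((LINT s|lebI T. (norm (V n s - W s))\<^sup>2) - 0) < e" if "n \<ge> N" for n
      using fatou[of "e / 2" N n] N that e by simp
    then show "\<exists>no. \<forall>n\<ge>no. norm ((LINT s|lebI T. (norm (V n s - W s))\<^sup>2) - 0) < e" by blast
  qed
  obtain N where N: "\<forall>m\<ge>N. \<forall>n\<ge>N. (LINT s:{0..T}|lborel. (norm (V m s - V n s))\<^sup>2) < 1"
    using cauchy[of 1] by auto
  have VW: "set_integrable lborel {0..T} (\<lambda>s. (norm (V N s - W s))\<^sup>2)"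
    using fatou[of 1 N N] N by (simp add: set_integrable_lebI)
  have "set_integrable lborel {0..T} (\<lambda>s. (norm (V N s + - (V N s - W s)))\<^sup>2)"
    by (rule L2_add) (use meas W int[of N] VW in \<open>auto intro!: borel_measurable_diff simp: norm_minus_commute\<close>)
  then have "set_integrable lborel {0..T} (\<lambda>s. (norm (W s))\<^sup>2)" by simp
  then show thesis using that[of W r] W r(1) conv lim by (simp add: AE_lebI set_integrable_lebI)
qed

lemma set_integrable_lebI_measurable:
  fixes f :: "real \<Rightarrow> 'a::{banach,second_countable_topology}"
  shows "set_integrable lborel {0..T} f \<Longrightarrow> f \<in> borel_measurable (lebI T)"
  by (simp add: set_integrable_lebI borel_measurable_integrable)

lemma set_integral_norm_le:
  fixes f :: "real \<Rightarrow> 'a::{banach,second_countable_topology}" and g :: "real \<Rightarrow> real"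
  assumes "set_integrable lborel A f" "set_integrable lborel A g" "\<And>x. x \<in> A \<Longrightarrow> norm (f x) \<le> g x"
  shows "norm (LINT x:A|lborel. f x) \<le> (LINT x:A|lborel. g x)"
  by (rule order_trans[OF set_integral_norm_bound[OF assms(1)] set_integral_mono[OF set_integrable_norm[OF assms(1)] assms(2,3)]])

section \<open>Absolutely continuous curves, the product rule and a Volterra estimate\<close>

lemma continuous_on_integral_form:
  fixes f :: "real \<Rightarrow> 'a::{banach,second_countable_topology}"
  assumes f: "set_integrable lborel {a..b} f" and eq: "\<And>s. s \<in> {a..b} \<Longrightarrow> X s = x0 + (LINT r:{a..s}|lborel. f r)"
  shows "continuous_on {a..b} X"
proof (rule continuous_on_eq)
  show "continuous_on {a..b} (\<lambda>s. x0 + (LINT r:{a..s}|lborel. f r))"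
    by (intro continuous_on_add continuous_on_const continuous_on_indefinite_integral f)
qed (simp add: eq)

abbreviation triangle :: "real \<Rightarrow> (real \<times> real) set" where
  "triangle T \<equiv> {p. 0 \<le> snd p \<and> snd p \<le> fst p \<and> fst p \<le> T}"

lemma fst_measurable_triangle: "s \<le> T \<Longrightarrow> fst \<in> measurable (restrict_space borel (triangle s)) (lebI T)"
  by (rule measurable_restrict_space2)
    (auto simp: space_restrict_space borel_prod[symmetric] intro!: measurable_restrict_space1)

lemma snd_measurable_triangle: "s \<le> T \<Longrightarrow> snd \<in> measurable (restrict_space borel (triangle s)) (lebI T)"
  by (rule measurable_restrict_space2)
    (auto simp: space_restrict_space borel_prod[symmetric] intro!: measurable_restrict_space1)

text \<open>This is \<open>(A X)' = A' X + A X'\<close> when both factors are known only as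
  indefinite integrals. Expand \<open>X s\<close>, pull \<open>A s\<close> into the integral of
  \<open>x'\<close>, write \<open>A s\<close> as \<open>A \<tau>\<close> plus the integral of
  \<open>A'\<close> over \<open>{\<tau>..s}\<close>, and exchange the double integral; the inner
  integral of \<open>x'\<close> then rebuilds \<open>X\<close>. The bound \<open>k\<close> is
  integrable rather than constant so that \<open>A'\<close> may itself be pairing with the
  derivative of a curve.\<close>

lemma operator_product_rule:
  fixes A A' :: "real \<Rightarrow> 'a::{banach,second_countable_topology} \<Rightarrow> 'b::{banach,second_countable_topology}"
    and X x' :: "real \<Rightarrow> 'a" and k :: "real \<Rightarrow> real"
  assumes T: "0 \<le> T"
    and A: "\<And>s. s \<in> {0..T} \<Longrightarrow> bounded_linear (A s)"
    and A': "\<And>s. s \<in> {0..T} \<Longrightarrow> bounded_linear (A' s)"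
    and A'_meas: "\<And>x. (\<lambda>s. A' s x) \<in> borel_measurable (lebI T)"
    and k: "set_integrable lborel {0..T} k" "\<And>s x. s \<in> {0..T} \<Longrightarrow> norm (A' s x) \<le> k s * norm x"
    and A_eq: "\<And>s x. s \<in> {0..T} \<Longrightarrow> A s x = A 0 x + (LINT r:{0..s}|lborel. A' r x)"
    and x': "set_integrable lborel {0..T} x'"
    and X_eq: "\<And>s. s \<in> {0..T} \<Longrightarrow> X s = X 0 + (LINT r:{0..s}|lborel. x' r)"
  shows "set_integrable lborel {0..T} (\<lambda>r. A' r (X r) + A r (x' r))"
    and "s \<in> {0..T} \<Longrightarrow> A s (X s) = A 0 (X 0) + (LINT r:{0..s}|lborel. A' r (X r) + A r (x' r))"
proof -
  have A'_int: "set_integrable lborel {0..T} (\<lambda>r. A' r x)" for x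
    by (rule set_integrable_dominated[OF A'_meas set_integrable_mult_left[OF k(1)] k(2)])
  have x'_meas: "x' \<in> borel_measurable (lebI T)" by (rule set_integrable_lebI_measurable[OF x'])
  have A'_app: "(\<lambda>s. A' s (Z s)) \<in> borel_measurable (lebI T)" if "Z \<in> borel_measurable (lebI T)" for Z
    by (rule borel_measurable_caratheodory[OF _ A'_meas that]) (use A' in \<open>auto intro: linear_continuous_on\<close>)
  have A_meas: "(\<lambda>s. A s x) \<in> borel_measurable (lebI T)" for x
    by (intro continuous_on_lebI_measurable continuous_on_integral_form[OF A'_int A_eq])
  have A_app: "(\<lambda>s. A s (Z s)) \<in> borel_measurable (lebI T)" if "Z \<in> borel_measurable (lebI T)" for Z
    by (rule borel_measurable_caratheodory[OF _ A_meas that]) (use A in \<open>auto intro: linear_continuous_on\<close>)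
  have X_cont: "continuous_on {0..T} X" by (rule continuous_on_integral_form[OF x' X_eq])
  obtain B where B: "\<And>s. s \<in> {0..T} \<Longrightarrow> norm (X s) \<le> B"
    using compact_imp_bounded[OF compact_continuous_image[OF X_cont compact_Icc]] unfolding bounded_iff by blast
  \<comment> \<open>Over a trivial space \<open>k\<close> could be negative; the absolute value
    avoids a case distinction.\<close>
  have k2: "norm (A' s x) \<le> \<bar>k s\<bar> * norm x" if "s \<in> {0..T}" for s x
    using k(2)[OF that, of x] by (rule order_trans) (simp add: mult_right_mono)
  obtain K0 where K0: "\<And>x. norm (A 0 x) \<le> norm x * K0" using bounded_linear.bounded[OF A[of 0]] T by auto
  define K where "K = K0 + (LINT r:{0..T}|lborel. \<bar>k r\<bar>)"
  have k_abs: "set_integrable lborel {0..T} (\<lambda>r. \<bar>k r\<bar>)" by (rule set_integrable_abs[OF k(1)])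
  \<comment> \<open>A bound uniform in \<open>s\<close> is read off the integral equation: the bound
    \<open>K0\<close> of \<open>A 0\<close> plus the integral of \<open>|k|\<close>.\<close>
  have A_bound: "norm (A s x) \<le> K * norm x" if s: "s \<in> {0..T}" for s x
  proof -
    have sub: "set_integrable lborel {0..s} (\<lambda>r. A' r x)" "set_integrable lborel {0..s} (\<lambda>r. \<bar>k r\<bar> * norm x)"
      using s by (auto intro!: set_integrable_mult_left set_integrable_subinterval[OF A'_int] set_integrable_subinterval[OF k_abs])
    have "norm (LINT r:{0..s}|lborel. A' r x) \<le> (LINT r:{0..s}|lborel. \<bar>k r\<bar> * norm x)"
    proof (rule set_integral_norm_le[OF sub])
      fix r assume "r \<in> {0..s}"
      then show "norm (A' r x) \<le> \<bar>k r\<bar> * norm x" using k2[of r x] s by auto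
    qed
    also have "\<dots> = (LINT r:{0..s}|lborel. \<bar>k r\<bar>) * norm x" by simp
    also have "\<dots> \<le> (LINT r:{0..T}|lborel. \<bar>k r\<bar>) * norm x"
    proof (rule mult_right_mono)
      have "(LINT r:{0..T}|lborel. \<bar>k r\<bar>) = (LINT r:{0..s}|lborel. \<bar>k r\<bar>) + (LINT r:{s..T}|lborel. \<bar>k r\<bar>)"
        by (rule set_integral_Icc_split[OF k_abs]) (use s in auto)
      moreover have "0 \<le> (LINT r:{s..T}|lborel. \<bar>k r\<bar>)" 
        unfolding set_lebesgue_integral_def by (rule Bochner_Integration.integral_nonneg) simp
      ultimately show "(LINT r:{0..s}|lborel. \<bar>k r\<bar>) \<le> (LINT r:{0..T}|lborel. \<bar>k r\<bar>)" by simp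
    qed simp
    finally show ?thesis using A_eq[OF s, of x] K0[of x] norm_triangle_ineq[of "A 0 x" "LINT r:{0..s}|lborel. A' r x"]
      by (simp add: K_def algebra_simps)
  qed
  have Ax'_int: "set_integrable lborel {0..T} (\<lambda>r. A r (x' r))"
    by (rule set_integrable_dominated[OF A_app[OF x'_meas] set_integrable_mult_right[OF set_integrable_norm[OF x']] A_bound])
  have A'X_int: "set_integrable lborel {0..T} (\<lambda>r. A' r (X r))"
  proof (rule set_integrable_dominated[OF A'_app[OF continuous_on_lebI_measurable[OF X_cont]]])
    show "set_integrable lborel {0..T} (\<lambda>r. \<bar>k r\<bar> * B)" by (intro set_integrable_mult_left k_abs)
    show "norm (A' r (X r)) \<le> \<bar>k r\<bar> * B" if "r \<in> {0..T}" for r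
    proof -
      have "norm (A' r (X r)) \<le> \<bar>k r\<bar> * norm (X r)"
        by (rule k2[OF that])
      also have "\<dots> \<le> \<bar>k r\<bar> * B" by (intro mult_left_mono B that) simp
      finally show ?thesis .
    qed
  qed
  show "set_integrable lborel {0..T} (\<lambda>r. A' r (X r) + A r (x' r))"
    by (intro set_integral_add A'X_int Ax'_int)
  assume s: "s \<in> {0..T}"
  have sub: "set_integrable lborel {0..s} f" if "set_integrable lborel {0..T} f" for f :: "real \<Rightarrow> 'c::{banach,second_countable_topology}"
    by (rule set_integrable_subinterval[OF that]) (use s in auto)
  note fub = triangle_fubini[of "\<lambda>r \<tau>. A' r (x' \<tau>)" s "\<lambda>r. \<bar>k r\<bar>" "\<lambda>\<tau>. norm (x' \<tau>)"]
  have m: "(\<lambda>p. A' (fst p) (x' (snd p))) \<in> borel_measurable (restrict_space borel (triangle s))"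
  proof (rule borel_measurable_caratheodory[where A = "\<lambda>p. A' (fst p)" and X = "\<lambda>p. x' (snd p)"])
    show "continuous_on UNIV (A' (fst p))" if "p \<in> space (restrict_space borel (triangle s))" for p
      using that s by (intro linear_continuous_on A') (auto simp: space_restrict_space)
    show "(\<lambda>p. A' (fst p) x) \<in> borel_measurable (restrict_space borel (triangle s))" for x
      using s by (intro measurable_compose[OF fst_measurable_triangle A'_meas]) auto
    show "(\<lambda>p. x' (snd p)) \<in> borel_measurable (restrict_space borel (triangle s))"
      using s by (intro measurable_compose[OF snd_measurable_triangle x'_meas]) auto
  qed
  have bd: "norm (A' r (x' \<tau>)) \<le> \<bar>k r\<bar> * norm (x' \<tau>)" if "0 \<le> \<tau>" "\<tau> \<le> r" "r \<le> s" for r \<tau>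
    using k2[of r "x' \<tau>"] that s by auto
  note fub = fub[OF m sub[OF k_abs] sub[OF set_integrable_norm[OF x']] bd]
  have step: "A s z = A \<tau> z + (LINT r:{\<tau>..s}|lborel. A' r z)" if "\<tau> \<in> {0..s}" for \<tau> z
    using A_eq[OF s, of z] A_eq[of \<tau> z] set_integral_Icc_split[OF sub[OF A'_int[of z]], of \<tau>] that s by simp
  have inner: "(LINT \<tau>:{0..r}|lborel. A' r (x' \<tau>)) = A' r (X r) - A' r (X 0)" if r: "r \<in> {0..s}" for r
  proof -
    have rT: "r \<in> {0..T}" using r s by auto
    have "(LINT \<tau>:{0..r}|lborel. A' r (x' \<tau>)) = A' r (LINT \<tau>:{0..r}|lborel. x' \<tau>)"
      by (rule set_integral_bounded_linear(2)[OF A'[OF rT] set_integrable_subinterval[OF x']]) (use r s in auto)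
    also have "\<dots> = A' r (X r - X 0)" using X_eq[OF rT] by simp
    finally show ?thesis by (simp add: linear_simps(2)[OF A'[OF rT]])
  qed
  have "A s (X s) = A s (X 0) + A s (LINT \<tau>:{0..s}|lborel. x' \<tau>)"
    using X_eq[OF s] by (simp add: linear_simps(1)[OF A[OF s]])
  also have "A s (LINT \<tau>:{0..s}|lborel. x' \<tau>) = (LINT \<tau>:{0..s}|lborel. A s (x' \<tau>))"
    by (rule set_integral_bounded_linear(2)[OF A[OF s] sub[OF x'], symmetric])
  also have "(LINT \<tau>:{0..s}|lborel. A s (x' \<tau>)) = (LINT \<tau>:{0..s}|lborel. A \<tau> (x' \<tau>) + (LINT r:{\<tau>..s}|lborel. A' r (x' \<tau>)))"
    using step by (intro set_lebesgue_integral_cong) auto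
  also have "\<dots> = (LINT \<tau>:{0..s}|lborel. A \<tau> (x' \<tau>)) + (LINT \<tau>:{0..s}|lborel. (LINT r:{\<tau>..s}|lborel. A' r (x' \<tau>)))"
    by (rule set_integral_add(2)[OF sub[OF Ax'_int] fub(2)])
  also have "(LINT \<tau>:{0..s}|lborel. (LINT r:{\<tau>..s}|lborel. A' r (x' \<tau>))) = (LINT r:{0..s}|lborel. (LINT \<tau>:{0..r}|lborel. A' r (x' \<tau>)))"
    by (rule fub(3)[symmetric])
  also have "\<dots> = (LINT r:{0..s}|lborel. A' r (X r) - A' r (X 0))"
    using inner by (intro set_lebesgue_integral_cong) auto
  also have "\<dots> = (LINT r:{0..s}|lborel. A' r (X r)) - (LINT r:{0..s}|lborel. A' r (X 0))"
    by (rule set_integral_diff(2)[OF sub[OF A'X_int] sub[OF A'_int]])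
  finally show "A s (X s) = A 0 (X 0) + (LINT r:{0..s}|lborel. A' r (X r) + A r (x' r))"
    using A_eq[OF s, of "X 0"] set_integral_add(2)[OF sub[OF A'X_int] sub[OF Ax'_int]] by simp
qed

text \<open>Gronwall applied to the norm of the solution. The case \<open>d = 0\<close> is the
  uniqueness statement behind the cocycle law and the variation of constants formula.\<close>

lemma linear_volterra_bound:
  fixes A :: "real \<Rightarrow> 'a::{banach,second_countable_topology} \<Rightarrow> 'a"
  assumes L: "0 \<le> L" "\<And>s x. s \<in> {a..b} \<Longrightarrow> norm (A s x) \<le> L * norm x"
    and int: "set_integrable lborel {a..b} (\<lambda>\<tau>. A \<tau> (D \<tau>))"
    and eq: "\<And>s. s \<in> {a..b} \<Longrightarrow> D s = d + (LINT \<tau>:{a..s}|lborel. A \<tau> (D \<tau>))"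
    and s: "s \<in> {a..b}"
  shows "norm (D s) \<le> norm d * exp (L * (s - a))"
proof (rule gronwall[OF _ L(1) _ s])
  show cont: "continuous_on {a..b} (\<lambda>s. norm (D s))"
    by (rule continuous_on_norm[OF continuous_on_integral_form[OF int eq]])
  fix s assume s: "s \<in> {a..b}"
  have "norm (LINT \<tau>:{a..s}|lborel. A \<tau> (D \<tau>)) \<le> (LINT \<tau>:{a..s}|lborel. L * norm (D \<tau>))"
  proof (rule set_integral_norm_le)
    show "set_integrable lborel {a..s} (\<lambda>\<tau>. A \<tau> (D \<tau>))" by (rule set_integrable_subinterval[OF int]) (use s in auto)
    show "set_integrable lborel {a..s} (\<lambda>\<tau>. L * norm (D \<tau>))"
      by (rule set_integrable_mult_right, rule set_integrable_subinterval[OF borel_integrable_atLeastAtMost'[OF cont]]) (use s in auto)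
  qed (use L s in auto)
  then show "norm (D s) \<le> norm d + L * (LINT \<tau>:{a..s}|lborel. norm (D \<tau>))"
    using eq[OF s] norm_triangle_ineq[of d "LINT \<tau>:{a..s}|lborel. A \<tau> (D \<tau>)"] by simp
qed

section \<open>Evolution families\<close>

locale evolution_family =
  fixes T :: real and A :: "real \<Rightarrow> 'h::{real_inner,banach,second_countable_topology} \<Rightarrow> 'h"
    and Phi :: "real \<Rightarrow> real \<Rightarrow> 'h \<Rightarrow> 'h"
  assumes T: "0 < T" and A: "op_family_Linf T A" and Phi: "evolution_op T A Phi"
begin

lemma Phi_linear: "0 \<le> t \<Longrightarrow> t \<le> s \<Longrightarrow> s \<le> T \<Longrightarrow> bounded_linear (Phi s t)"
  and Phi_integrable: "0 \<le> t \<Longrightarrow> t \<le> s \<Longrightarrow> s \<le> T \<Longrightarrow> set_integrable lborel {t..s} (\<lambda>\<tau>. A \<tau> (Phi \<tau> t x))"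
  and Phi_eq: "0 \<le> t \<Longrightarrow> t \<le> s \<Longrightarrow> s \<le> T \<Longrightarrow> Phi s t x = x + (LINT \<tau>:{t..s}|lborel. A \<tau> (Phi \<tau> t x))"
  using Phi unfolding evolution_op_def by blast+

lemma Phi_bounded:
  obtains K where "1 \<le> K" "\<And>s t x. 0 \<le> t \<Longrightarrow> t \<le> s \<Longrightarrow> s \<le> T \<Longrightarrow> norm (Phi s t x) \<le> K * norm x"
proof -
  obtain L where L: "0 < L" "\<And>s x. s \<in> {0..T} \<Longrightarrow> norm (A s x) \<le> L * norm x" using A op_family_LinfE by blast
  have "norm (Phi s t x) \<le> exp (L * T) * norm x" if "0 \<le> t" "t \<le> s" "s \<le> T" for s t x
  proof -
    have "norm (Phi s t x) \<le> norm x * exp (L * (s - t))"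
      by (rule linear_volterra_bound[where b = s and A = A and D = "\<lambda>s. Phi s t x"])
        (use that L Phi_integrable[of t s x] Phi_eq[of t _ x] in auto)
    also have "\<dots> \<le> norm x * exp (L * T)" using L that by (intro mult_left_mono) auto
    finally show ?thesis by (simp add: mult.commute)
  qed
  moreover have "1 \<le> exp (L * T)" using L T by simp
  ultimately show thesis using that by blast
qed

text \<open>On \<open>{r..s}\<close> both sides solve the same integral equation with the same value
  at \<open>r\<close>, so their difference solves a homogeneous Volterra equation with zero
  datum.\<close>

lemma Phi_cocycle:
  assumes "0 \<le> t" "t \<le> r" "r \<le> s" "s \<le> T"
  shows "Phi s t x = Phi s r (Phi r t x)"
proof -
  obtain L where L: "0 < L" "\<And>s x. s \<in> {0..T} \<Longrightarrow> norm (A s x) \<le> L * norm x" using A op_family_LinfE by blast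
  define D where "D \<sigma> = Phi \<sigma> t x - Phi \<sigma> r (Phi r t x)" for \<sigma>
  have i1: "set_integrable lborel {r..\<sigma>} (\<lambda>\<tau>. A \<tau> (Phi \<tau> t x))" if "\<sigma> \<le> s" for \<sigma>
    by (rule set_integrable_subinterval[OF Phi_integrable[of t s x]]) (use assms that in auto)
  have i2: "set_integrable lborel {r..\<sigma>} (\<lambda>\<tau>. A \<tau> (Phi \<tau> r (Phi r t x)))" if "\<sigma> \<le> s" for \<sigma>
    by (rule set_integrable_subinterval[OF Phi_integrable[of r s]]) (use assms that in auto)
  have AD: "A \<tau> (D \<tau>) = A \<tau> (Phi \<tau> t x) - A \<tau> (Phi \<tau> r (Phi r t x))" if "\<tau> \<in> {r..s}" for \<tau>
    unfolding D_def by (rule linear_simps(2)[OF op_family_bounded_linear[OF A]]) (use that assms in auto)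
  have iD: "set_integrable lborel {r..\<sigma>} (\<lambda>\<tau>. A \<tau> (D \<tau>))" if "\<sigma> \<le> s" for \<sigma>
  proof -
    have "set_integrable lborel {r..\<sigma>} (\<lambda>\<tau>. A \<tau> (Phi \<tau> t x) - A \<tau> (Phi \<tau> r (Phi r t x)))"
      by (rule set_integral_diff(1)[OF i1[OF that] i2[OF that]])
    then show ?thesis using AD that by (subst set_integrable_cong[OF refl refl]) auto
  qed
  have "norm (D s) \<le> norm (0::'h) * exp (L * (s - r))"
  proof (rule linear_volterra_bound[where b = s and A = A])
    show "D \<sigma> = 0 + (LINT \<tau>:{r..\<sigma>}|lborel. A \<tau> (D \<tau>))" if s: "\<sigma> \<in> {r..s}" for \<sigma>
    proof -
      have "(LINT \<tau>:{r..\<sigma>}|lborel. A \<tau> (D \<tau>)) = (LINT \<tau>:{r..\<sigma>}|lborel. A \<tau> (Phi \<tau> t x) - A \<tau> (Phi \<tau> r (Phi r t x)))"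
        using AD s by (intro set_lebesgue_integral_cong) auto
      also have "\<dots> = (LINT \<tau>:{r..\<sigma>}|lborel. A \<tau> (Phi \<tau> t x)) - (LINT \<tau>:{r..\<sigma>}|lborel. A \<tau> (Phi \<tau> r (Phi r t x)))"
        by (rule set_integral_diff(2)[OF i1 i2]) (use s in auto)
      also have "\<dots> = D \<sigma>"
        using Phi_eq[of t \<sigma> x] Phi_eq[of t r x] Phi_eq[of r \<sigma> "Phi r t x"] s assms
          set_integral_Icc_split[OF Phi_integrable[of t \<sigma> x], of r]
        by (simp add: D_def)
      finally show ?thesis by simp
    qed
  qed (use L assms iD[of s] in auto)
  then show ?thesis by (simp add: D_def)
qed

text \<open>Joint continuity provides the joint measurability that Fubini's theorem requires. The
  evolution equation gives a Lipschitz estimate near the diagonal; the cocycle law carries it to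
  increments in either argument.\<close>

lemma Phi_continuous: "continuous_on (triangle T) (\<lambda>p. Phi (fst p) (snd p) x)"
proof -
  obtain L where L: "0 < L" "\<And>s x. s \<in> {0..T} \<Longrightarrow> norm (A s x) \<le> L * norm x" using A op_family_LinfE by blast
  obtain K where K: "1 \<le> K" "\<And>s t x. 0 \<le> t \<Longrightarrow> t \<le> s \<Longrightarrow> s \<le> T \<Longrightarrow> norm (Phi s t x) \<le> K * norm x"
    using Phi_bounded by blast
  have id: "norm (Phi s t z - z) \<le> L * K * norm z * (s - t)" if "0 \<le> t" "t \<le> s" "s \<le> T" for s t z
  proof -
    have "norm (LINT \<tau>:{t..s}|lborel. A \<tau> (Phi \<tau> t z)) \<le> (LINT \<tau>:{t..s}|lborel. L * K * norm z)"
    proof (rule set_integral_norm_le[OF Phi_integrable[OF that] set_integrable_const_Icc])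
      fix \<tau> assume "\<tau> \<in> {t..s}"
      then show "norm (A \<tau> (Phi \<tau> t z)) \<le> L * K * norm z"
        using order_trans[OF L(2)[of \<tau> "Phi \<tau> t z"] mult_left_mono[OF K(2)[of t \<tau> z], of L]] L(1) that
        by (auto simp: mult.assoc)
    qed
    also have "\<dots> = L * K * norm z * (s - t)"
      using that by (simp add: set_lebesgue_integral_def)
    finally show ?thesis using Phi_eq[OF that, of z] by simp
  qed
  have r: "norm (Phi s t x - Phi r t x) \<le> L * K * K * norm x * (s - r)" if "0 \<le> t" "t \<le> r" "r \<le> s" "s \<le> T" for s r t
  proof -
    have "norm (Phi s t x - Phi r t x) \<le> L * K * norm (Phi r t x) * (s - r)"
      using Phi_cocycle[OF that, of x] id[of r s "Phi r t x"] that by simp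
    also have "\<dots> \<le> L * K * (K * norm x) * (s - r)"
      using L K(1) K(2)[of t r x] that by (intro mult_right_mono mult_left_mono) auto
    finally show ?thesis by (simp add: mult_ac)
  qed
  have t: "norm (Phi s t x - Phi s t' x) \<le> L * K * K * norm x * (t' - t)" if "0 \<le> t" "t \<le> t'" "t' \<le> s" "s \<le> T" for s t t'
  proof -
    have "Phi s t x - Phi s t' x = Phi s t' (Phi t' t x - x)"
      using Phi_cocycle[OF that, of x] that by (simp add: linear_simps(2)[OF Phi_linear])
    then have "norm (Phi s t x - Phi s t' x) \<le> K * norm (Phi t' t x - x)" using K(2)[of t' s] that by auto
    also have "\<dots> \<le> K * (L * K * norm x * (t' - t))" using K(1) that by (intro mult_left_mono id) auto
    finally show ?thesis by (simp add: mult_ac)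
  qed
  define C where "C = L * K * K * norm x"
  have C: "0 \<le> C" using L K by (simp add: C_def)
  have r2: "norm (Phi s t x - Phi r t x) \<le> C * \<bar>s - r\<bar>" if "0 \<le> t" "t \<le> r" "t \<le> s" "s \<le> T" "r \<le> T" for s r t
    using r[of t r s] r[of t s r] that by (cases "r \<le> s") (auto simp: C_def norm_minus_commute)
  have t2: "norm (Phi s t x - Phi s t' x) \<le> C * \<bar>t - t'\<bar>" if "0 \<le> t" "0 \<le> t'" "t' \<le> s" "t \<le> s" "s \<le> T" for s t t'
    using t[of t t' s] t[of t' t s] that by (cases "t \<le> t'") (auto simp: C_def norm_minus_commute)
  have lip: "dist (Phi s t x) (Phi s' t' x) \<le> C * (2 * \<bar>s - s'\<bar> + \<bar>t - t'\<bar>)"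
    if "0 \<le> t" "t \<le> s" "s \<le> T" "0 \<le> t'" "t' \<le> s'" "s' \<le> T" for s t s' t'
  proof -
    \<comment> \<open>The detour through the larger first argument keeps all intermediate points in
      the triangle. Raising \<open>s\<close> and \<open>s'\<close> to \<open>m\<close> accounts for
      the factor 2.\<close>
    define m where "m = max s s'"
    have "norm (Phi s t x - Phi s' t' x) \<le> norm (Phi s t x - Phi m t x) + (norm (Phi m t x - Phi m t' x) + norm (Phi m t' x - Phi s' t' x))"
      by norm
    also have "\<dots> \<le> C * \<bar>s - m\<bar> + (C * \<bar>t - t'\<bar> + C * \<bar>m - s'\<bar>)"
      using that by (intro add_mono r2 t2) (auto simp: m_def)
    also have "\<dots> \<le> C * (2 * \<bar>s - s'\<bar> + \<bar>t - t'\<bar>)"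
      unfolding distrib_left[symmetric] by (rule mult_left_mono[OF _ C]) (auto simp: m_def max_def)
    finally show ?thesis by (simp add: dist_norm)
  qed
  show ?thesis
  proof (rule lipschitz_on_continuous_on[of "3 * C"], rule lipschitz_onI)
    fix p q assume pq: "p \<in> triangle T" "q \<in> triangle T"
    have "\<bar>fst p - fst q\<bar> \<le> dist p q" "\<bar>snd p - snd q\<bar> \<le> dist p q"
      using dist_fst_le[of p q] dist_snd_le[of p q] by (auto simp: dist_real_def)
    then have "C * (2 * \<bar>fst p - fst q\<bar> + \<bar>snd p - snd q\<bar>) \<le> C * (3 * dist p q)" by (intro mult_left_mono C) auto
    then show "dist (Phi (fst p) (snd p) x) (Phi (fst q) (snd q) x) \<le> 3 * C * dist p q"
      using lip[of "snd p" "fst p" "snd q" "fst q"] pq by simp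
  qed (use C in simp)
qed

lemma Phi_snd_measurable:
  assumes "0 \<le> s" "s \<le> T"
  shows "(\<lambda>\<tau>. Phi s \<tau> x) \<in> borel_measurable (lebI s)"
proof (rule continuous_on_lebI_measurable)
  have "continuous_on {0..s} (\<lambda>\<tau>. (\<lambda>p. Phi (fst p) (snd p) x) (s, \<tau>))"
    by (rule continuous_on_compose2[OF Phi_continuous]) (use assms in \<open>auto intro!: continuous_intros\<close>)
  then show "continuous_on {0..s} (\<lambda>\<tau>. Phi s \<tau> x)" by simp
qed

lemma Phi_apply_integrable:
  assumes s: "0 \<le> s" "s \<le> T" and g: "set_integrable lborel {0..T} g"
  shows "set_integrable lborel {0..s} (\<lambda>\<tau>. Phi s \<tau> (g \<tau>))"
proof -
  obtain K where K: "1 \<le> K" "\<And>s t x. 0 \<le> t \<Longrightarrow> t \<le> s \<Longrightarrow> s \<le> T \<Longrightarrow> norm (Phi s t x) \<le> K * norm x"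
    using Phi_bounded by blast
  have gs: "set_integrable lborel {0..s} g" by (rule set_integrable_subinterval[OF g]) (use s in auto)
  show ?thesis
  proof (rule set_integrable_dominated)
    show "(\<lambda>\<tau>. Phi s \<tau> (g \<tau>)) \<in> borel_measurable (lebI s)"
      by (rule borel_measurable_caratheodory[OF _ Phi_snd_measurable[OF s] set_integrable_lebI_measurable[OF gs]])
        (use s in \<open>auto intro!: linear_continuous_on Phi_linear\<close>)
    show "set_integrable lborel {0..s} (\<lambda>\<tau>. K * norm (g \<tau>))" by (intro set_integrable_mult_right set_integrable_norm gs)
    show "norm (Phi s \<tau> (g \<tau>)) \<le> K * norm (g \<tau>)" if "\<tau> \<in> {0..s}" for \<tau> using K(2) that s by auto
  qed
qed

section \<open>Variation of constants\<close>

definition duhamel :: "'h \<Rightarrow> (real \<Rightarrow> 'h) \<Rightarrow> real \<Rightarrow> 'h" where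
  "duhamel y g s = Phi s 0 y + (LINT \<tau>:{0..s}|lborel. Phi s \<tau> (g \<tau>))"

text \<open>Apply \<open>A r\<close> to the formula, integrate over \<open>r\<close> and exchange
  the order on the triangle. The inner integral over \<open>r\<close> is then
  \<open>Phi s \<tau> (g \<tau>) - g \<tau>\<close> by the evolution equation, and its last term
  cancels the forcing \<open>g\<close>.\<close>

lemma duhamel_solves:
  assumes g: "set_integrable lborel {0..T} g"
  shows "set_integrable lborel {0..T} (\<lambda>r. A r (duhamel y g r) + g r)"
    and "s \<in> {0..T} \<Longrightarrow> duhamel y g s = y + (LINT r:{0..s}|lborel. A r (duhamel y g r) + g r)"
proof -
  obtain L where L: "0 < L" "\<And>s x. s \<in> {0..T} \<Longrightarrow> norm (A s x) \<le> L * norm x" using A op_family_LinfE by blast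
  obtain K where K: "1 \<le> K" "\<And>s t x. 0 \<le> t \<Longrightarrow> t \<le> s \<Longrightarrow> s \<le> T \<Longrightarrow> norm (Phi s t x) \<le> K * norm x"
    using Phi_bounded by blast
  note A_lin = op_family_bounded_linear[OF A]
  have fub: "set_integrable lborel {0..s} (\<lambda>r. LINT \<tau>:{0..r}|lborel. A r (Phi r \<tau> (g \<tau>)))
      \<and> set_integrable lborel {0..s} (\<lambda>\<tau>. LINT r:{\<tau>..s}|lborel. A r (Phi r \<tau> (g \<tau>)))
      \<and> (LINT r:{0..s}|lborel. (LINT \<tau>:{0..r}|lborel. A r (Phi r \<tau> (g \<tau>)))) = (LINT \<tau>:{0..s}|lborel. (LINT r:{\<tau>..s}|lborel. A r (Phi r \<tau> (g \<tau>))))"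
    if s: "s \<in> {0..T}" for s
  proof -
    have Phi_m: "(\<lambda>p. Phi (fst p) (snd p) x) \<in> borel_measurable (restrict_space borel (triangle s))" for x
      by (rule borel_measurable_continuous_on_restrict, rule continuous_on_subset[OF Phi_continuous]) (use s in auto)
    have A_m: "(\<lambda>p. A (fst p) x) \<in> borel_measurable (restrict_space borel (triangle s))" for x
      using s A by (intro measurable_compose[OF fst_measurable_triangle, of s T "\<lambda>r. A r x"]) (auto simp: op_family_Linf_def)
    \<comment> \<open>The curve \<open>g\<close> is inserted last: the composite operator is first
      measurable on a fixed vector, then a second Caratheodory argument replaces that vector by
      \<open>g\<close>.\<close>
    have AP_m: "(\<lambda>p. A (fst p) (Phi (fst p) (snd p) x)) \<in> borel_measurable (restrict_space borel (triangle s))" for x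
      by (rule borel_measurable_caratheodory[OF _ A_m Phi_m])
        (use s in \<open>auto simp: space_restrict_space intro!: linear_continuous_on A_lin\<close>)
    have g_m: "(\<lambda>p. g (snd p)) \<in> borel_measurable (restrict_space borel (triangle s))"
      using s by (intro measurable_compose[OF snd_measurable_triangle set_integrable_lebI_measurable[OF g]]) auto
    have m: "(\<lambda>p. A (fst p) (Phi (fst p) (snd p) (g (snd p)))) \<in> borel_measurable (restrict_space borel (triangle s))"
    proof (rule borel_measurable_caratheodory[where A = "\<lambda>p x. A (fst p) (Phi (fst p) (snd p) x)", OF _ AP_m g_m])
      fix p assume "p \<in> space (restrict_space borel (triangle s))"
      then show "continuous_on UNIV (\<lambda>x. A (fst p) (Phi (fst p) (snd p) x))"
        using s by (intro linear_continuous_on bounded_linear_compose[OF A_lin Phi_linear]) (auto simp: space_restrict_space)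
    qed
    have gs: "set_integrable lborel {0..s} (\<lambda>\<tau>. norm (g \<tau>))"
      by (rule set_integrable_norm, rule set_integrable_subinterval[OF g]) (use s in auto)
    have bd: "norm (A r (Phi r \<tau> (g \<tau>))) \<le> (L * K) * norm (g \<tau>)" if "0 \<le> \<tau>" "\<tau> \<le> r" "r \<le> s" for r \<tau>
      using order_trans[OF L(2)[of r "Phi r \<tau> (g \<tau>)"] mult_left_mono[OF K(2)[of \<tau> r "g \<tau>"], of L]] L(1) that s
      by (auto simp: mult.assoc)
    show ?thesis
      using triangle_fubini[of "\<lambda>r \<tau>. A r (Phi r \<tau> (g \<tau>))", OF m set_integrable_const_Icc[of _ _ "L * K"] gs bd] by blast
  qed
  have inner1: "A r (Phi r 0 y) + (LINT \<tau>:{0..r}|lborel. A r (Phi r \<tau> (g \<tau>))) = A r (duhamel y g r)" if r: "r \<in> {0..T}" for r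
    using set_integral_bounded_linear(2)[OF A_lin[OF r] Phi_apply_integrable[OF _ _ g]] r
    by (simp add: duhamel_def linear_simps(1)[OF A_lin[OF r]])
  have int_s: "set_integrable lborel {0..s} (\<lambda>r. A r (duhamel y g r))" if s: "s \<in> {0..T}" for s
  proof -
    have "set_integrable lborel {0..s} (\<lambda>r. A r (Phi r 0 y) + (LINT \<tau>:{0..r}|lborel. A r (Phi r \<tau> (g \<tau>))))"
      using fub[OF s] Phi_integrable[of 0 s y] s by (intro set_integral_add) auto
    then show ?thesis using inner1 s by (subst (asm) set_integrable_cong[OF refl refl]) auto
  qed
  have gs: "set_integrable lborel {0..s} g" if "s \<in> {0..T}" for s
    by (rule set_integrable_subinterval[OF g]) (use that in auto)
  show "set_integrable lborel {0..T} (\<lambda>r. A r (duhamel y g r) + g r)"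
    using T by (intro set_integral_add int_s g) auto
  assume s: "s \<in> {0..T}"
  have inner2: "(LINT r:{\<tau>..s}|lborel. A r (Phi r \<tau> (g \<tau>))) = Phi s \<tau> (g \<tau>) - g \<tau>" if "\<tau> \<in> {0..s}" for \<tau>
    using Phi_eq[of \<tau> s "g \<tau>"] that s by simp
  have "(LINT r:{0..s}|lborel. A r (duhamel y g r)) = (LINT r:{0..s}|lborel. A r (Phi r 0 y) + (LINT \<tau>:{0..r}|lborel. A r (Phi r \<tau> (g \<tau>))))"
    using inner1 s by (intro set_lebesgue_integral_cong) auto
  also have "\<dots> = (LINT r:{0..s}|lborel. A r (Phi r 0 y)) + (LINT r:{0..s}|lborel. (LINT \<tau>:{0..r}|lborel. A r (Phi r \<tau> (g \<tau>))))"
    using fub[OF s] Phi_integrable[of 0 s y] s by (intro set_integral_add) auto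
  also have "(LINT r:{0..s}|lborel. A r (Phi r 0 y)) = Phi s 0 y - y" using Phi_eq[of 0 s y] s by simp
  also have "(LINT r:{0..s}|lborel. (LINT \<tau>:{0..r}|lborel. A r (Phi r \<tau> (g \<tau>)))) = (LINT \<tau>:{0..s}|lborel. Phi s \<tau> (g \<tau>) - g \<tau>)"
    unfolding conjunct2[OF conjunct2[OF fub[OF s]]] using inner2 by (intro set_lebesgue_integral_cong) auto
  also have "\<dots> = (LINT \<tau>:{0..s}|lborel. Phi s \<tau> (g \<tau>)) - (LINT \<tau>:{0..s}|lborel. g \<tau>)"
    using s by (intro set_integral_diff Phi_apply_integrable g gs) auto
  finally show "duhamel y g s = y + (LINT r:{0..s}|lborel. A r (duhamel y g r) + g r)"
    using set_integral_add(2)[OF int_s[OF s] gs[OF s]] by (simp add: duhamel_def)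
qed

lemma duhamel_unique:
  assumes g: "set_integrable lborel {0..T} g" and int: "set_integrable lborel {0..T} (\<lambda>r. A r (X r) + g r)"
    and X: "\<And>s. s \<in> {0..T} \<Longrightarrow> X s = y + (LINT r:{0..s}|lborel. A r (X r) + g r)" and s: "s \<in> {0..T}"
  shows "X s = duhamel y g s"
proof -
  obtain L where L: "0 < L" "\<And>s x. s \<in> {0..T} \<Longrightarrow> norm (A s x) \<le> L * norm x" using A op_family_LinfE by blast
  define D where "D r = X r - duhamel y g r" for r
  have AD: "A r (D r) = (A r (X r) + g r) - (A r (duhamel y g r) + g r)" if "r \<in> {0..T}" for r
    by (simp add: D_def linear_simps(2)[OF op_family_bounded_linear[OF A that]])
  have "norm (D s) \<le> norm (0::'h) * exp (L * (s - 0))"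
  proof (rule linear_volterra_bound[where b = T and A = A and D = D])
    have "set_integrable lborel {0..T} (\<lambda>r. (A r (X r) + g r) - (A r (duhamel y g r) + g r))"
      by (intro set_integral_diff int duhamel_solves(1) g)
    then show "set_integrable lborel {0..T} (\<lambda>r. A r (D r))"
      using AD by (subst set_integrable_cong[OF refl refl]) auto
    fix s assume s: "s \<in> {0..T}"
    have "(LINT r:{0..s}|lborel. A r (D r)) = (LINT r:{0..s}|lborel. (A r (X r) + g r) - (A r (duhamel y g r) + g r))"
      using AD s by (intro set_lebesgue_integral_cong) auto
    also have "\<dots> = (LINT r:{0..s}|lborel. A r (X r) + g r) - (LINT r:{0..s}|lborel. A r (duhamel y g r) + g r)"
      by (intro set_integral_diff set_integrable_subinterval[OF int] set_integrable_subinterval[OF duhamel_solves(1)[OF g]]) (use s in auto)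
    finally show "D s = 0 + (LINT r:{0..s}|lborel. A r (D r))"
      using X[OF s] duhamel_solves(2)[OF g s, of y] by (simp add: D_def)
  qed (use L s in auto)
  then show ?thesis by (simp add: D_def)
qed

end

section \<open>Representative controls\<close>

text \<open>Landweber iteration: with \<open>S = N\<^sup>-\<^sup>1 G\<^sup>* G\<close>, which is symmetric and positive for the inner product
  \<open>(N u, w)\<close>, the powers of \<open>I - \<alpha> S\<close> converge strongly to the \<open>N\<close>-orthogonal projection onto
  \<open>ker G\<close>. This description makes the projection measurable in parameters.\<close>
lemma landweber_converges:
  fixes G :: "'u::{real_inner,banach} \<Rightarrow> 'h::real_inner" and N S :: "'u \<Rightarrow> 'u" and x :: "nat \<Rightarrow> 'u"
  assumes G: "bounded_linear G" and C: "0 < C" "\<And>u. norm (G u) \<le> C * norm u"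
    and N: "bounded_linear N" "sym_op N" and c: "0 < c" "\<And>u. c * (norm u)\<^sup>2 \<le> inner (N u) u"
    and S: "bounded_linear S" "\<And>u w. inner (N (S u)) w = inner (G u) (G w)"
    and x: "\<And>k. x (Suc k) = x k - (c / C\<^sup>2) *\<^sub>R S (x k)"
  obtains y where "x \<longlonglongrightarrow> y" "G y = 0" "\<And>w. G w = 0 \<Longrightarrow> inner (N (x 0 - y)) w = 0"
proof -
  interpret N: bounded_linear N by fact
  interpret G: bounded_linear G by fact
  define \<alpha> where "\<alpha> = c / C\<^sup>2"
  have \<alpha>: "0 < \<alpha>" using c C by (simp add: \<alpha>_def)
  define b where "b u w = inner (N u) w" for u w
  have b_sym: "b u w = b w u" for u w using N(2) by (simp add: b_def sym_op_def inner_commute)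
  have b_pos: "0 \<le> b u u" for u
  proof -
    have "0 \<le> c * (norm u)\<^sup>2" using c(1) by simp
    then show ?thesis using c(2)[of u] by (simp add: b_def)
  qed
  have b_step: "b (x (Suc j)) w = b (x j) w - \<alpha> * inner (G (x j)) (G w)" for j w
    by (simp add: b_def x \<alpha>_def N.diff N.scale inner_simps S(2))
  \<comment> \<open>The map \<open>I - \<alpha> S\<close> is symmetric for \<open>b\<close>, so one
    step can be moved from one argument to the other. Consequently \<open>b (x j) (x k)\<close>
    depends on \<open>j + k\<close> alone and is a moment \<open>\<mu>\<close> of the
    iteration.\<close>
  have b_shift: "b (x (Suc j)) (x k) = b (x j) (x (Suc k))" for j k
    using b_step[of j "x k"] b_step[of k "x j"] b_sym[of "x j" "x (Suc k)"] b_sym[of "x j" "x k"]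
    by (simp add: inner_commute)
  define \<mu> where "\<mu> m = b (x m) (x 0)" for m
  have b_\<mu>: "b (x j) (x k) = \<mu> (j + k)" for j k
    by (induction k arbitrary: j) (simp_all add: \<mu>_def b_shift[symmetric])
  \<comment> \<open>This says that \<open>S (I - \<alpha> S)\<close> is nonnegative for the form
    \<open>b\<close>. It follows from \<open>c |S u| \<le> C |G u|\<close>, without spectral
    theory.\<close>
  have SG: "\<alpha> * inner (G u) (G (S u)) \<le> (norm (G u))\<^sup>2" for u
  proof -
    have 1: "c * (norm (S u))\<^sup>2 \<le> inner (G u) (G (S u))" using c(2)[of "S u"] by (simp add: S(2))
    have 2: "inner (G u) (G (S u)) \<le> norm (G u) * (C * norm (S u))"
      by (rule order_trans[OF norm_cauchy_schwarz]) (intro mult_left_mono C norm_ge_zero)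
    have 3: "c * norm (S u) \<le> C * norm (G u)"
    proof (cases "S u = 0")
      case False
      have "norm (S u) * (c * norm (S u)) \<le> norm (S u) * (C * norm (G u))"
        using order_trans[OF 1 2] by (simp add: power2_eq_square mult_ac)
      then show ?thesis using False by simp
    qed (use C in simp)
    have "\<alpha> * inner (G u) (G (S u)) \<le> \<alpha> * (norm (G u) * (C * norm (S u)))" using 2 \<alpha> by simp
    also have "\<dots> = norm (G u) / C * (c * norm (S u))" using C(1) by (simp add: \<alpha>_def power2_eq_square)
    also have "\<dots> \<le> norm (G u) / C * (C * norm (G u))" using C(1) by (intro mult_left_mono 3) simp
    also have "\<dots> = (norm (G u))\<^sup>2" using C(1) by (simp add: power2_eq_square)
    finally show ?thesis .
  qed
  have \<mu>_step: "\<mu> (j + k) - \<mu> (Suc (j + k)) = \<alpha> * inner (G (x j)) (G (x k))" for j k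
    using b_step[of j "x k"] b_\<mu>[of "Suc j" k] b_\<mu>[of j k] by simp
  \<comment> \<open>For even \<open>m\<close> the decrement is a multiple of
    \<open>|G (x j)|^2\<close>; for odd \<open>m\<close> it is nonnegative by
    \<open>SG\<close>.\<close>
  have "\<mu> (Suc m) \<le> \<mu> m" for m
  proof (cases "even m")
    case True
    then obtain j where "m = j + j" by (metis evenE mult_2)
    then show ?thesis using \<mu>_step[of j j] \<alpha> by (smt (verit) inner_ge_zero mult_nonneg_nonneg)
  next
    case False
    then obtain j where m: "m = j + Suc j" by (metis oddE mult_2 add_Suc_right Suc_eq_plus1)
    have "inner (G (x j)) (G (x (Suc j))) = (norm (G (x j)))\<^sup>2 - \<alpha> * inner (G (x j)) (G (S (x j)))"
      by (simp add: x \<alpha>_def G.diff G.scale inner_simps power2_norm_eq_inner)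
    then have "0 \<le> inner (G (x j)) (G (x (Suc j)))" using SG[of "x j"] by simp
    then have "0 \<le> \<alpha> * inner (G (x j)) (G (x (Suc j)))" using \<alpha> by simp
    then show ?thesis using \<mu>_step[of j "Suc j"] unfolding m by simp
  qed
  then have dec: "decseq \<mu>" by (rule decseq_SucI)
  \<comment> \<open>Only moments of even index are squared norms; monotonicity transfers the sign to
    all the others.\<close>
  have "0 \<le> \<mu> m" for m
  proof -
    have "0 \<le> \<mu> (m + m)" using b_pos[of "x m"] by (simp add: b_\<mu>)
    also have "\<dots> \<le> \<mu> m" using dec by (simp add: decseq_def)
    finally show ?thesis .
  qed
  then obtain l where l: "\<mu> \<longlonglongrightarrow> l" using decseq_convergent[OF dec] by metis
  have dist: "c * (norm (x j - x k))\<^sup>2 \<le> \<mu> (j + j) - 2 * \<mu> (j + k) + \<mu> (k + k)" for j k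
  proof -
    have "b (x j - x k) (x j - x k) = b (x j) (x j) - 2 * b (x j) (x k) + b (x k) (x k)"
      using b_sym[of "x j" "x k"] by (simp add: b_def N.diff inner_simps)
    then show ?thesis using c(2)[of "x j - x k"] by (simp add: b_\<mu>[symmetric]) (simp add: b_def)
  qed
  have "Cauchy x"
  proof (rule metric_CauchyI)
    fix e :: real assume e: "0 < e"
    \<comment> \<open>In \<open>\<mu> (j + j) - 2 * \<mu> (j + k) + \<mu> (k + k)\<close> the limit
      cancels, and the weights 1, 2, 1 give a total error below
      \<open>4 * d = c * e^2\<close>.\<close>
    define d where "d = c * e\<^sup>2 / 4"
    have d: "d > 0" using e c by (simp add: d_def)
    obtain M where M: "\<And>m. m \<ge> M \<Longrightarrow> \<bar>\<mu> m - l\<bar> < d" using LIMSEQ_D[OF l d] by auto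
    have "dist (x j) (x k) < e" if "j \<ge> M" "k \<ge> M" for j k
    proof -
      have "\<bar>\<mu> (j + j) - l\<bar> < d" "\<bar>\<mu> (j + k) - l\<bar> < d" "\<bar>\<mu> (k + k) - l\<bar> < d" using M that by auto
      then have "c * (norm (x j - x k))\<^sup>2 < 4 * d" using dist[of j k] by linarith
      then have "(norm (x j - x k))\<^sup>2 < e\<^sup>2" using c(1) by (simp add: d_def)
      then show ?thesis using e by (auto simp: dist_norm dest: power_less_imp_less_base)
    qed
    then show "\<exists>M. \<forall>m\<ge>M. \<forall>n\<ge>M. dist (x m) (x n) < e" by blast
  qed
  then obtain y where y: "x \<longlonglongrightarrow> y" using Cauchy_convergent_iff convergent_def by blast
  have "(\<lambda>k. x k - (c / C\<^sup>2) *\<^sub>R S (x k)) \<longlonglongrightarrow> y - (c / C\<^sup>2) *\<^sub>R S y"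
    by (intro tendsto_intros bounded_linear.tendsto[OF S(1)] y)
  moreover have "(\<lambda>k. x k - (c / C\<^sup>2) *\<^sub>R S (x k)) \<longlonglongrightarrow> y" using LIMSEQ_Suc[OF y] by (simp add: x)
  ultimately have "y - (c / C\<^sup>2) *\<^sub>R S y = y" using LIMSEQ_unique by blast
  then have "S y = 0" using c(1) C(1) by simp
  then have Gy: "G y = 0" using S(2)[of y y] by (simp add: N.zero)
  have "inner (N (x 0 - y)) w = 0" if w: "G w = 0" for w
  proof -
    \<comment> \<open>Each correction \<open>S (x k)\<close> is \<open>N\<close>-orthogonal to the
      kernel of \<open>G\<close>, so the component along the kernel never changes.\<close>
    have const: "b (x k) w = b (x 0) w" for k by (induction k) (simp_all add: b_step w)
    have "(\<lambda>k. b (x k) w) \<longlonglongrightarrow> b y w" unfolding b_def by (intro tendsto_intros N.tendsto y)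
    moreover have "(\<lambda>k. b (x k) w) = (\<lambda>k. b (x 0) w)" by (rule ext) (rule const)
    ultimately have "b y w = b (x 0) w" by (metis LIMSEQ_unique tendsto_const)
    then show ?thesis by (simp add: b_def N.diff inner_simps)
  qed
  then show thesis using that y Gy by blast
qed

section \<open>The state equation and its representative controls\<close>

lemma state_eqD:
  assumes "state_eq T F G X V"
  shows "V \<in> borel_measurable (lebI T)" "set_integrable lborel {0..T} (\<lambda>s. (norm (V s))\<^sup>2)"
    "X \<in> borel_measurable (lebI T)" "set_integrable lborel {0..T} (\<lambda>s. (norm (X s))\<^sup>2)"
    "s \<in> {0..T} \<Longrightarrow> set_integrable lborel {0..s} (\<lambda>r. F r (X r) + G r (V r))"
    "s \<in> {0..T} \<Longrightarrow> X s = X 0 + (LINT r:{0..s}|lborel. F r (X r) + G r (V r))"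
  using assms unfolding state_eq_def by blast+

lemma state_eqI:
  assumes "V \<in> borel_measurable (lebI T)" "set_integrable lborel {0..T} (\<lambda>s. (norm (V s))\<^sup>2)"
    "X \<in> borel_measurable (lebI T)" "set_integrable lborel {0..T} (\<lambda>s. (norm (X s))\<^sup>2)"
    "\<And>s. s \<in> {0..T} \<Longrightarrow> set_integrable lborel {0..s} (\<lambda>r. F r (X r) + G r (V r))"
    "\<And>s. s \<in> {0..T} \<Longrightarrow> X s = X 0 + (LINT r:{0..s}|lborel. F r (X r) + G r (V r))"
  shows "state_eq T F G X V"
  using assms unfolding state_eq_def by blast

lemma state_eq_add:
  assumes F: "op_family_Linf T F" and G: "op_family_Linf T G"
    and X: "state_eq T F G X V" and Y: "state_eq T F G Y W"
  shows "state_eq T F G (\<lambda>s. X s + Y s) (\<lambda>s. V s + W s)"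
proof -
  have eq: "F r (X r + Y r) + G r (V r + W r) = (F r (X r) + G r (V r)) + (F r (Y r) + G r (W r))" if "r \<in> {0..T}" for r
    using op_family_bounded_linear[OF F that] op_family_bounded_linear[OF G that] by (simp add: linear_simps)
  show ?thesis
  proof (rule state_eqI)
    fix s assume s: "s \<in> {0..T}"
    note i = state_eqD(5)[OF X s] state_eqD(5)[OF Y s]
    have "set_integrable lborel {0..s} (\<lambda>r. F r (X r + Y r) + G r (V r + W r)) = set_integrable lborel {0..s} (\<lambda>r. (F r (X r) + G r (V r)) + (F r (Y r) + G r (W r)))"
      using eq s by (intro set_integrable_cong) auto
    then show "set_integrable lborel {0..s} (\<lambda>r. F r (X r + Y r) + G r (V r + W r))" using set_integral_add(1)[OF i] by simp
    have "(LINT r:{0..s}|lborel. F r (X r + Y r) + G r (V r + W r)) = (LINT r:{0..s}|lborel. (F r (X r) + G r (V r)) + (F r (Y r) + G r (W r)))"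
      using eq s by (intro set_lebesgue_integral_cong) auto
    also have "\<dots> = (LINT r:{0..s}|lborel. F r (X r) + G r (V r)) + (LINT r:{0..s}|lborel. F r (Y r) + G r (W r))"
      by (rule set_integral_add(2)[OF i])
    finally show "X s + Y s = X 0 + Y 0 + (LINT r:{0..s}|lborel. F r (X r + Y r) + G r (V r + W r))"
      by (subst state_eqD(6)[OF X s], subst state_eqD(6)[OF Y s]) simp
  qed (intro borel_measurable_add L2_add state_eqD[OF X] state_eqD[OF Y])+
qed

lemma state_eq_scaleR:
  assumes F: "op_family_Linf T F" and G: "op_family_Linf T G" and X: "state_eq T F G X V"
  shows "state_eq T F G (\<lambda>s. a *\<^sub>R X s) (\<lambda>s. a *\<^sub>R V s)"
proof -
  have eq: "F r (a *\<^sub>R X r) + G r (a *\<^sub>R V r) = a *\<^sub>R (F r (X r) + G r (V r))" if "r \<in> {0..T}" for r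
    using op_family_bounded_linear[OF F that] op_family_bounded_linear[OF G that] by (simp add: linear_simps scaleR_right_distrib)
  show ?thesis
  proof (rule state_eqI)
    fix s assume s: "s \<in> {0..T}"
    have "set_integrable lborel {0..s} (\<lambda>r. F r (a *\<^sub>R X r) + G r (a *\<^sub>R V r)) = set_integrable lborel {0..s} (\<lambda>r. a *\<^sub>R (F r (X r) + G r (V r)))"
      using eq s by (intro set_integrable_cong) auto
    then show "set_integrable lborel {0..s} (\<lambda>r. F r (a *\<^sub>R X r) + G r (a *\<^sub>R V r))"
      using set_integrable_scaleR_right[OF state_eqD(5)[OF X s], of a] by simp
    have "(LINT r:{0..s}|lborel. F r (a *\<^sub>R X r) + G r (a *\<^sub>R V r)) = (LINT r:{0..s}|lborel. a *\<^sub>R (F r (X r) + G r (V r)))"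
      using eq s by (intro set_lebesgue_integral_cong) auto
    then show "a *\<^sub>R X s = a *\<^sub>R X 0 + (LINT r:{0..s}|lborel. F r (a *\<^sub>R X r) + G r (a *\<^sub>R V r))"
      by (subst state_eqD(6)[OF X s]) (simp only: scaleR_right_distrib[of a "X 0"] set_integral_scaleR_right)
  next
    have "set_integrable lborel {0..T} (\<lambda>s. a\<^sup>2 * (norm (V s))\<^sup>2)" "set_integrable lborel {0..T} (\<lambda>s. a\<^sup>2 * (norm (X s))\<^sup>2)"
      by (intro set_integrable_mult_right state_eqD[OF X])+
    then show "set_integrable lborel {0..T} (\<lambda>s. (norm (a *\<^sub>R V s))\<^sup>2)" "set_integrable lborel {0..T} (\<lambda>s. (norm (a *\<^sub>R X s))\<^sup>2)"
      by (simp_all add: power_mult_distrib)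
  qed (intro borel_measurable_scaleR borel_measurable_const state_eqD[OF X])+
qed

locale control_system =
  fixes T :: real
    and F :: "real \<Rightarrow> 'h::{real_inner,banach,second_countable_topology} \<Rightarrow> 'h"
    and G :: "real \<Rightarrow> 'u::{real_inner,banach,second_countable_topology} \<Rightarrow> 'h"
    and N :: "real \<Rightarrow> 'u \<Rightarrow> 'u" and c :: real
  assumes T: "0 < T" and F: "op_family_Linf T F" and G: "op_family_Linf T G" and N: "op_family_Linf T N"
    and N_sym: "s \<in> {0..T} \<Longrightarrow> sym_op (N s)"
    and c: "0 < c" "s \<in> {0..T} \<Longrightarrow> c * (norm v)\<^sup>2 \<le> inner (N s v) v"
begin

lemmas F_linear = op_family_bounded_linear[OF F]
  and G_linear = op_family_bounded_linear[OF G]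
  and N_linear = op_family_bounded_linear[OF N]

lemma Ninv: "op_family_Linf T (\<lambda>s. inv (N s))"
  by (rule op_family_inverse[OF N c])

lemma N_Ninv: "s \<in> {0..T} \<Longrightarrow> N s (inv (N s) v) = v"
  using coercive_bij[OF N_linear c(1) c(2)] by (simp add: bij_is_surj surj_f_inv_f)

lemma N_eq_0:
  assumes "s \<in> {0..T}" "inner (N s v) v = 0" shows "v = 0"
proof -
  have "c * (norm v)\<^sup>2 \<le> 0" using c(2)[OF assms(1), of v] assms(2) by simp
  then show ?thesis using c(1) by (simp add: mult_le_0_iff)
qed

text \<open>From any control subtract its \<open>N\<close>-orthogonal projection onto the kernel of
  \<open>G s\<close>, taken pointwise in \<open>s\<close>. The trajectory is unchanged, the
  projection is measurable as a limit of Landweber iterates, and orthogonality bounds the remainder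
  in \<open>L2\<close>.\<close>

lemma rep_control_exists:
  assumes "X \<in> Hspace T F G"
  obtains V where "rep_control T F G N X V"
proof -
  obtain V where V: "state_eq T F G X V" using assms by (auto simp: Hspace_def)
  have V_meas: "V \<in> borel_measurable (lebI T)" and V_int: "set_integrable lborel {0..T} (\<lambda>s. (norm (V s))\<^sup>2)"
    by (rule state_eqD[OF V])+
  obtain C where C: "0 < C" "\<And>s u. s \<in> {0..T} \<Longrightarrow> norm (G s u) \<le> C * norm u" using G op_family_LinfE by blast
  define S where "S s u = inv (N s) (adjoint (G s) (G s u))" for s u
  have S: "op_family_Linf T S"
    unfolding S_def by (intro op_family_compose[OF Ninv] op_family_compose[OF op_family_adjoint[OF G] G])
  define x where "x = rec_nat V (\<lambda>k z s. z s - (c / C\<^sup>2) *\<^sub>R S s (z s))"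
  have x0: "x 0 = V" and xS: "x (Suc k) = (\<lambda>s. x k s - (c / C\<^sup>2) *\<^sub>R S s (x k s))" for k
    by (simp_all add: x_def)
  have x_meas: "x k \<in> borel_measurable (lebI T)" for k
  proof (induction k)
    case (Suc k)
    then show ?case unfolding xS
      by (intro borel_measurable_diff borel_measurable_scaleR borel_measurable_const op_family_apply_measurable[OF S])
  qed (simp add: x0 V_meas)
  have "\<exists>y. (\<lambda>k. x k s) \<longlonglongrightarrow> y \<and> G s y = 0 \<and> (\<forall>w. G s w = 0 \<longrightarrow> inner (N s (V s - y)) w = 0)" if s: "s \<in> {0..T}" for s
  proof -
    have S2: "inner (N s (S s u)) w = inner (G s u) (G s w)" for u w
      using inner_adjoint[OF G_linear[OF s], of w "G s u"] by (simp add: S_def N_Ninv[OF s] inner_commute)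
    have xs: "x (Suc k) s = x k s - (c / C\<^sup>2) *\<^sub>R S s (x k s)" for k by (simp add: xS)
    obtain y where "(\<lambda>k. x k s) \<longlonglongrightarrow> y" "G s y = 0" "\<And>w. G s w = 0 \<Longrightarrow> inner (N s (x 0 s - y)) w = 0"
      by (rule landweber_converges[where x = "\<lambda>k. x k s", OF G_linear[OF s] C(1) C(2)[OF s] N_linear[OF s] N_sym[OF s] c(1) c(2)[OF s]
          op_family_bounded_linear[OF S s] S2 xs]) blast
    then show ?thesis by (auto simp: x0)
  qed
  then obtain y where y: "\<And>s. s \<in> {0..T} \<Longrightarrow> (\<lambda>k. x k s) \<longlonglongrightarrow> y s" "\<And>s. s \<in> {0..T} \<Longrightarrow> G s (y s) = 0"
    "\<And>s w. s \<in> {0..T} \<Longrightarrow> G s w = 0 \<Longrightarrow> inner (N s (V s - y s)) w = 0" by metis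
  have y_meas: "y \<in> borel_measurable (lebI T)"
    by (rule borel_measurable_LIMSEQ_metric[OF x_meas]) (use y(1) in simp)
  define W where "W s = V s - y s" for s
  have W_meas: "W \<in> borel_measurable (lebI T)" unfolding W_def[abs_def] by (intro borel_measurable_diff V_meas y_meas)
  have GW: "G s (W s) = G s (V s)" if "s \<in> {0..T}" for s
    using y(2)[OF that] by (simp add: W_def linear_simps(2)[OF G_linear[OF that]])
  have NW: "inner (N s (W s)) w = 0" if "s \<in> {0..T}" "G s w = 0" for s w
    using y(3)[OF that] by (simp add: W_def)
  obtain K where K: "0 < K" "\<And>s u. s \<in> {0..T} \<Longrightarrow> norm (N s u) \<le> K * norm u" using N op_family_LinfE by blast
  have W_int: "set_integrable lborel {0..T} (\<lambda>s. (norm (W s))\<^sup>2)"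
  proof (rule set_integrable_dominated)
    show "(\<lambda>s. (norm (W s))\<^sup>2) \<in> borel_measurable (lebI T)" using W_meas by measurable
    show "set_integrable lborel {0..T} (\<lambda>s. (K / c) * (norm (V s))\<^sup>2)" by (intro set_integrable_mult_right V_int)
    fix s assume s: "s \<in> {0..T}"
    have Vs: "V s = W s + y s" by (simp add: W_def)
    \<comment> \<open>Pythagoras for the form of \<open>N s\<close>: the two parts of
      \<open>V s\<close> are orthogonal, so the form at \<open>W s\<close> is at most the form at
      \<open>V s\<close>.\<close>
    have "inner (N s (y s)) (W s) = 0"
      using NW[OF s y(2)[OF s]] N_sym[OF s] by (simp add: sym_op_def inner_commute)
    then have "inner (N s (V s)) (V s) = inner (N s (W s)) (W s) + inner (N s (y s)) (y s)"
      using NW[OF s y(2)[OF s]] unfolding Vs by (simp add: linear_simps(1)[OF N_linear[OF s]] inner_simps)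
    moreover have "0 \<le> inner (N s (y s)) (y s)"
      using c(2)[OF s, of "y s"] c(1) by (meson less_imp_le mult_nonneg_nonneg order_trans zero_le_power2)
    ultimately have "c * (norm (W s))\<^sup>2 \<le> inner (N s (V s)) (V s)" using c(2)[OF s, of "W s"] by linarith
    also have "\<dots> \<le> norm (N s (V s)) * norm (V s)" by (rule norm_cauchy_schwarz)
    also have "\<dots> \<le> (K * norm (V s)) * norm (V s)" by (intro mult_right_mono K s) simp
    finally show "norm ((norm (W s))\<^sup>2) \<le> (K / c) * (norm (V s))\<^sup>2"
      using c(1) by (simp add: field_simps power2_eq_square)
  qed
  have "state_eq T F G X W"
  proof -
    have *: "set_integrable lborel {0..s} (\<lambda>r. F r (X r) + G r (W r)) = set_integrable lborel {0..s} (\<lambda>r. F r (X r) + G r (V r))"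
      if "s \<in> {0..T}" for s using GW that by (intro set_integrable_cong) auto
    have **: "(LINT r:{0..s}|lborel. F r (X r) + G r (W r)) = (LINT r:{0..s}|lborel. F r (X r) + G r (V r))"
      if "s \<in> {0..T}" for s using GW that by (intro set_lebesgue_integral_cong) auto
    show ?thesis
      by (rule state_eqI[OF W_meas W_int state_eqD(3,4)[OF V]])
        (simp only: * state_eqD(5)[OF V], simp only: ** state_eqD(6)[OF V, symmetric])
  qed
  then have "rep_control T F G N X W" using NW by (auto simp: rep_control_def)
  then show thesis by (rule that)
qed

text \<open>The two right-hand sides have equal integrals over every \<open>{0..s}\<close>, so
  \<open>G s (V s - W s) = 0\<close> almost everywhere. The difference then lies in the kernel of
  \<open>G s\<close> and is \<open>N\<close>-orthogonal to it.\<close>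

lemma rep_control_unique:
  assumes V: "rep_control T F G N X V" and W: "rep_control T F G N X W"
  shows "AE s in lborel. s \<in> {0..T} \<longrightarrow> V s = W s"
proof -
  have stV: "state_eq T F G X V" and stW: "state_eq T F G X W" using V W by (auto simp: rep_control_def)
  let ?f = "\<lambda>r. (F r (X r) + G r (V r)) - (F r (X r) + G r (W r))"
  have i: "set_integrable lborel {0..s} (\<lambda>r. F r (X r) + G r (V r))" "set_integrable lborel {0..s} (\<lambda>r. F r (X r) + G r (W r))"
    if "s \<in> {0..T}" for s by (rule state_eqD(5)[OF stV that] state_eqD(5)[OF stW that])+
  have "AE s in lborel. s \<in> {0..T} \<longrightarrow> ?f s = 0"
  proof (rule AE_zero_of_integral_zero)
    show "set_integrable lborel {0..T} ?f" using T by (intro set_integral_diff i) auto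
    fix s assume s: "s \<in> {0..T}"
    have "X s = X 0 + (LINT r:{0..s}|lborel. F r (X r) + G r (V r))" "X s = X 0 + (LINT r:{0..s}|lborel. F r (X r) + G r (W r))"
      by (rule state_eqD(6)[OF stV s] state_eqD(6)[OF stW s])+
    then show "(LINT r:{0..s}|lborel. ?f r) = 0" using set_integral_diff(2)[OF i[OF s]] by simp
  qed
  moreover have "AE s in lborel. s \<in> {0..T} \<longrightarrow> (\<forall>w. G s w = 0 \<longrightarrow> inner (N s (V s)) w = 0)"
    "AE s in lborel. s \<in> {0..T} \<longrightarrow> (\<forall>w. G s w = 0 \<longrightarrow> inner (N s (W s)) w = 0)"
    using V W by (auto simp: rep_control_def)
  ultimately show ?thesis
  proof eventually_elim
    case (elim s)
    show ?case
    proof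
      assume s: "s \<in> {0..T}"
      have "G s (V s - W s) = 0" using elim(1) s by (simp add: linear_simps(2)[OF G_linear[OF s]])
      then have "inner (N s (V s - W s)) (V s - W s) = 0"
        using elim(2,3) s by (simp add: linear_simps(2)[OF N_linear[OF s]] inner_diff_left)
      then show "V s = W s" using N_eq_0[OF s] by force
    qed
  qed
qed

lemma rep_control_add:
  assumes "rep_control T F G N X V" "rep_control T F G N Y W"
  shows "rep_control T F G N (\<lambda>s. X s + Y s) (\<lambda>s. V s + W s)"
proof -
  have "AE s in lborel. s \<in> {0..T} \<longrightarrow> (\<forall>w. G s w = 0 \<longrightarrow> inner (N s (V s)) w = 0)"
    "AE s in lborel. s \<in> {0..T} \<longrightarrow> (\<forall>w. G s w = 0 \<longrightarrow> inner (N s (W s)) w = 0)"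
    using assms by (auto simp: rep_control_def)
  then have "AE s in lborel. s \<in> {0..T} \<longrightarrow> (\<forall>w. G s w = 0 \<longrightarrow> inner (N s (V s + W s)) w = 0)"
    by eventually_elim (use linear_simps(1)[OF N_linear] in \<open>auto simp: inner_add_left\<close>)
  then show ?thesis using assms state_eq_add[OF F G] by (auto simp: rep_control_def)
qed

lemma rep_control_scaleR:
  assumes "rep_control T F G N X V"
  shows "rep_control T F G N (\<lambda>s. a *\<^sub>R X s) (\<lambda>s. a *\<^sub>R V s)"
proof -
  have "AE s in lborel. s \<in> {0..T} \<longrightarrow> (\<forall>w. G s w = 0 \<longrightarrow> inner (N s (V s)) w = 0)"
    using assms by (auto simp: rep_control_def)
  then have "AE s in lborel. s \<in> {0..T} \<longrightarrow> (\<forall>w. G s w = 0 \<longrightarrow> inner (N s (a *\<^sub>R V s)) w = 0)"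
    by eventually_elim (use linear_simps(5)[OF N_linear] in auto)
  then show ?thesis using assms state_eq_scaleR[OF F G] by (auto simp: rep_control_def)
qed

lemma rep_control_diff:
  assumes "rep_control T F G N X V" "rep_control T F G N Y W"
  shows "rep_control T F G N (\<lambda>s. X s - Y s) (\<lambda>s. V s - W s)"
  using rep_control_add[OF assms(1) rep_control_scaleR[OF assms(2), of "- 1"]] by simp

lemma inner_N_integrable:
  assumes "V \<in> borel_measurable (lebI T)" "set_integrable lborel {0..T} (\<lambda>s. (norm (V s))\<^sup>2)"
    and "W \<in> borel_measurable (lebI T)" "set_integrable lborel {0..T} (\<lambda>s. (norm (W s))\<^sup>2)"
  shows "set_integrable lborel {0..T} (\<lambda>s. inner (N s (V s)) (W s))"
proof (rule set_integrable_dominated)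
  show "(\<lambda>s. inner (N s (V s)) (W s)) \<in> borel_measurable (lebI T)"
    by (intro borel_measurable_inner op_family_apply_measurable[OF N] assms)
  show "set_integrable lborel {0..T} (\<lambda>s. norm (N s (V s)) * norm (W s))"
    by (intro L2_mult op_family_apply_measurable[OF N] L2_op_family[OF N] assms)
qed (simp add: Cauchy_Schwarz_ineq2)

end

section \<open>The Riccati equation and the closed loop\<close>

locale riccati_system = control_system T F G N c
  for T :: real
    and F :: "real \<Rightarrow> 'h::{real_inner,banach,second_countable_topology} \<Rightarrow> 'h"
    and G :: "real \<Rightarrow> 'u::{real_inner,banach,second_countable_topology} \<Rightarrow> 'h"
    and N :: "real \<Rightarrow> 'u \<Rightarrow> 'u" and c :: real +
  fixes M P :: "real \<Rightarrow> 'h \<Rightarrow> 'h" and JT :: "'h \<Rightarrow> 'h"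
  assumes M: "op_family_Linf T M"
    and P_linear: "s \<in> {0..T} \<Longrightarrow> bounded_linear (P s)" and P_sym: "s \<in> {0..T} \<Longrightarrow> sym_op (P s)"
    and riccati: "riccati_solution T F G N M JT P"
begin

abbreviation "R \<equiv> riccati_rhs F G N M P"

abbreviation "A \<equiv> closed_loop F G N P"

definition feedback :: "real \<Rightarrow> 'h \<Rightarrow> 'u" where
  "feedback s x = inv (N s) (adjoint (G s) (P s x))"

lemma R_integrable: "set_integrable lborel {0..T} (\<lambda>\<tau>. R \<tau> x)"
  and P_backward: "s \<in> {0..T} \<Longrightarrow> P s x = JT x + (LINT r:{s..T}|lborel. R r x)"
  using riccati T unfolding riccati_solution_def by force+

lemma P_T: "P T x = JT x"
proof -
  have "(LINT r:{T..T}|lborel. R r x) = 0"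
    by (simp add: set_lebesgue_integral_def integral_eq_zero_AE[OF AE_mp[OF AE_lborel_singleton[of T]]])
  then show ?thesis using P_backward[of T x] T by simp
qed

text \<open>The Riccati solution is anchored at its terminal value, whereas the product rule
  integrates from 0; hence this form with \<open>- R\<close> as derivative.\<close>

lemma P_forward:
  assumes s: "s \<in> {0..T}"
  shows "P s x = P 0 x + (LINT r:{0..s}|lborel. - R r x)"
proof -
  have "(LINT r:{0..s}|lborel. - R r x) = - (LINT r:{0..s}|lborel. R r x)"
    by (rule set_integral_uminus, rule set_integrable_subinterval[OF R_integrable]) (use s in auto)
  moreover have "(LINT r:{0..T}|lborel. R r x) = (LINT r:{0..s}|lborel. R r x) + (LINT r:{s..T}|lborel. R r x)"
    by (rule set_integral_Icc_split[OF R_integrable]) (use s in auto)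
  ultimately show ?thesis using P_backward[OF s, of x] P_backward[of 0 x] T by simp
qed

text \<open>Boundedness is given for each \<open>P s\<close> separately. The integral equation makes
  \<open>s |-> P s x\<close> continuous, hence bounded on the compact interval, and the uniform
  boundedness principle yields a common bound. Only integrability of the Riccati right-hand side
  enters, so its own boundedness can be derived afterwards.\<close>

lemma P: "op_family_Linf T P"
proof -
  have minus_R: "set_integrable lborel {0..T} (\<lambda>\<tau>. - R \<tau> x)" for x
    using set_integrable_scaleR_right[OF R_integrable, of "- 1" x] by simp
  have cont: "continuous_on {0..T} (\<lambda>s. P s x)" for x
    by (rule continuous_on_integral_form[OF minus_R P_forward])
  have "\<exists>C\<ge>0. \<forall>s\<in>{0..T}. \<forall>x. norm (P s x) \<le> C * norm x"
  proof (rule uniform_boundedness[OF P_linear])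
    fix x
    show "\<exists>B. \<forall>s\<in>{0..T}. norm (P s x) \<le> B"
      using compact_imp_bounded[OF compact_continuous_image[OF cont compact_Icc]] unfolding bounded_iff by blast
  qed
  then obtain C where "0 \<le> C" "\<And>s x. s \<in> {0..T} \<Longrightarrow> norm (P s x) \<le> C * norm x" by blast
  then show ?thesis
    by (intro op_family_LinfI[where C = C] P_linear continuous_on_lebI_measurable cont)
qed

lemma feedback: "op_family_Linf T feedback"
  unfolding feedback_def[abs_def]
  by (intro op_family_compose[OF Ninv] op_family_compose[OF op_family_adjoint[OF G] P])

lemma closed_loop_eq: "A s x = F s x - G s (feedback s x)"
  by (simp add: closed_loop_def feedback_def)

lemma A: "op_family_Linf T A"
  unfolding closed_loop_eq[abs_def] by (intro op_family_diff F op_family_compose[OF G feedback])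

lemma riccati_rhs_eq: "R s x = P s (F s x) + adjoint (F s) (P s x) - P s (G s (feedback s x)) + M s x"
  by (simp add: riccati_rhs_def feedback_def)

lemma R: "op_family_Linf T R"
  unfolding riccati_rhs_eq[abs_def]
  by (intro op_family_add op_family_diff M op_family_compose[OF P F] op_family_compose[OF op_family_adjoint[OF F] P]
      op_family_compose[OF P op_family_compose[OF G feedback]])

text \<open>The closed loop is again a control system with the same \<open>G\<close> and
  \<open>N\<close>, so linearity and almost everywhere uniqueness of representative controls apply
  to closed-loop controls as well.\<close>

sublocale CL: control_system T A G N c
  by unfold_locales (use T A G N N_sym c in auto)

text \<open>\<open>N s (feedback s x)\<close> is the image of \<open>P s x\<close> under the adjoint
  of \<open>G s\<close>, hence orthogonal to the kernel of \<open>G s\<close>. This is the reason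
  that adding feedback preserves representative controls.\<close>

lemma inner_N_feedback: "s \<in> {0..T} \<Longrightarrow> inner (N s (feedback s x)) v = inner (P s x) (G s v)"
  using inner_adjoint[OF G_linear, of s v "P s x"] by (simp add: feedback_def N_Ninv inner_commute)

text \<open>The left side is the formal derivative of \<open>(P X, Y)\<close> along trajectories
  with controls \<open>v\<close> and \<open>w\<close>. The Riccati equation cancels the terms in
  \<open>F\<close>, and its quadratic term completes the square. The polarised form is kept because
  inner products of two different trajectories are needed.\<close>

lemma pointwise_energy:
  assumes s: "s \<in> {0..T}"
  shows "- R s x \<bullet> y + P s (F s x + G s v) \<bullet> y + P s x \<bullet> (F s y + G s w)
    = N s (v + feedback s x) \<bullet> (w + feedback s y) - N s v \<bullet> w - M s x \<bullet> y"
proof -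
  interpret P: bounded_linear "P s" by (rule P_linear[OF s])
  interpret N: bounded_linear "N s" by (rule N_linear[OF s])
  have symP: "P s a \<bullet> b = a \<bullet> P s b" for a b using P_sym[OF s] by (simp add: sym_op_def)
  have symN: "N s a \<bullet> b = a \<bullet> N s b" for a b using N_sym[OF s] by (simp add: sym_op_def)
  have adj: "adjoint (F s) (P s x) \<bullet> y = P s x \<bullet> F s y"
    using inner_adjoint[OF F_linear[OF s], of y "P s x"] by (simp add: inner_commute)
  have 1: "N s v \<bullet> feedback s y = P s (G s v) \<bullet> y"
    by (metis inner_N_feedback[OF s] inner_commute symN symP)
  have 2: "N s (feedback s x) \<bullet> w = P s x \<bullet> G s w" by (rule inner_N_feedback[OF s])
  have 3: "N s (feedback s x) \<bullet> feedback s y = P s (G s (feedback s x)) \<bullet> y"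
    by (metis inner_N_feedback[OF s] inner_commute symN symP)
  show ?thesis
    by (simp add: riccati_rhs_eq P.add N.add inner_simps adj 1 2 3)
qed

text \<open>The pointwise identity is integrated over \<open>{0..T}\<close>, with
  \<open>P T = JT\<close> at the right end. It holds for arbitrary controls generating the two
  trajectories.\<close>

lemma energy_identity:
  assumes X: "state_eq T F G X V" and Y: "state_eq T F G Y W"
  shows "JT (X T) \<bullet> Y T + (LINT s:{0..T}|lborel. M s (X s) \<bullet> Y s) + (LINT s:{0..T}|lborel. N s (V s) \<bullet> W s)
    = P 0 (X 0) \<bullet> Y 0 + (LINT s:{0..T}|lborel. N s (V s + feedback s (X s)) \<bullet> (W s + feedback s (Y s)))"
proof -
  define x' where "x' r = F r (X r) + G r (V r)" for r
  define y' where "y' r = F r (Y r) + G r (W r)" for r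
  have T0: "0 \<le> T" "T \<in> {0..T}" "0 \<in> {0..T}" using T by auto
  have x': "set_integrable lborel {0..T} x'" and y': "set_integrable lborel {0..T} y'"
    unfolding x'_def[abs_def] y'_def[abs_def] by (rule state_eqD(5)[OF X T0(2)] state_eqD(5)[OF Y T0(2)])+
  have X_eq: "X s = X 0 + (LINT r:{0..s}|lborel. x' r)" if "s \<in> {0..T}" for s
    unfolding x'_def by (rule state_eqD(6)[OF X that])
  have Y_eq: "Y s = Y 0 + (LINT r:{0..s}|lborel. y' r)" if "s \<in> {0..T}" for s
    unfolding y'_def by (rule state_eqD(6)[OF Y that])
  obtain C where C: "0 < C" "\<And>s x. s \<in> {0..T} \<Longrightarrow> norm (R s x) \<le> C * norm x" using R op_family_LinfE by blast
  have mR: "op_family_Linf T (\<lambda>s x. - R s x)" using op_family_scaleR[OF R, of "- 1"] by simp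
  have bR: "norm (- R s x) \<le> C * norm x" if "s \<in> {0..T}" for s x using C(2)[OF that, of x] by simp
  have mR_meas: "(\<lambda>s. - R s x) \<in> borel_measurable (lebI T)" for x using mR by (simp add: op_family_Linf_def)
  note PX = operator_product_rule[where A = P and A' = "\<lambda>s x. - R s x" and k = "\<lambda>s. C" and X = X and x' = x',
      OF T0(1) P_linear op_family_bounded_linear[OF mR] mR_meas set_integrable_const_Icc bR P_forward x' X_eq]
  have Y_lin: "z \<bullet> Y s = z \<bullet> Y 0 + (LINT r:{0..s}|lborel. z \<bullet> y' r)" if s: "s \<in> {0..T}" for s z
  proof -
    have "set_integrable lborel {0..s} y'" by (rule set_integrable_subinterval[OF y']) (use s in auto)
    from set_integral_bounded_linear(2)[OF bounded_linear_inner_right this, of z]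
    have "(LINT r:{0..s}|lborel. z \<bullet> y' r) = z \<bullet> (LINT r:{0..s}|lborel. y' r)" .
    then show ?thesis by (subst Y_eq[OF s]) (simp add: inner_add_right)
  qed
  have y'_meas: "(\<lambda>s. z \<bullet> y' s) \<in> borel_measurable (lebI T)" for z
    by (intro borel_measurable_inner borel_measurable_const set_integrable_lebI_measurable y')
  have y'_bound: "norm (z \<bullet> y' s) \<le> norm (y' s) * norm z" for s z
    using Cauchy_Schwarz_ineq2[of z "y' s"] by (simp add: mult.commute)
  \<comment> \<open>Second use of the product rule: the curve is now \<open>P s (X s)\<close> and
    the operators are the functionals \<open>z |-> z \<bullet> Y s\<close>. Their derivative has the
    bound \<open>|y' s|\<close>, which is only integrable.\<close>
  note PXY = operator_product_rule[where A = "\<lambda>s z. z \<bullet> Y s" and A' = "\<lambda>s z. z \<bullet> y' s" and k = "\<lambda>s. norm (y' s)"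
      and X = "\<lambda>s. P s (X s)" and x' = "\<lambda>r. - R r (X r) + P r (x' r)",
      OF T0(1) bounded_linear_inner_left bounded_linear_inner_left y'_meas set_integrable_norm[OF y'] y'_bound Y_lin PX]
  have meas: "V \<in> borel_measurable (lebI T)" "W \<in> borel_measurable (lebI T)" "X \<in> borel_measurable (lebI T)" "Y \<in> borel_measurable (lebI T)"
    and L2: "set_integrable lborel {0..T} (\<lambda>s. (norm (V s))\<^sup>2)" "set_integrable lborel {0..T} (\<lambda>s. (norm (W s))\<^sup>2)"
      "set_integrable lborel {0..T} (\<lambda>s. (norm (X s))\<^sup>2)" "set_integrable lborel {0..T} (\<lambda>s. (norm (Y s))\<^sup>2)"
    by (rule state_eqD[OF X] state_eqD[OF Y])+
  have iN: "set_integrable lborel {0..T} (\<lambda>s. N s (V s) \<bullet> W s)" by (intro inner_N_integrable meas L2)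
  have iU: "set_integrable lborel {0..T} (\<lambda>s. N s (V s + feedback s (X s)) \<bullet> (W s + feedback s (Y s)))"
    by (intro inner_N_integrable borel_measurable_add L2_add op_family_apply_measurable[OF feedback] L2_op_family[OF feedback] meas L2)
  have iM: "set_integrable lborel {0..T} (\<lambda>s. M s (X s) \<bullet> Y s)"
  proof (rule set_integrable_dominated)
    show "(\<lambda>s. M s (X s) \<bullet> Y s) \<in> borel_measurable (lebI T)"
      by (intro borel_measurable_inner op_family_apply_measurable[OF M] meas)
    show "set_integrable lborel {0..T} (\<lambda>s. norm (M s (X s)) * norm (Y s))"
      by (intro L2_mult op_family_apply_measurable[OF M] L2_op_family[OF M] meas L2)
  qed (simp add: Cauchy_Schwarz_ineq2)
  have "P T (X T) \<bullet> Y T = P 0 (X 0) \<bullet> Y 0 + (LINT r:{0..T}|lborel. P r (X r) \<bullet> y' r + (- R r (X r) + P r (x' r)) \<bullet> Y r)"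
    by (rule PXY(2)) (use T0 in auto)
  then have "P T (X T) \<bullet> Y T - P 0 (X 0) \<bullet> Y 0 = (LINT r:{0..T}|lborel. P r (X r) \<bullet> y' r + (- R r (X r) + P r (x' r)) \<bullet> Y r)"
    by simp
  also have "\<dots> = (LINT s:{0..T}|lborel. N s (V s + feedback s (X s)) \<bullet> (W s + feedback s (Y s)) - N s (V s) \<bullet> W s - M s (X s) \<bullet> Y s)"
    by (intro set_lebesgue_integral_cong) (auto simp: pointwise_energy[symmetric] x'_def y'_def inner_add_left inner_diff_left)
  also have "\<dots> = (LINT s:{0..T}|lborel. N s (V s + feedback s (X s)) \<bullet> (W s + feedback s (Y s)))
      - (LINT s:{0..T}|lborel. N s (V s) \<bullet> W s) - (LINT s:{0..T}|lborel. M s (X s) \<bullet> Y s)"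
    by (simp only: set_integral_diff(2)[OF set_integral_diff(1)[OF iU iN] iM] set_integral_diff(2)[OF iU iN])
  finally show ?thesis by (simp add: P_T)
qed

lemma rep_control_closed_loop:
  assumes "rep_control T F G N X V"
  shows "rep_control T A G N X (\<lambda>s. V s + feedback s (X s))"
proof -
  have X: "state_eq T F G X V" using assms by (simp add: rep_control_def)
  have eq: "F r (X r) + G r (V r) = A r (X r) + G r (V r + feedback r (X r))" if "r \<in> {0..T}" for r
    by (simp add: closed_loop_eq linear_simps(1)[OF G_linear[OF that]])
  have "state_eq T A G X (\<lambda>s. V s + feedback s (X s))"
  proof (rule state_eqI)
    fix s assume s: "s \<in> {0..T}"
    have "set_integrable lborel {0..s} (\<lambda>r. F r (X r) + G r (V r)) = set_integrable lborel {0..s} (\<lambda>r. A r (X r) + G r (V r + feedback r (X r)))"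
      by (intro set_integrable_cong) (use eq s in auto)
    then show "set_integrable lborel {0..s} (\<lambda>r. A r (X r) + G r (V r + feedback r (X r)))" using state_eqD(5)[OF X s] by simp
    have "(LINT r:{0..s}|lborel. F r (X r) + G r (V r)) = (LINT r:{0..s}|lborel. A r (X r) + G r (V r + feedback r (X r)))"
      by (intro set_lebesgue_integral_cong) (use eq s in auto)
    then show "X s = X 0 + (LINT r:{0..s}|lborel. A r (X r) + G r (V r + feedback r (X r)))"
      using state_eqD(6)[OF X s] by argo
  qed (intro borel_measurable_add L2_add op_family_apply_measurable[OF feedback] L2_op_family[OF feedback] state_eqD[OF X])+
  moreover have "AE s in lborel. s \<in> {0..T} \<longrightarrow> (\<forall>w. G s w = 0 \<longrightarrow> inner (N s (V s)) w = 0)"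
    using assms by (simp add: rep_control_def)
  then have "AE s in lborel. s \<in> {0..T} \<longrightarrow> (\<forall>w. G s w = 0 \<longrightarrow> inner (N s (V s + feedback s (X s))) w = 0)"
    by eventually_elim (auto simp: linear_simps(1)[OF N_linear] inner_add_left inner_N_feedback)
  ultimately show ?thesis by (simp add: rep_control_def)
qed

lemma rep_control_open_loop:
  assumes "rep_control T A G N X u"
  shows "rep_control T F G N X (\<lambda>s. u s - feedback s (X s))"
proof -
  have X: "state_eq T A G X u" using assms by (simp add: rep_control_def)
  have eq: "A r (X r) + G r (u r) = F r (X r) + G r (u r - feedback r (X r))" if "r \<in> {0..T}" for r
    by (simp add: closed_loop_eq linear_simps(2)[OF G_linear[OF that]])
  have fm: "op_family_Linf T (\<lambda>s x. - feedback s x)" using op_family_scaleR[OF feedback, of "- 1"] by simp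
  have "state_eq T F G X (\<lambda>s. u s - feedback s (X s))"
  proof (rule state_eqI)
    fix s assume s: "s \<in> {0..T}"
    have "set_integrable lborel {0..s} (\<lambda>r. A r (X r) + G r (u r)) = set_integrable lborel {0..s} (\<lambda>r. F r (X r) + G r (u r - feedback r (X r)))"
      by (intro set_integrable_cong) (use eq s in auto)
    then show "set_integrable lborel {0..s} (\<lambda>r. F r (X r) + G r (u r - feedback r (X r)))" using state_eqD(5)[OF X s] by simp
    have "(LINT r:{0..s}|lborel. A r (X r) + G r (u r)) = (LINT r:{0..s}|lborel. F r (X r) + G r (u r - feedback r (X r)))"
      by (intro set_lebesgue_integral_cong) (use eq s in auto)
    then show "X s = X 0 + (LINT r:{0..s}|lborel. F r (X r) + G r (u r - feedback r (X r)))"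
      using state_eqD(6)[OF X s] by argo
  next
    show "set_integrable lborel {0..T} (\<lambda>s. (norm (u s - feedback s (X s)))\<^sup>2)"
      using L2_add[OF state_eqD(1,2)[OF X] op_family_apply_measurable[OF fm state_eqD(3)[OF X]] L2_op_family[OF fm state_eqD(3,4)[OF X]]]
      by simp
  qed (intro borel_measurable_diff op_family_apply_measurable[OF feedback] state_eqD[OF X])+
  moreover have "AE s in lborel. s \<in> {0..T} \<longrightarrow> (\<forall>w. G s w = 0 \<longrightarrow> inner (N s (u s)) w = 0)"
    using assms by (simp add: rep_control_def)
  then have "AE s in lborel. s \<in> {0..T} \<longrightarrow> (\<forall>w. G s w = 0 \<longrightarrow> inner (N s (u s - feedback s (X s))) w = 0)"
    by eventually_elim (auto simp: linear_simps(2)[OF N_linear] inner_diff_left inner_N_feedback)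
  ultimately show ?thesis by (simp add: rep_control_def)
qed

lemma Hspace_iff: "X \<in> Hspace T F G \<longleftrightarrow> (\<exists>u. rep_control T A G N X u)"
  using rep_control_exists rep_control_closed_loop rep_control_open_loop
  unfolding Hspace_def by (metis (mono_tags, lifting) Hspace_def mem_Collect_eq rep_control_def)

text \<open>The controls selected by choice inside \<open>H_inner\<close> may differ from those
  obtained from \<open>u\<close> and \<open>w\<close>, but only on a null set, so the integral is
  unaffected. The energy identity absorbs the terms with \<open>JT\<close> and
  \<open>M\<close>.\<close>

lemma H_inner_closed_loop:
  assumes X: "rep_control T A G N X u" and Y: "rep_control T A G N Y w"
  shows "H_inner T F G N M J0 JT X Y = J0 (X 0) \<bullet> Y 0 + P 0 (X 0) \<bullet> Y 0 + (LINT s:{0..T}|lborel. N s (u s) \<bullet> w s)"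
proof -
  define V where "V = (SOME V. rep_control T F G N X V)"
  define W where "W = (SOME V. rep_control T F G N Y V)"
  have V: "rep_control T F G N X V" unfolding V_def by (rule someI[where P = "rep_control T F G N X", OF rep_control_open_loop[OF X]])
  have W: "rep_control T F G N Y W" unfolding W_def by (rule someI[where P = "rep_control T F G N Y", OF rep_control_open_loop[OF Y]])
  have st: "state_eq T F G X V" "state_eq T F G Y W" using V W by (auto simp: rep_control_def)
  have st': "state_eq T A G X u" "state_eq T A G Y w" using X Y by (auto simp: rep_control_def)
  have ae: "AE s in lebI T. N s (V s + feedback s (X s)) \<bullet> (W s + feedback s (Y s)) = N s (u s) \<bullet> w s"
    using CL.rep_control_unique[OF rep_control_closed_loop[OF V] X] CL.rep_control_unique[OF rep_control_closed_loop[OF W] Y]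
    unfolding AE_lebI[symmetric] by eventually_elim simp
  have "(LINT s:{0..T}|lborel. N s (V s + feedback s (X s)) \<bullet> (W s + feedback s (Y s))) = (LINT s:{0..T}|lborel. N s (u s) \<bullet> w s)"
    unfolding set_integrable_lebI
  proof (rule integral_cong_AE[OF _ _ ae])
    show "(\<lambda>s. N s (V s + feedback s (X s)) \<bullet> (W s + feedback s (Y s))) \<in> borel_measurable (lebI T)"
      by (intro borel_measurable_inner op_family_apply_measurable[OF N] borel_measurable_add op_family_apply_measurable[OF feedback]
          state_eqD[OF st(1)] state_eqD[OF st(2)])
    show "(\<lambda>s. N s (u s) \<bullet> w s) \<in> borel_measurable (lebI T)"
      by (intro borel_measurable_inner op_family_apply_measurable[OF N] state_eqD[OF st'(1)] state_eqD[OF st'(2)])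
  qed
  then show ?thesis using energy_identity[OF st]
    by (simp add: H_inner_def Let_def V_def[symmetric] W_def[symmetric])
qed

end

section \<open>The reproducing kernel\<close>

locale kernel_system = riccati_system T F G N c M P JT + E: evolution_family T "closed_loop F G N P" Phi
  for T :: real
    and F :: "real \<Rightarrow> 'h::{real_inner,banach,second_countable_topology} \<Rightarrow> 'h"
    and G :: "real \<Rightarrow> 'u::{real_inner,banach,second_countable_topology} \<Rightarrow> 'h"
    and N :: "real \<Rightarrow> 'u \<Rightarrow> 'u" and c :: real and M P :: "real \<Rightarrow> 'h \<Rightarrow> 'h" and JT :: "'h \<Rightarrow> 'h"
    and Phi :: "real \<Rightarrow> real \<Rightarrow> 'h \<Rightarrow> 'h" +
  fixes J0 :: "'h \<Rightarrow> 'h" and c0 :: real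
  assumes J0: "bounded_linear J0" "sym_op J0" and c0: "0 < c0" "c0 * (norm x)\<^sup>2 \<le> inner (J0 x) x"
    and P0_psd: "psd_op (P 0)"
begin

abbreviation ip :: "(real \<Rightarrow> 'h) \<Rightarrow> (real \<Rightarrow> 'h) \<Rightarrow> real" where
  "ip \<equiv> H_inner T F G N M J0 JT"

definition B :: "'h \<Rightarrow> 'h" where "B x = J0 x + P 0 x"

lemma B_linear: "bounded_linear B"
  unfolding B_def[abs_def] using T by (intro bounded_linear_add J0 P_linear) auto

lemma B_sym: "B x \<bullet> y = x \<bullet> B y"
  using J0(2) P_sym[of 0] T by (simp add: B_def sym_op_def inner_add_left inner_add_right)

lemma B_coercive: "c0 * (norm x)\<^sup>2 \<le> B x \<bullet> x"
  using c0(2)[of x] P0_psd by (simp add: B_def psd_op_def inner_add_left add_increasing2)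

lemma B_inv: "B (inv B x) = x"
  using coercive_bij[OF B_linear c0(1) B_coercive] by (simp add: bij_is_surj surj_f_inv_f)

section \<open>Trajectories described by initial value and closed-loop control\<close>

lemma ip_eq:
  "rep_control T A G N X u \<Longrightarrow> rep_control T A G N Y w \<Longrightarrow>
    ip X Y = B (X 0) \<bullet> Y 0 + (LINT s:{0..T}|lborel. N s (u s) \<bullet> w s)"
  by (simp add: H_inner_closed_loop B_def inner_add_left)

lemma rep_controlD:
  assumes "rep_control T A G N X u"
  shows "u \<in> borel_measurable (lebI T)" "set_integrable lborel {0..T} (\<lambda>s. (norm (u s))\<^sup>2)"
    "set_integrable lborel {0..T} (\<lambda>s. G s (u s))"
    "AE s in lborel. s \<in> {0..T} \<longrightarrow> (\<forall>w. G s w = 0 \<longrightarrow> inner (N s (u s)) w = 0)"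
proof -
  have st: "state_eq T A G X u" using assms by (simp add: rep_control_def)
  show 1: "u \<in> borel_measurable (lebI T)" "set_integrable lborel {0..T} (\<lambda>s. (norm (u s))\<^sup>2)"
    by (rule state_eqD[OF st])+
  show "set_integrable lborel {0..T} (\<lambda>s. G s (u s))"
    by (rule L2_imp_integrable[OF op_family_apply_measurable[OF G 1(1)] L2_op_family[OF G 1]])
qed (use assms in \<open>simp add: rep_control_def\<close>)

lemma trajectory_eq:
  assumes X: "rep_control T A G N X u" and s: "s \<in> {0..T}"
  shows "X s = E.duhamel (X 0) (\<lambda>\<tau>. G \<tau> (u \<tau>)) s"
proof -
  have st: "state_eq T A G X u" using X by (simp add: rep_control_def)
  show ?thesis
    by (rule E.duhamel_unique[OF rep_controlD(3)[OF X] state_eqD(5)[OF st] state_eqD(6)[OF st] s]) (use T in auto)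
qed

text \<open>Values outside \<open>{0..T}\<close> are irrelevant to the state equation. The kernel
  sections are identified with variation of constants formulas only on \<open>{0..T}\<close>, where
  \<open>Phi\<close> is constrained.\<close>

lemma rep_control_cong:
  assumes X: "rep_control T A G N X u" and eq: "\<And>s. s \<in> {0..T} \<Longrightarrow> Y s = X s"
  shows "rep_control T A G N Y u"
proof -
  have st: "state_eq T A G X u" using X by (simp add: rep_control_def)
  have "state_eq T A G Y u"
  proof (rule state_eqI[OF state_eqD(1,2)[OF st]])
    have "Y \<in> borel_measurable (lebI T) \<longleftrightarrow> X \<in> borel_measurable (lebI T)" by (rule measurable_cong) (use eq in auto)
    then show "Y \<in> borel_measurable (lebI T)" using state_eqD(3)[OF st] by simp
    have "set_integrable lborel {0..T} (\<lambda>s. (norm (Y s))\<^sup>2) = set_integrable lborel {0..T} (\<lambda>s. (norm (X s))\<^sup>2)"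
      by (rule set_integrable_cong) (use eq in auto)
    then show "set_integrable lborel {0..T} (\<lambda>s. (norm (Y s))\<^sup>2)" using state_eqD(4)[OF st] by simp
    fix s assume s: "s \<in> {0..T}"
    have "set_integrable lborel {0..s} (\<lambda>r. A r (Y r) + G r (u r)) = set_integrable lborel {0..s} (\<lambda>r. A r (X r) + G r (u r))"
      by (rule set_integrable_cong) (use eq s in auto)
    then show "set_integrable lborel {0..s} (\<lambda>r. A r (Y r) + G r (u r))" using state_eqD(5)[OF st s] by simp
    have "(LINT r:{0..s}|lborel. A r (Y r) + G r (u r)) = (LINT r:{0..s}|lborel. A r (X r) + G r (u r))"
      by (rule set_lebesgue_integral_cong) (use eq s in auto)
    moreover have "Y s = X s" "Y 0 = X 0" using eq s T by auto
    ultimately show "Y s = Y 0 + (LINT r:{0..s}|lborel. A r (Y r) + G r (u r))" using state_eqD(6)[OF st s] by argo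
  qed
  then show ?thesis using rep_controlD(4)[OF X] by (simp add: rep_control_def)
qed

text \<open>Surjectivity: every pair of an initial value and a square-integrable representative
  control comes from a trajectory.\<close>

lemma rep_control_duhamel:
  assumes u: "u \<in> borel_measurable (lebI T)" "set_integrable lborel {0..T} (\<lambda>s. (norm (u s))\<^sup>2)"
    and rep: "AE s in lborel. s \<in> {0..T} \<longrightarrow> (\<forall>w. G s w = 0 \<longrightarrow> inner (N s (u s)) w = 0)"
  shows "rep_control T A G N (E.duhamel x (\<lambda>\<tau>. G \<tau> (u \<tau>))) u" "E.duhamel x (\<lambda>\<tau>. G \<tau> (u \<tau>)) 0 = x"
proof -
  let ?g = "\<lambda>\<tau>. G \<tau> (u \<tau>)"
  have g: "set_integrable lborel {0..T} ?g"
    by (rule L2_imp_integrable[OF op_family_apply_measurable[OF G u(1)] L2_op_family[OF G u]])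
  note sol = E.duhamel_solves[OF g, where y = x]
  have "(LINT r:{0..0}|lborel. A r (E.duhamel x ?g r) + ?g r) = 0"
    by (simp add: set_lebesgue_integral_def integral_eq_zero_AE[OF AE_mp[OF AE_lborel_singleton[of 0]]])
  then show x0: "E.duhamel x ?g 0 = x" using sol(2)[of 0] T by simp
  have cont: "continuous_on {0..T} (E.duhamel x ?g)" by (rule continuous_on_integral_form[OF sol])
  have "state_eq T A G (E.duhamel x ?g) u"
  proof (rule state_eqI[OF u])
    show "E.duhamel x ?g \<in> borel_measurable (lebI T)" by (rule continuous_on_lebI_measurable[OF cont])
    show "set_integrable lborel {0..T} (\<lambda>s. (norm (E.duhamel x ?g s))\<^sup>2)"
      by (intro borel_integrable_atLeastAtMost' continuous_on_power continuous_on_norm cont)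
    show "set_integrable lborel {0..s} (\<lambda>r. A r (E.duhamel x ?g r) + ?g r)" if "s \<in> {0..T}" for s
      by (rule set_integrable_subinterval[OF sol(1)]) (use that in auto)
  qed (use sol(2) x0 in simp)
  then show "rep_control T A G N (E.duhamel x ?g) u" using rep by (simp add: rep_control_def)
qed

text \<open>The lower half of the norm equivalence with \<open>H\<close> times \<open>L2\<close>.
  Nonnegativity, definiteness and the Cauchy property of initial values and controls all come from
  it.\<close>

lemma ip_self_ge:
  assumes "rep_control T A G N X u"
  shows "c0 * (norm (X 0))\<^sup>2 + c * (LINT s:{0..T}|lborel. (norm (u s))\<^sup>2) \<le> ip X X"
proof -
  note u = rep_controlD(1,2)[OF assms]
  have "(LINT s:{0..T}|lborel. c * (norm (u s))\<^sup>2) \<le> (LINT s:{0..T}|lborel. N s (u s) \<bullet> u s)"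
    by (intro set_integral_mono set_integrable_mult_right u inner_N_integrable c)
  then show ?thesis using B_coercive[of "X 0"] by (simp add: ip_eq[OF assms assms])
qed

lemma L2_sq_nonneg: "0 \<le> c * (LINT s:{0..T}|lborel. (norm (u s :: 'u))\<^sup>2)"
  unfolding set_lebesgue_integral_def using c(1) by (intro mult_nonneg_nonneg Bochner_Integration.integral_nonneg) auto

lemma ip_self_nonneg: "rep_control T A G N X u \<Longrightarrow> 0 \<le> ip X X"
  using ip_self_ge[of X u] L2_sq_nonneg[of u] c0(1)
  by (meson add_nonneg_nonneg less_imp_le mult_nonneg_nonneg order_trans zero_le_power2)

text \<open>The initial value vanishes and the control vanishes almost everywhere. The variation of
  constants formula then gives zero at every point of \<open>{0..T}\<close>, not merely almost
  everywhere.\<close>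

lemma ip_definite:
  assumes X: "rep_control T A G N X u" and 0: "ip X X = 0" and s: "s \<in> {0..T}"
  shows "X s = 0"
proof -
  note u = rep_controlD(1,2)[OF X]
  have nn: "0 \<le> c0 * (norm (X 0))\<^sup>2" "0 \<le> c * (LINT s:{0..T}|lborel. (norm (u s))\<^sup>2)"
    using c0(1) L2_sq_nonneg[of u] by auto
  have X0: "X 0 = 0" and u0: "(LINT s:{0..T}|lborel. (norm (u s))\<^sup>2) = 0"
    using antisym[OF ip_self_ge[OF X, unfolded 0] add_nonneg_nonneg[OF nn]] c(1) c0(1) add_nonneg_eq_0_iff[OF nn] by auto
  have "AE s in lebI T. (norm (u s))\<^sup>2 = 0"
    using u(2) u0 integral_nonneg_eq_0_iff_AE[of "lebI T" "\<lambda>s. (norm (u s))\<^sup>2"] by (simp add: set_integrable_lebI)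
  then have "AE s in lebI T. u s = 0" by simp
  then have ae: "AE r in lborel. r \<in> {0..T} \<longrightarrow> u r = 0" by (simp add: AE_lebI)
  have "(LINT \<tau>:{0..s}|lborel. Phi s \<tau> (G \<tau> (u \<tau>))) = 0"
    unfolding set_lebesgue_integral_def
  proof (rule integral_eq_zero_AE)
    show "AE \<tau> in lborel. indicator {0..s} \<tau> *\<^sub>R Phi s \<tau> (G \<tau> (u \<tau>)) = 0"
      using ae
    proof eventually_elim
      case (elim \<tau>)
      show ?case
      proof (cases "\<tau> \<in> {0..s}")
        case True
        then have "G \<tau> (u \<tau>) = 0" using elim s linear_simps(3)[OF G_linear[of \<tau>]] by auto
        then show ?thesis using True s linear_simps(3)[OF E.Phi_linear[of \<tau> s]] by auto
      qed simp
    qed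
  qed
  then show ?thesis
    using trajectory_eq[OF X s] X0 s linear_simps(3)[OF E.Phi_linear[of 0 s]] by (simp add: E.duhamel_def)
qed

lemma ip_complete:
  assumes mem: "\<And>n. Xs n \<in> Hspace T F G"
    and cauchy: "\<And>e. e > 0 \<Longrightarrow> \<exists>K. \<forall>m\<ge>K. \<forall>n\<ge>K. ip (\<lambda>s. Xs m s - Xs n s) (\<lambda>s. Xs m s - Xs n s) < e"
  shows "\<exists>X\<in>Hspace T F G. (\<lambda>n. ip (\<lambda>s. Xs n s - X s) (\<lambda>s. Xs n s - X s)) \<longlonglongrightarrow> 0"
proof -
  obtain u where u: "\<And>n. rep_control T A G N (Xs n) (u n)" using mem unfolding Hspace_iff by metis
  have ge: "c0 * (norm (Xs m 0 - Xs n 0))\<^sup>2 + c * (LINT s:{0..T}|lborel. (norm (u m s - u n s))\<^sup>2)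
      \<le> ip (\<lambda>s. Xs m s - Xs n s) (\<lambda>s. Xs m s - Xs n s)" for m n
    using ip_self_ge[OF CL.rep_control_diff[OF u[of m] u[of n]]] by simp
  have "Cauchy (\<lambda>n. Xs n 0)"
  proof (rule metric_CauchyI)
    fix e :: real assume e: "0 < e"
    obtain K where K: "\<forall>m\<ge>K. \<forall>n\<ge>K. ip (\<lambda>s. Xs m s - Xs n s) (\<lambda>s. Xs m s - Xs n s) < c0 * e\<^sup>2"
      using cauchy[of "c0 * e\<^sup>2"] e c0(1) by auto
    have "dist (Xs m 0) (Xs n 0) < e" if "m \<ge> K" "n \<ge> K" for m n
    proof -
      have "0 \<le> c * (LINT s:{0..T}|lborel. (norm (u m s - u n s))\<^sup>2)" by (rule L2_sq_nonneg)
      then have "c0 * (norm (Xs m 0 - Xs n 0))\<^sup>2 < c0 * e\<^sup>2" using ge[of m n] K[rule_format, OF that] by linarith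
      then have "(norm (Xs m 0 - Xs n 0))\<^sup>2 < e\<^sup>2" using c0(1) by simp
      then show ?thesis using e by (auto simp: dist_norm dest: power_less_imp_less_base)
    qed
    then show "\<exists>K. \<forall>m\<ge>K. \<forall>n\<ge>K. dist (Xs m 0) (Xs n 0) < e" by blast
  qed
  then obtain x where x: "(\<lambda>n. Xs n 0) \<longlonglongrightarrow> x" using Cauchy_convergent_iff convergent_def by blast
  have L2_cauchy: "\<exists>K. \<forall>m\<ge>K. \<forall>n\<ge>K. (LINT s:{0..T}|lborel. (norm (u m s - u n s))\<^sup>2) < e" if e: "e > 0" for e
  proof -
    obtain K where K: "\<forall>m\<ge>K. \<forall>n\<ge>K. ip (\<lambda>s. Xs m s - Xs n s) (\<lambda>s. Xs m s - Xs n s) < c * e"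
      using cauchy[of "c * e"] e c(1) by auto
    have "(LINT s:{0..T}|lborel. (norm (u m s - u n s))\<^sup>2) < e" if "m \<ge> K" "n \<ge> K" for m n
    proof -
      have "0 \<le> c0 * (norm (Xs m 0 - Xs n 0))\<^sup>2" using c0(1) by simp
      then have "c * (LINT s:{0..T}|lborel. (norm (u m s - u n s))\<^sup>2) < c * e" using ge[of m n] K[rule_format, OF that] by linarith
      then show ?thesis using c(1) by simp
    qed
    then show ?thesis by blast
  qed
  obtain W r where W: "W \<in> borel_measurable (lebI T)" "set_integrable lborel {0..T} (\<lambda>s. (norm (W s))\<^sup>2)"
    and conv: "AE s in lborel. s \<in> {0..T} \<longrightarrow> (\<lambda>k. u (r k) s) \<longlonglongrightarrow> W s"
    and lim: "(\<lambda>n. LINT s:{0..T}|lborel. (norm (u n s - W s))\<^sup>2) \<longlonglongrightarrow> 0"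
    by (rule L2_complete[OF rep_controlD(1)[OF u] rep_controlD(2)[OF u] L2_cauchy T])
  have "AE s in lborel. \<forall>n. s \<in> {0..T} \<longrightarrow> (\<forall>w. G s w = 0 \<longrightarrow> inner (N s (u n s)) w = 0)"
    unfolding AE_all_countable using rep_controlD(4)[OF u] by blast
  \<comment> \<open>The countably many exceptional null sets are merged into one. Off it, the
    orthogonality condition is stable under the pointwise limit along the subsequence.\<close>
  with conv have rep: "AE s in lborel. s \<in> {0..T} \<longrightarrow> (\<forall>w. G s w = 0 \<longrightarrow> inner (N s (W s)) w = 0)"
  proof eventually_elim
    case (elim s)
    show ?case
    proof (intro impI allI)
      fix w assume s: "s \<in> {0..T}" and w: "G s w = 0"
      have "(\<lambda>k. N s (u (r k) s) \<bullet> w) \<longlonglongrightarrow> N s (W s) \<bullet> w"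
        using elim(1) s by (intro tendsto_inner tendsto_const bounded_linear.tendsto[OF N_linear[OF s]]) auto
      moreover have "(\<lambda>k. N s (u (r k) s) \<bullet> w) = (\<lambda>k. 0)" using elim(2) s w by auto
      ultimately show "N s (W s) \<bullet> w = 0" by (simp add: LIMSEQ_const_iff)
    qed
  qed
  define X where "X = E.duhamel x (\<lambda>\<tau>. G \<tau> (W \<tau>))"
  have X: "rep_control T A G N X W" and X0: "X 0 = x"
    unfolding X_def by (rule rep_control_duhamel[OF W rep])+
  obtain KB where KB: "KB > 0" "\<And>z. norm (B z) \<le> norm z * KB" using bounded_linear.pos_bounded[OF B_linear] by blast
  obtain KN where KN: "0 < KN" "\<And>s z. s \<in> {0..T} \<Longrightarrow> norm (N s z) \<le> KN * norm z" using N op_family_LinfE by blast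
  \<comment> \<open>The reverse bound on the norm: convergence of initial values in \<open>H\<close>
    and of controls in \<open>L2\<close> implies convergence in \<open>ip\<close>.\<close>
  have le: "ip (\<lambda>s. Xs n s - X s) (\<lambda>s. Xs n s - X s)
      \<le> KB * (norm (Xs n 0 - x))\<^sup>2 + KN * (LINT s:{0..T}|lborel. (norm (u n s - W s))\<^sup>2)" for n
  proof -
    note d = CL.rep_control_diff[OF u[of n] X]
    note du = rep_controlD(1,2)[OF d]
    have quad: "L z \<bullet> z \<le> K * (norm z)\<^sup>2" if "norm (L z) \<le> K * norm z" for L :: "'b::real_inner \<Rightarrow> 'b" and z K
    proof -
      have "L z \<bullet> z \<le> norm (L z) * norm z" by (rule norm_cauchy_schwarz)
      also have "\<dots> \<le> K * norm z * norm z" by (intro mult_right_mono that) simp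
      finally show ?thesis by (simp add: power2_eq_square mult.assoc)
    qed
    have "(LINT s:{0..T}|lborel. N s (u n s - W s) \<bullet> (u n s - W s)) \<le> (LINT s:{0..T}|lborel. KN * (norm (u n s - W s))\<^sup>2)"
      by (intro set_integral_mono set_integrable_mult_right du inner_N_integrable quad KN)
    moreover have "B (Xs n 0 - x) \<bullet> (Xs n 0 - x) \<le> KB * (norm (Xs n 0 - x))\<^sup>2"
      using KB(2) by (intro quad) (simp add: mult.commute)
    ultimately show ?thesis by (simp add: ip_eq[OF d d] X0)
  qed
  have nonneg: "0 \<le> ip (\<lambda>s. Xs n s - X s) (\<lambda>s. Xs n s - X s)" for n
    by (rule ip_self_nonneg[OF CL.rep_control_diff[OF u[of n] X]])
  have "(\<lambda>n. Xs n 0 - x) \<longlonglongrightarrow> 0" using x by (simp add: LIM_zero_iff)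
  then have "(\<lambda>n. (norm (Xs n 0 - x))\<^sup>2) \<longlonglongrightarrow> 0\<^sup>2" by (intro tendsto_power tendsto_norm_zero)
  then have lim': "(\<lambda>n. KB * (norm (Xs n 0 - x))\<^sup>2 + KN * (LINT s:{0..T}|lborel. (norm (u n s - W s))\<^sup>2)) \<longlonglongrightarrow> KB * 0\<^sup>2 + KN * 0"
    by (intro tendsto_add tendsto_mult tendsto_const lim)
  then have "(\<lambda>n. ip (\<lambda>s. Xs n s - X s) (\<lambda>s. Xs n s - X s)) \<longlonglongrightarrow> 0"
    by (intro tendsto_sandwich[OF always_eventually always_eventually tendsto_const lim'[simplified]] allI nonneg le)
  moreover have "X \<in> Hspace T F G" using X by (auto simp: Hspace_iff)
  ultimately show ?thesis by blast
qed

lemma hilbert: "hilbert_fn_space T (Hspace T F G) ip"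
  unfolding hilbert_fn_space_def
proof (intro conjI ballI allI impI)
  have "rep_control T A G N (E.duhamel 0 (\<lambda>\<tau>. G \<tau> 0)) (\<lambda>s. 0)"
  proof (rule rep_control_duhamel)
    show "AE s in lborel. s \<in> {0..T} \<longrightarrow> (\<forall>w. G s w = 0 \<longrightarrow> N s 0 \<bullet> w = 0)"
      using linear_simps(3)[OF N_linear] by simp
  qed (auto simp: set_integrable_def)
  \<comment> \<open>The trajectory with zero data need not vanish outside \<open>{0..T}\<close>;
    scaling it by 0 yields the constant zero function literally.\<close>
  from CL.rep_control_scaleR[OF this, of 0] show "(\<lambda>_. 0) \<in> Hspace T F G" by (auto simp: Hspace_iff)
next
  fix X Y assume "X \<in> Hspace T F G" "Y \<in> Hspace T F G"
  then obtain u w where X: "rep_control T A G N X u" and Y: "rep_control T A G N Y w" by (auto simp: Hspace_iff)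
  show "(\<lambda>s. X s + Y s) \<in> Hspace T F G" using CL.rep_control_add[OF X Y] by (auto simp: Hspace_iff)
  have "(LINT s:{0..T}|lborel. N s (u s) \<bullet> w s) = (LINT s:{0..T}|lborel. N s (w s) \<bullet> u s)"
    using N_sym by (intro set_lebesgue_integral_cong) (auto simp: sym_op_def inner_commute)
  then show "ip X Y = ip Y X" using B_sym[of "X 0" "Y 0"] by (simp add: ip_eq[OF X Y] ip_eq[OF Y X] inner_commute)
  fix a
  have "(LINT s:{0..T}|lborel. N s (a *\<^sub>R u s) \<bullet> w s) = (LINT s:{0..T}|lborel. a * (N s (u s) \<bullet> w s))"
    using linear_simps(5)[OF N_linear] by (intro set_lebesgue_integral_cong) auto
  then show "ip (\<lambda>s. a *\<^sub>R X s) Y = a * ip X Y"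
    by (simp add: ip_eq[OF X Y] ip_eq[OF CL.rep_control_scaleR[OF X] Y] linear_simps(5)[OF B_linear] distrib_left)
next
  fix X Y Z assume "X \<in> Hspace T F G" "Y \<in> Hspace T F G" "Z \<in> Hspace T F G"
  then obtain u w v where X: "rep_control T A G N X u" and Y: "rep_control T A G N Y w" and Z: "rep_control T A G N Z v"
    by (auto simp: Hspace_iff)
  have "(LINT s:{0..T}|lborel. N s (u s + w s) \<bullet> v s) = (LINT s:{0..T}|lborel. N s (u s) \<bullet> v s + N s (w s) \<bullet> v s)"
    using linear_simps(1)[OF N_linear] by (intro set_lebesgue_integral_cong) (auto simp: inner_add_left)
  also have "\<dots> = (LINT s:{0..T}|lborel. N s (u s) \<bullet> v s) + (LINT s:{0..T}|lborel. N s (w s) \<bullet> v s)"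
    by (intro set_integral_add inner_N_integrable rep_controlD(1,2)[OF X] rep_controlD(1,2)[OF Y] rep_controlD(1,2)[OF Z])
  finally show "ip (\<lambda>s. X s + Y s) Z = ip X Z + ip Y Z"
    by (simp add: ip_eq[OF X Z] ip_eq[OF Y Z] ip_eq[OF CL.rep_control_add[OF X Y] Z] linear_simps(1)[OF B_linear] inner_add_left)
next
  fix X assume "X \<in> Hspace T F G"
  then obtain u where X: "rep_control T A G N X u" by (auto simp: Hspace_iff)
  show "(\<lambda>s. a *\<^sub>R X s) \<in> Hspace T F G" for a using CL.rep_control_scaleR[OF X] by (auto simp: Hspace_iff)
  show "0 \<le> ip X X" by (rule ip_self_nonneg[OF X])
  show "X s = 0" if "ip X X = 0" "s \<in> {0..T}" for s using ip_definite[OF X that] .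
next
  fix Xs :: "nat \<Rightarrow> real \<Rightarrow> 'h" assume *: "(\<forall>n. Xs n \<in> Hspace T F G) \<and>
    (\<forall>e>0. \<exists>N. \<forall>m\<ge>N. \<forall>n\<ge>N. ip (\<lambda>s. Xs m s - Xs n s) (\<lambda>s. Xs m s - Xs n s) < e)"
  show "\<exists>X\<in>Hspace T F G. (\<lambda>n. ip (\<lambda>s. Xs n s - X s) (\<lambda>s. Xs n s - X s)) \<longlonglongrightarrow> 0"
    by (rule ip_complete) (use * in auto)
qed

lemma kernel_reproduces:
  assumes t: "t \<in> {0..T}"
  shows "(\<lambda>s. rk_kernel J0 P G N Phi s t Z) \<in> Hspace T F G"
    and "X \<in> Hspace T F G \<Longrightarrow> X t \<bullet> Z = ip X (\<lambda>s. rk_kernel J0 P G N Phi s t Z)"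
proof -
  \<comment> \<open>The cut-off at \<open>t\<close> serves two ends: it avoids
    \<open>Phi t \<tau>\<close> for \<open>\<tau> > t\<close>, where nothing is known, and it turns
    the upper limit \<open>min s t\<close> of the kernel integral into \<open>s\<close>.\<close>
  define z where "z \<tau> = (if \<tau> \<le> t then adjoint (Phi t \<tau>) Z else 0)" for \<tau>
  define w where "w \<tau> = inv (N \<tau>) (adjoint (G \<tau>) (z \<tau>))" for \<tau>
  define y where "y = inv B (adjoint (Phi t 0) Z)"
  obtain K where K: "1 \<le> K" "\<And>s t x. 0 \<le> t \<Longrightarrow> t \<le> s \<Longrightarrow> s \<le> T \<Longrightarrow> norm (Phi s t x) \<le> K * norm x"
    using E.Phi_bounded by blast
  have adj: "x \<bullet> adjoint (Phi t \<tau>) Z = Phi t \<tau> x \<bullet> Z" if "\<tau> \<in> {0..t}" for \<tau> x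
    using that t by (intro inner_adjoint E.Phi_linear) auto
  \<comment> \<open>Only \<open>\<tau> |-> Phi t \<tau> x\<close> is known to be measurable, so the
    adjoint is handled weakly, by pairing with each \<open>x\<close>.\<close>
  have z_meas: "z \<in> borel_measurable (lebI T)"
  proof (rule weakly_measurable_imp_measurable)
    fix x
    have "(\<lambda>\<tau>. Phi t \<tau> x \<bullet> Z) \<in> borel_measurable (lebI t)"
      using t by (intro borel_measurable_inner borel_measurable_const E.Phi_snd_measurable) auto
    then have "(\<lambda>\<tau>. indicator {0..t} \<tau> *\<^sub>R (Phi t \<tau> x \<bullet> Z)) \<in> borel_measurable lborel"
      by (subst (asm) borel_measurable_restrict_space_iff) auto
    moreover have "(\<lambda>\<tau>. indicator {0..t} \<tau> *\<^sub>R (Phi t \<tau> x \<bullet> Z)) = (\<lambda>\<tau>. indicator {0..T} \<tau> *\<^sub>R (z \<tau> \<bullet> x))"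
      using adj t by (auto simp: z_def indicator_def inner_commute[of _ x] fun_eq_iff)
    ultimately show "(\<lambda>\<tau>. z \<tau> \<bullet> x) \<in> borel_measurable (lebI T)"
      by (subst borel_measurable_restrict_space_iff) auto
  qed
  have z_bound: "norm (z \<tau>) \<le> K * norm Z" if "\<tau> \<in> {0..T}" for \<tau>
    using norm_adjoint_le[OF E.Phi_linear, of \<tau> t K Z] K t that by (auto simp: z_def)
  have z_L2: "set_integrable lborel {0..T} (\<lambda>s. (norm (z s))\<^sup>2)"
  proof (rule set_integrable_bounded)
    show "(\<lambda>s. (norm (z s))\<^sup>2) \<in> borel_measurable (lebI T)" using z_meas by measurable
    show "norm ((norm (z s))\<^sup>2) \<le> (K * norm Z)\<^sup>2" if "s \<in> {0..T}" for s
      using power_mono[OF z_bound[OF that], of 2] by simp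
  qed
  have NG: "op_family_Linf T (\<lambda>s x. inv (N s) (adjoint (G s) x))"
    by (rule op_family_compose[OF Ninv op_family_adjoint[OF G]])
  have w: "w \<in> borel_measurable (lebI T)" "set_integrable lborel {0..T} (\<lambda>s. (norm (w s))\<^sup>2)"
    unfolding w_def[abs_def] by (rule op_family_apply_measurable[OF NG z_meas], rule L2_op_family[OF NG z_meas z_L2])
  have Nw: "v \<bullet> N s (w s) = G s v \<bullet> z s" if "s \<in> {0..T}" for s v
    using inner_adjoint[OF G_linear[OF that]] by (simp add: w_def N_Ninv[OF that])
  \<comment> \<open>\<open>N s (w s)\<close> is the adjoint of \<open>G s\<close> applied to
    \<open>z s\<close>, so it is orthogonal to the kernel of \<open>G s\<close> at every
    \<open>s\<close>.\<close>
  have rep: "AE s in lborel. s \<in> {0..T} \<longrightarrow> (\<forall>v. G s v = 0 \<longrightarrow> N s (w s) \<bullet> v = 0)"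
    using Nw by (auto simp: inner_commute[of "N _ (w _)"])
  have kernel: "rk_kernel J0 P G N Phi s t Z = E.duhamel y (\<lambda>\<tau>. G \<tau> (w \<tau>)) s" if s: "s \<in> {0..T}" for s
  proof -
    have "(LINT \<tau>:{0..min s t}|lborel. Phi s \<tau> (G \<tau> (inv (N \<tau>) (adjoint (G \<tau>) (adjoint (Phi t \<tau>) Z)))))
        = (LINT \<tau>:{0..s}|lborel. Phi s \<tau> (G \<tau> (w \<tau>)))"
      unfolding set_lebesgue_integral_def
    proof (rule Bochner_Integration.integral_cong[OF refl])
      fix \<tau>
      show "indicator {0..min s t} \<tau> *\<^sub>R Phi s \<tau> (G \<tau> (inv (N \<tau>) (adjoint (G \<tau>) (adjoint (Phi t \<tau>) Z))))
          = indicator {0..s} \<tau> *\<^sub>R Phi s \<tau> (G \<tau> (w \<tau>))"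
      proof (cases "\<tau> \<in> {0..s} \<and> t < \<tau>")
        case True
        then have \<tau>: "\<tau> \<in> {0..T}" using s by auto
        have "w \<tau> = 0" using True linear_simps(3)[OF op_family_bounded_linear[OF NG \<tau>]] by (simp add: w_def z_def)
        then have "Phi s \<tau> (G \<tau> (w \<tau>)) = 0"
          using True s linear_simps(3)[OF G_linear[OF \<tau>]] linear_simps(3)[OF E.Phi_linear[of \<tau> s]] by auto
        then show ?thesis using True by simp
      qed (auto simp: w_def z_def indicator_def)
    qed
    then show ?thesis by (simp add: rk_kernel_def E.duhamel_def y_def B_def[abs_def])
  qed
  have Y: "rep_control T A G N (\<lambda>s. rk_kernel J0 P G N Phi s t Z) w"
    by (rule rep_control_cong[OF rep_control_duhamel(1)[OF w rep, of y] kernel])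
  then show "(\<lambda>s. rk_kernel J0 P G N Phi s t Z) \<in> Hspace T F G" by (auto simp: Hspace_iff)
  have Y0: "rk_kernel J0 P G N Phi 0 t Z = y"
    using kernel[of 0] rep_control_duhamel(2)[OF w rep, of y] T by simp
  assume "X \<in> Hspace T F G"
  then obtain u where X: "rep_control T A G N X u" by (auto simp: Hspace_iff)
  \<comment> \<open>Here \<open>N\<close> cancels its inverse inside \<open>w\<close>, and the two
    adjoints move onto \<open>u\<close>. What remains is the forcing term of the formula for
    \<open>X t\<close>, tested against \<open>Z\<close>.\<close>
  have "(LINT s:{0..T}|lborel. N s (u s) \<bullet> w s) = (LINT s:{0..t}|lborel. Phi t s (G s (u s)) \<bullet> Z)"
    unfolding set_lebesgue_integral_def
  proof (rule Bochner_Integration.integral_cong[OF refl])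
    fix s
    show "indicator {0..T} s *\<^sub>R (N s (u s) \<bullet> w s) = indicator {0..t} s *\<^sub>R (Phi t s (G s (u s)) \<bullet> Z)"
    proof (cases "s \<in> {0..T}")
      case True
      have "N s (u s) \<bullet> w s = G s (u s) \<bullet> z s" using Nw[OF True, of "u s"] N_sym[OF True] by (simp add: sym_op_def)
      then show ?thesis using True adj[of s "G s (u s)"] by (auto simp: z_def indicator_def)
    qed (use t in \<open>auto simp: indicator_def\<close>)
  qed
  also have "\<dots> = (LINT s:{0..t}|lborel. Phi t s (G s (u s))) \<bullet> Z"
    by (rule set_integral_bounded_linear(2)[OF bounded_linear_inner_left E.Phi_apply_integrable[OF _ _ rep_controlD(3)[OF X]]])
      (use t in auto)
  finally have "ip X (\<lambda>s. rk_kernel J0 P G N Phi s t Z) = B (X 0) \<bullet> y + (LINT s:{0..t}|lborel. Phi t s (G s (u s))) \<bullet> Z"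
    by (simp add: ip_eq[OF X Y] Y0)
  also have "B (X 0) \<bullet> y = Phi t 0 (X 0) \<bullet> Z"
    using adj[of 0 "X 0"] t by (simp add: B_sym y_def B_inv)
  finally show "X t \<bullet> Z = ip X (\<lambda>s. rk_kernel J0 P G N Phi s t Z)"
    using trajectory_eq[OF X t] by (simp add: E.duhamel_def inner_add_left)
qed

lemma RKHS: "RKHS_with_kernel T (Hspace T F G) ip (rk_kernel J0 P G N Phi)"
  using hilbert kernel_reproduces by (simp add: RKHS_with_kernel_def)

end

theorem theorem3p1:
  fixes T :: real
    and F M :: "real \<Rightarrow> 'h::{real_inner,banach,second_countable_topology} \<Rightarrow> 'h"
    and G :: "real \<Rightarrow> 'u::{real_inner,banach,second_countable_topology} \<Rightarrow> 'h"
    and N :: "real \<Rightarrow> 'u \<Rightarrow> 'u"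
    and J0 JT :: "'h \<Rightarrow> 'h"
    and P :: "real \<Rightarrow> 'h \<Rightarrow> 'h"
    and Phi :: "real \<Rightarrow> real \<Rightarrow> 'h \<Rightarrow> 'h"
  assumes T: "0 < T"
    and F: "op_family_Linf T F"
    and G: "op_family_Linf T G"
    and M: "op_family_Linf T M" "\<forall>s\<in>{0..T}. sym_op (M s) \<and> psd_op (M s)"
    and N: "op_family_Linf T N" "\<forall>s\<in>{0..T}. sym_op (N s) \<and> bij (N s)"
           "\<exists>c>0. \<forall>s\<in>{0..T}. \<forall>v. c * (norm v)\<^sup>2 \<le> inner (N s v) v"
    and J0: "bounded_linear J0" "sym_op J0" "psd_op J0" "bij J0"
    and JT: "bounded_linear JT" "sym_op JT" "psd_op JT"
    and P: "\<forall>s\<in>{0..T}. bounded_linear (P s) \<and> sym_op (P s) \<and> psd_op (P s)"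
           "riccati_solution T F G N M JT P"
    and Phi: "evolution_op T (closed_loop F G N P) Phi"
  shows "RKHS_with_kernel T (Hspace T F G) (H_inner T F G N M J0 JT) (rk_kernel J0 P G N Phi)"
proof -
  obtain c where c: "0 < c" "\<And>s v. s \<in> {0..T} \<Longrightarrow> c * (norm v)\<^sup>2 \<le> inner (N s v) v" using N(3) by blast
  \<comment> \<open>Invertibility and nonnegativity of \<open>J0\<close> become a quantitative lower
    bound, which makes \<open>J0 + P 0\<close> coercive and hence invertible.\<close>
  obtain c0 where c0: "0 < c0" "\<And>x. c0 * (norm x)\<^sup>2 \<le> inner (J0 x) x" using psd_bij_coercive[OF J0] by blast
  interpret R: riccati_system T F G N c M P JT
    by (intro riccati_system.intro control_system.intro riccati_system_axioms.intro) (use T F G M N(1,2) P c in auto)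
  interpret kernel_system T F G N c M P JT Phi J0 c0
    by (intro kernel_system.intro evolution_family.intro kernel_system_axioms.intro R.riccati_system_axioms)
      (use T R.A Phi J0 P c0 in auto)
  show ?thesis by (rule RKHS)
qed

end
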